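(* Let $A$ be a CM-order and $L$ an $A$-lattice. Then $L$ is invertible as an $A$-lattice if and only if there exist a fractional $A$-ideal $I\subset A_{\mathbb Q}$ and an element $w\in(A^+_{\mathbb Q})_{\gg0}$ such that (i) $I\bar I=Aw$, and (ii) $L$ and $L_{(I,w)}$ are isomorphic as $A$-lattices.
   Context: A CM-order is a commutative ring $A$ with additive group $\cong\mathbb{Z}^n$, with no non-zero nilpotents, equipped with a ring automorphism $x\mapsto\bar x$ such that $\psi(\bar x)=\overline{\psi(x)}$ for all ring homomorphisms $\psi:A\to\mathbb{C}$. $A_{\mathbb Q}=A\otimes\mathbb{Q}$ (with $\bar{\ }$ extended linearly), $\mathrm{Tr}=\mathrm{Tr}_{A_{\mathbb Q}/\mathbb{Q}}$, $\hat A=\{a\in A_{\mathbb Q}:\mathrm{Tr}(aA)\subset\mathbb{Z}\}$, and $(A^+_{\mathbb Q})_{\gg0}$ is the set of $w\in A_{\mathbb Q}$ with $\psi(w)\in\mathbb{R}_{>0}$ for all ring homomorphisms $\psi:A_{\mathbb Q}\to\mathbb{C}$. A fractional $A$-ideal is a finitely generated $A$-submodule of $A_{\mathbb Q}$ spanning $A_{\mathbb Q}$ over $\mathbb{Q}$. A lattice is a finitely generated free abelian group with a positive definite symmetric $\mathbb{Z}$-valued bilinear form; an $A$-lattice is a lattice with an $A$-module structure such that $\langle ax,y\rangle=\langle x,\bar ay\rangle$; isomorphisms of $A$-lattices are inner-product-preserving $A$-module isomorphisms. For $x,y\in L$, $x\bar y$ denotes the unique $z\in\hat A$ with $\mathrm{Tr}(az)=\langle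 ax,y\rangle$ for all $a\in A$; this gives an $A$-linear map $\varphi_L:L\otimes_A\bar L\to\hat A$, $x\otimes\bar y\mapsto x\bar y$, where $\bar L$ is a copy of $L$ with $A$ acting through $\bar{\ }$. $L$ is invertible if $\varphi_L$ takes values in $A$ and is an $A$-module isomorphism onto $A$. For $I,w$ as in (i), $L_{(I,w)}$ is the $A$-module $I$ with inner product $\langle x,y\rangle=\mathrm{Tr}(x\bar y/w)$. *)

theory Defs
  imports "HOL-Algebra.Algebra" "HOL-Algebra.Algebraic_Closure_Type"
begin

section \<open>Modules\<close>

definition free_finite_rank :: "('a, 'c) ring_scheme \<Rightarrow> bool" where
  "free_finite_rank M \<longleftrightarrow> (\<exists>n::nat. add_monoid M \<cong> free_Abelian_group {..<n})"

definition module_span ::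
    "('r, 'c) ring_scheme \<Rightarrow> ('r, 'm, 'd) module_scheme \<Rightarrow> 'm set \<Rightarrow> 'm set" where
  "module_span R M S = (\<lambda>N. submodule N R M) hull S"

definition module_isos ::
    "('r, 'c) ring_scheme \<Rightarrow> ('r, 'm, 'd) module_scheme \<Rightarrow> ('r, 'n, 'e) module_scheme
      \<Rightarrow> ('m \<Rightarrow> 'n) set" where
  "module_isos R M N = {h \<in> iso (add_monoid M) (add_monoid N).
     \<forall>r\<in>carrier R. \<forall>x\<in>carrier M. h (r \<odot>\<^bsub>M\<^esub> x) = r \<odot>\<^bsub>N\<^esub> h x}"

definition is_coords ::
    "('r, 'c) ring_scheme \<Rightarrow> ('r, 'm, 'd) module_scheme \<Rightarrow> 'm set \<Rightarrow> 'm \<Rightarrow> ('m \<Rightarrow> 'r) \<Rightarrow> bool" where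
  "is_coords R M B x c \<longleftrightarrow>
     c \<in> B \<rightarrow>\<^sub>E carrier R \<and> x = (\<Oplus>\<^bsub>M\<^esub>b\<in>B. c b \<odot>\<^bsub>M\<^esub> b)"

definition is_basis ::
    "('r, 'c) ring_scheme \<Rightarrow> ('r, 'm, 'd) module_scheme \<Rightarrow> 'm set \<Rightarrow> bool" where
  "is_basis R M B \<longleftrightarrow>
     finite B \<and> B \<subseteq> carrier M \<and> (\<forall>x\<in>carrier M. \<exists>!c. is_coords R M B x c)"

text \<open>The trace of an endomorphism of a free module of finite rank: the sum of the diagonal
  entries of its matrix in some basis (over a commutative ring, the choice is immaterial).\<close>

definition endo_trace ::
    "('r, 'c) ring_scheme \<Rightarrow> ('r, 'm, 'd) module_scheme \<Rightarrow> ('m \<Rightarrow> 'm) \<Rightarrow> 'r" where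
  "endo_trace R M f = (let B = (SOME B. is_basis R M B)
     in \<Oplus>\<^bsub>R\<^esub>b\<in>B. (THE c. is_coords R M B (f b) c) b)"


section \<open>Tensor products\<close>

definition tensor_relations ::
    "('r, 'c) ring_scheme \<Rightarrow> ('r, 'm, 'd) module_scheme \<Rightarrow> ('r, 'n, 'e) module_scheme
      \<Rightarrow> ('m \<times> 'n \<Rightarrow>\<^sub>0 int) set" where
  "tensor_relations R M N = generate (free_Abelian_group (carrier M \<times> carrier N))
     ({frag_of (x \<oplus>\<^bsub>M\<^esub> x', y) - frag_of (x, y) - frag_of (x', y) | x x' y.
         x \<in> carrier M \<and> x' \<in> carrier M \<and> y \<in> carrier N} \<union>
      {frag_of (x, y \<oplus>\<^bsub>N\<^esub> y') - frag_of (x, y) - frag_of (x, y') | x y y'.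
         x \<in> carrier M \<and> y \<in> carrier N \<and> y' \<in> carrier N} \<union>
      {frag_of (r \<odot>\<^bsub>M\<^esub> x, y) - frag_of (x, r \<odot>\<^bsub>N\<^esub> y) | r x y.
         r \<in> carrier R \<and> x \<in> carrier M \<and> y \<in> carrier N})"

text \<open>The ring multiplication that the record type \<open>module\<close> carries along is irrelevant for
  modules and left unspecified.\<close>

definition tensor ::
    "('r, 'c) ring_scheme \<Rightarrow> ('r, 'm, 'd) module_scheme \<Rightarrow> ('r, 'n, 'e) module_scheme
      \<Rightarrow> ('r, ('m \<times> 'n \<Rightarrow>\<^sub>0 int) set) module" where
  "tensor R M N =
     (let F = free_Abelian_group (carrier M \<times> carrier N); K = tensor_relations R M N
      in \<lparr>carrier = carrier (F Mod K), monoid.mult = undefined, one = undefined,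
          ring.zero = \<one>\<^bsub>F Mod K\<^esub>, add = monoid.mult (F Mod K),
          module.smult = (\<lambda>r C. \<Union>c\<in>C. K #>\<^bsub>F\<^esub> frag_extend (\<lambda>(x, y). frag_of (r \<odot>\<^bsub>M\<^esub> x, y)) c)\<rparr>)"

text \<open>The homomorphism on a tensor product induced by a bilinear map \<open>\<beta>\<close> into \<open>P\<close>: all
  representatives of a coset have the same image.\<close>

definition tensor_lift ::
    "('p, 'c) ring_scheme \<Rightarrow> ('m \<Rightarrow> 'n \<Rightarrow> 'p) \<Rightarrow> ('m \<times> 'n \<Rightarrow>\<^sub>0 int) set \<Rightarrow> 'p" where
  "tensor_lift P \<beta> C = the_elem
     ((\<lambda>c. \<Oplus>\<^bsub>P\<^esub>p\<in>Poly_Mapping.keys c.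
         add_pow P (Poly_Mapping.lookup c p) (\<beta> (fst p) (snd p))) ` C)"


section \<open>CM-orders\<close>

locale cm_order = cring A for A (structure) +
  fixes bar :: "'a \<Rightarrow> 'a"
  assumes free: "free_finite_rank A"
    and reduced: "\<lbrakk>x \<in> carrier A; x [^] (n::nat) = \<zero>\<rbrakk> \<Longrightarrow> x = \<zero>"
    and bar_iso: "bar \<in> ring_iso A A"
    and bar_cnj: "\<lbrakk>\<psi> \<in> ring_hom A (ring_of_type_algebra :: complex ring); x \<in> carrier A\<rbrakk>
      \<Longrightarrow> \<psi> (bar x) = cnj (\<psi> x)"


subsection \<open>The algebra of fractions with nonzero integer denominators\<close>

text \<open>\<open>A \<otimes> \<rat>\<close> for a ring \<open>A\<close> with torsion-free additive group, as the localization of \<open>A\<close> at the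
  nonzero integers; \<open>qfrac A a m\<close> is \<open>a \<otimes> 1/m\<close>.\<close>

definition qfrac_rel :: "('a, 'c) ring_scheme \<Rightarrow> (('a \<times> int) \<times> ('a \<times> int)) set" where
  "qfrac_rel A = {((a, m), (b, n)). a \<in> carrier A \<and> b \<in> carrier A \<and> m \<noteq> 0 \<and> n \<noteq> 0 \<and>
     add_pow A n a = add_pow A m b}"

definition qfrac :: "('a, 'c) ring_scheme \<Rightarrow> 'a \<Rightarrow> int \<Rightarrow> ('a \<times> int) set" where
  "qfrac A a m = qfrac_rel A `` {(a, m)}"

definition AQ :: "('a, 'c) ring_scheme \<Rightarrow> (rat, ('a \<times> int) set) module" where
  "AQ A = \<lparr>carrier = (carrier A \<times> {m. m \<noteq> 0}) // qfrac_rel A,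
     monoid.mult = (\<lambda>U V. \<Union>(a, m)\<in>U. \<Union>(b, n)\<in>V. qfrac A (a \<otimes>\<^bsub>A\<^esub> b) (m * n)),
     one = qfrac A \<one>\<^bsub>A\<^esub> 1,
     ring.zero = qfrac A \<zero>\<^bsub>A\<^esub> 1,
     add = (\<lambda>U V. \<Union>(a, m)\<in>U. \<Union>(b, n)\<in>V.
       qfrac A (add_pow A n a \<oplus>\<^bsub>A\<^esub> add_pow A m b) (m * n)),
     module.smult = (\<lambda>q U. \<Union>(a, m)\<in>U.
       qfrac A (add_pow A (fst (quotient_of q)) a) (snd (quotient_of q) * m))\<rparr>"

definition AQ_of :: "('a, 'c) ring_scheme \<Rightarrow> 'a \<Rightarrow> ('a \<times> int) set" where
  "AQ_of A a = qfrac A a 1"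

definition AQ_bar :: "('a, 'c) ring_scheme \<Rightarrow> ('a \<Rightarrow> 'a) \<Rightarrow> ('a \<times> int) set \<Rightarrow> ('a \<times> int) set" where
  "AQ_bar A bar U = (\<Union>(a, m)\<in>U. qfrac A (bar a) m)"

definition AQ_trace :: "('a, 'c) ring_scheme \<Rightarrow> ('a \<times> int) set \<Rightarrow> rat" where
  "AQ_trace A x = endo_trace ring_of_type_algebra (AQ A) (\<lambda>y. x \<otimes>\<^bsub>AQ A\<^esub> y)"

definition trace_dual :: "('a, 'c) ring_scheme \<Rightarrow> ('a \<times> int) set set" where
  "trace_dual A = {x \<in> carrier (AQ A). \<forall>a\<in>carrier A. AQ_trace A (x \<otimes>\<^bsub>AQ A\<^esub> AQ_of A a) \<in> \<int>}"

definition totally_positive :: "('a, 'c) ring_scheme \<Rightarrow> ('a \<times> int) set set" where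
  "totally_positive A = {w \<in> carrier (AQ A).
     \<forall>\<psi>\<in>ring_hom (AQ A) (ring_of_type_algebra :: complex ring). \<psi> w \<in> \<real> \<and> 0 < Re (\<psi> w)}"

text \<open>An \<open>A\<close>-submodule \<open>I\<close> of \<open>AQ A\<close>, regarded as an \<open>A\<close>-module.\<close>

definition AQ_sub :: "('a, 'c) ring_scheme \<Rightarrow> ('a \<times> int) set set \<Rightarrow> ('a, ('a \<times> int) set) module" where
  "AQ_sub A I = \<lparr>carrier = I, monoid.mult = monoid.mult (AQ A), one = \<one>\<^bsub>AQ A\<^esub>,
     ring.zero = \<zero>\<^bsub>AQ A\<^esub>, add = add (AQ A), module.smult = (\<lambda>a x. AQ_of A a \<otimes>\<^bsub>AQ A\<^esub> x)\<rparr>"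

definition fractional_ideal :: "('a, 'c) ring_scheme \<Rightarrow> ('a \<times> int) set set \<Rightarrow> bool" where
  "fractional_ideal A I \<longleftrightarrow>
     submodule I A (AQ_sub A (carrier (AQ A))) \<and>
     (\<exists>S. finite S \<and> S \<subseteq> I \<and> module_span A (AQ_sub A (carrier (AQ A))) S = I) \<and>
     module_span (ring_of_type_algebra :: rat ring) (AQ A) I = carrier (AQ A)"

definition principal_frac_ideal :: "('a, 'c) ring_scheme \<Rightarrow> ('a \<times> int) set \<Rightarrow> ('a \<times> int) set set" where
  "principal_frac_ideal A w = (\<lambda>a. AQ_of A a \<otimes>\<^bsub>AQ A\<^esub> w) ` carrier A"


section \<open>Lattices over CM-orders\<close>

text \<open>The form takes rational values, so that the form of \<open>ideal_lattice\<close> below can be written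
  down for arbitrary \<open>I\<close> and \<open>w\<close>; integrality is an axiom of lattices.\<close>

record ('a, 'b) form_module = "('a, 'b) module" +
  ip :: "'b \<Rightarrow> 'b \<Rightarrow> rat"

locale A_lattice = cm_order A bar + module A L
  for A :: "('a, 'c) ring_scheme" (structure) and bar :: "'a \<Rightarrow> 'a"
    and L :: "('a, 'b) form_module" (structure) +
  assumes free_lattice: "free_finite_rank L"
    and ip_Ints: "\<lbrakk>x \<in> carrier L; y \<in> carrier L\<rbrakk> \<Longrightarrow> ip L x y \<in> \<int>"
    and ip_sym: "\<lbrakk>x \<in> carrier L; y \<in> carrier L\<rbrakk> \<Longrightarrow> ip L x y = ip L y x"
    and ip_add: "\<lbrakk>x \<in> carrier L; x' \<in> carrier L; y \<in> carrier L\<rbrakk>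
      \<Longrightarrow> ip L (x \<oplus>\<^bsub>L\<^esub> x') y = ip L x y + ip L x' y"
    and ip_pos: "\<lbrakk>x \<in> carrier L; x \<noteq> \<zero>\<^bsub>L\<^esub>\<rbrakk> \<Longrightarrow> 0 < ip L x x"
    and ip_smult: "\<lbrakk>a \<in> carrier A; x \<in> carrier L; y \<in> carrier L\<rbrakk>
      \<Longrightarrow> ip L (a \<odot>\<^bsub>L\<^esub> x) y = ip L x (bar a \<odot>\<^bsub>L\<^esub> y)"

definition A_lattice_isomorphic ::
    "('a, 'c) ring_scheme \<Rightarrow> ('a, 'b) form_module \<Rightarrow> ('a, 'd) form_module \<Rightarrow> bool" where
  "A_lattice_isomorphic A L M \<longleftrightarrow>
     (\<exists>f\<in>module_isos A L M. \<forall>x\<in>carrier L. \<forall>y\<in>carrier L. ip M (f x) (f y) = ip L x y)"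

text \<open>The element \<open>x \<cdot> bar y\<close> of the trace dual of \<open>A\<close>, for \<open>x\<close> and \<open>y\<close> in the lattice \<open>L\<close>.\<close>

definition x_ybar ::
    "('a, 'c) ring_scheme \<Rightarrow> ('a, 'b) form_module \<Rightarrow> 'b \<Rightarrow> 'b \<Rightarrow> ('a \<times> int) set" where
  "x_ybar A L x y = (THE z. z \<in> trace_dual A \<and>
     (\<forall>a\<in>carrier A. AQ_trace A (AQ_of A a \<otimes>\<^bsub>AQ A\<^esub> z) = ip L (a \<odot>\<^bsub>L\<^esub> x) y))"

definition bar_module ::
    "('a \<Rightarrow> 'a) \<Rightarrow> ('a, 'b) form_module \<Rightarrow> ('a, 'b) form_module" where
  "bar_module bar L = L\<lparr>module.smult := (\<lambda>a x. bar a \<odot>\<^bsub>L\<^esub> x)\<rparr>"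

definition phi_L ::
    "('a, 'c) ring_scheme \<Rightarrow> ('a, 'b) form_module \<Rightarrow> ('b \<times> 'b \<Rightarrow>\<^sub>0 int) set \<Rightarrow> ('a \<times> int) set" where
  "phi_L A L = tensor_lift (AQ A) (x_ybar A L)"

text \<open>\<open>AQ_sub A (AQ_of A ` carrier A)\<close> is \<open>A\<close> itself inside \<open>AQ A\<close>; being an isomorphism onto
  it includes that \<open>phi_L\<close> takes values in \<open>A\<close>.\<close>

definition invertible_A_lattice ::
    "('a, 'c) ring_scheme \<Rightarrow> ('a \<Rightarrow> 'a) \<Rightarrow> ('a, 'b) form_module \<Rightarrow> bool" where
  "invertible_A_lattice A bar L \<longleftrightarrow>
     phi_L A L \<in> module_isos A (tensor A L (bar_module bar L)) (AQ_sub A (AQ_of A ` carrier A))"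

definition ideal_lattice ::
    "('a, 'c) ring_scheme \<Rightarrow> ('a \<Rightarrow> 'a) \<Rightarrow> ('a \<times> int) set set \<Rightarrow> ('a \<times> int) set
      \<Rightarrow> ('a, ('a \<times> int) set) form_module" where
  "ideal_lattice A bar I w = module.extend (AQ_sub A I)
     (form_module.fields (\<lambda>x y.
       AQ_trace A (x \<otimes>\<^bsub>AQ A\<^esub> AQ_bar A bar y \<otimes>\<^bsub>AQ A\<^esub> inv\<^bsub>AQ A\<^esub> w)))"

end

theory Submission
  imports Defs "Jordan_Normal_Form.Schur_Decomposition"
begin

text \<open>The trace of \<open>c ^ k\<close> on \<open>A \<otimes> \<rat>\<close> is the sum of \<open>\<psi> c ^ k\<close> over a list of ring homomorphisms \<open>\<psi>\<close> to
  \<open>\<complex>\<close> in which every value \<open>\<psi> c\<close> occurs; homomorphisms are obtained as normalized common eigenvectors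
  in the space of linear functionals. Hence the trace form is nondegenerate, and a symmetric \<open>u\<close> with
  \<open>Tr (a \<cdot> bar a \<cdot> u) \<ge> 0\<close> for all \<open>a\<close> has \<open>\<psi> u \<ge> 0\<close> for all \<open>\<psi>\<close>.

  If \<open>L\<close> is invertible, injectivity of \<open>\<phi>\<close> forces the rank one identity \<open>(x \<cdot> bar y) z = (z \<cdot> bar y) x\<close>.
  It makes each form \<open>\<psi> (x \<cdot> bar y)\<close> a nonzero Hermitian form of rank one, so some \<open>e \<in> L\<close> is isotropic
  for none of the finitely many \<open>\<psi>\<close>, and \<open>x \<mapsto> x \<cdot> bar e\<close> identifies \<open>L\<close> with \<open>L_(I,w)\<close> for \<open>w = e \<cdot> bar e\<close>.
  Conversely \<open>x \<cdot> bar y\<close> on \<open>L_(I,w)\<close> is \<open>x (bar y) / w\<close>, which satisfies the rank one identity; with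
  \<open>1 = \<Sum> x\<^sub>i \<cdot> bar y\<^sub>i\<close> it gives \<open>x \<otimes> y = (x \<cdot> bar y) \<Sum> x\<^sub>i \<otimes> y\<^sub>i\<close>, so \<open>\<phi>\<close> is injective.\<close>

section \<open>Traces of powers of a complex matrix\<close>

text \<open>The splitting of \<open>AQ A\<close> into number fields is bypassed. Complex polynomials
  cannot be evaluated in a rational algebra, so they act on its complex-valued functionals instead.
  Multiplicities in the resulting lists of character values stay unspecified: the arguments only use
  which values occur, since a sum of nonnegative terms is positive as soon as one term is. The sign
  of a single character is harder to isolate, because a trace sees all characters at once and only
  rational polynomials in an element are available; the other values are suppressed by rational
  approximations to a real polynomial vanishing there. The rank one identity is the pivot. In the
  ideal model it is plain commutativity of multiplication, while for an abstract lattice it also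
  needs that \<open>A\<close> is reduced and the form definite. A vector that is good for one
  character may be isotropic for another, hence the search along the line x + k e with integral
  k.\<close>

lemma trace_comm_mat:
  fixes U V :: "'a::comm_semiring_0 mat"
  assumes "U \<in> carrier_mat n n" "V \<in> carrier_mat n n"
  shows "(\<Sum>i<n. (U * V) $$ (i,i)) = (\<Sum>i<n. (V * U) $$ (i,i))"
proof -
  have "(\<Sum>i<n. (U * V) $$ (i,i)) = (\<Sum>i<n. \<Sum>k<n. U $$ (i,k) * V $$ (k,i))"
    using assms by (auto simp: scalar_prod_def atLeast0LessThan intro!: sum.cong)
  also have "\<dots> = (\<Sum>k<n. \<Sum>i<n. V $$ (k,i) * U $$ (i,k))"
    by (subst sum.swap) (simp add: mult.commute)
  also have "\<dots> = (\<Sum>i<n. (V * U) $$ (i,i))"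
    using assms by (auto simp: scalar_prod_def atLeast0LessThan intro!: sum.cong)
  finally show ?thesis .
qed

lemma upper_triangular_mult:
  fixes U V :: "'a::comm_semiring_1 mat"
  assumes U: "U \<in> carrier_mat n n" "upper_triangular U" and V: "V \<in> carrier_mat n n" "upper_triangular V"
  shows "upper_triangular (U * V)" and "\<And>i. i < n \<Longrightarrow> (U * V) $$ (i,i) = U $$ (i,i) * V $$ (i,i)"
proof -
  have e: "(U * V) $$ (i,j) = (\<Sum>k<n. U $$ (i,k) * V $$ (k,j))" if "i < n" "j < n" for i j
    using U V that by (simp add: scalar_prod_def atLeast0LessThan)
  \<comment> \<open>If k < i the left factor lies below the diagonal; otherwise k > j and the right
    factor does. The last condition leaves out just the term k = i of a diagonal entry.\<close>
  have z: "U $$ (i,k) * V $$ (k,j) = 0" if "j \<le> i" "i < n" "k < n" "k \<noteq> i \<or> j < i" for i j k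
  proof (cases "k < i")
    case True
    then show ?thesis using upper_triangularD[OF U(2), of k i] U that by auto
  next
    case False
    then show ?thesis using upper_triangularD[OF V(2), of j k] V that by auto
  qed
  show "upper_triangular (U * V)"
  proof (rule upper_triangularI)
    fix i j assume "j < i" "i < dim_row (U * V)"
    then show "(U * V) $$ (i,j) = 0"
      using U by (subst e) (auto intro!: sum.neutral z)
  qed
  fix i assume i: "i < n"
  have "(U * V) $$ (i,i) = (\<Sum>k\<in>{i}. U $$ (i,k) * V $$ (k,i))"
    unfolding e[OF i i] by (rule sum.mono_neutral_right) (use i z in auto)
  then show "(U * V) $$ (i,i) = U $$ (i,i) * V $$ (i,i)" by simp
qed

lemma upper_triangular_pow:
  fixes U :: "'a::comm_semiring_1 mat"
  assumes U: "U \<in> carrier_mat n n" "upper_triangular U"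
  shows "upper_triangular (U ^\<^sub>m k) \<and> (\<forall>i<n. (U ^\<^sub>m k) $$ (i,i) = U $$ (i,i) ^ k)"
proof (induction k)
  case 0
  then show ?case using U by auto
next
  case (Suc k)
  then show ?case
    using upper_triangular_mult[of "U ^\<^sub>m k" n U] U by (simp add: mult.commute)
qed

text \<open>Schur triangularization puts the roots of the characteristic polynomial on the diagonal
  of B, powers keep B triangular, and cyclicity of the trace removes the conjugating matrices. The
  list \<open>es\<close> repeats eigenvalues by algebraic multiplicity; only its set is
  exported.\<close>

lemma trace_pow_eigenvalues:
  fixes M :: "complex mat"
  assumes M: "M \<in> carrier_mat n n"
  obtains es where "\<And>k. (\<Sum>i<n. (M ^\<^sub>m k) $$ (i,i)) = (\<Sum>e\<leftarrow>es. e ^ k)" and "set es = {e. eigenvalue M e}"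
proof -
  from char_poly_factorized[OF M] obtain as where
    as: "char_poly M = (\<Prod>a\<leftarrow>as. [:- a, 1:])" by auto
  obtain B P Q where BPQ: "schur_decomposition M as = (B, P, Q)" by (metis prod_cases3)
  from schur_decomposition[OF M as BPQ] have
    sim: "similar_mat_wit M B P Q" and ut: "upper_triangular B" and dg: "diag_mat B = as" by auto
  from similar_mat_witD2[OF M sim] have c: "B \<in> carrier_mat n n" "P \<in> carrier_mat n n" "Q \<in> carrier_mat n n"
    and QP: "Q * P = 1\<^sub>m n" and MB: "M = P * B * Q" by auto
  have pw: "M ^\<^sub>m k = P * B ^\<^sub>m k * Q" for k
  proof (induction k)
    case 0
    from similar_mat_witD2[OF M sim] M c show ?case by simp
  next
    case (Suc k)
    have Bk: "B ^\<^sub>m k \<in> carrier_mat n n" using c by simp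
    have "M ^\<^sub>m Suc k = (P * B ^\<^sub>m k * Q) * (P * B * Q)" using Suc MB by simp
    also have "\<dots> = P * (B ^\<^sub>m k * ((Q * P) * (B * Q)))"
      using c Bk by (simp add: assoc_mult_mat[of _ n n _ n _ n] mult_carrier_mat[of _ n n _ n])
    also have "\<dots> = P * (B ^\<^sub>m k * B) * Q"
      using c Bk unfolding QP by (simp add: assoc_mult_mat[of _ n n _ n _ n] mult_carrier_mat[of _ n n _ n])
    finally show ?case by simp
  qed
  have tr: "(\<Sum>i<n. (M ^\<^sub>m k) $$ (i,i)) = (\<Sum>e\<leftarrow>as. e ^ k)" for k
  proof -
    have Bk: "B ^\<^sub>m k \<in> carrier_mat n n" using c by simp
    have "(\<Sum>i<n. (M ^\<^sub>m k) $$ (i,i)) = (\<Sum>i<n. (P * (B ^\<^sub>m k * Q)) $$ (i,i))"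
      using pw c Bk by (simp add: assoc_mult_mat[of _ n n _ n _ n])
    also have "\<dots> = (\<Sum>i<n. (B ^\<^sub>m k * (Q * P)) $$ (i,i))"
      using c Bk by (subst trace_comm_mat) (auto simp: assoc_mult_mat[of _ n n _ n _ n])
    also have "\<dots> = (\<Sum>i<n. (B $$ (i,i)) ^ k)"
      using upper_triangular_pow[OF c(1) ut, of k] unfolding QP right_mult_one_mat[OF Bk] by simp
    also have "\<dots> = (\<Sum>e\<leftarrow>as. e ^ k)"
      using c dg[symmetric] by (simp add: diag_mat_def sum_list_sum_nth atLeast0LessThan)
    finally show ?thesis .
  qed
  have "set as = {e. eigenvalue M e}"
    unfolding eigenvalue_root_char_poly[OF M] as by (auto simp: poly_prod_list prod_list_zero_iff)
  with tr that show ?thesis by blast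
qed

section \<open>Finite-dimensional commutative algebras over the rationals\<close>

abbreviation complex_ring :: "complex ring" where "complex_ring \<equiv> ring_of_type_algebra"

lemma ring_of_type_algebra_sel [simp]:
  "carrier ring_of_type_algebra = UNIV" "\<one>\<^bsub>ring_of_type_algebra\<^esub> = 1" "\<zero>\<^bsub>ring_of_type_algebra\<^esub> = 0"
  "x \<oplus>\<^bsub>ring_of_type_algebra\<^esub> y = x + y" "x \<otimes>\<^bsub>ring_of_type_algebra\<^esub> y = x * y"
  by (simp_all add: ring_of_type_algebra_def)

text \<open>\<open>co x i\<close> for \<open>i < N\<close> are the coordinates of \<open>x\<close> in some basis.\<close>

locale rat_algebra = cring K for K :: "(rat, 'k) module" (structure) +
  fixes N :: nat and co :: "'k \<Rightarrow> nat \<Rightarrow> rat"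
  assumes smult_closed [simp, intro]: "x \<in> carrier K \<Longrightarrow> q \<odot> x \<in> carrier K"
    and smult_mult: "\<lbrakk>x \<in> carrier K; y \<in> carrier K\<rbrakk> \<Longrightarrow> (q \<odot> x) \<otimes> y = q \<odot> (x \<otimes> y)"
    and co_add: "\<lbrakk>x \<in> carrier K; y \<in> carrier K; i < N\<rbrakk> \<Longrightarrow> co (x \<oplus> y) i = co x i + co y i"
    and co_smult: "\<lbrakk>x \<in> carrier K; i < N\<rbrakk> \<Longrightarrow> co (q \<odot> x) i = q * co x i"
    and co_inj: "\<lbrakk>x \<in> carrier K; y \<in> carrier K; \<And>i. i < N \<Longrightarrow> co x i = co y i\<rbrakk> \<Longrightarrow> x = y"
    and co_surj: "\<exists>x\<in>carrier K. \<forall>i<N. co x i = f i"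
begin

lemma co_zero: "i < N \<Longrightarrow> co \<zero> i = 0"
  using co_add[of \<zero> \<zero> i] by simp

lemma mult_smult: "\<lbrakk>x \<in> carrier K; y \<in> carrier K\<rbrakk> \<Longrightarrow> x \<otimes> (q \<odot> y) = q \<odot> (x \<otimes> y)"
  using smult_mult[of y x q] by (simp add: m_comm)

lemma smult_zero [simp]: "x \<in> carrier K \<Longrightarrow> 0 \<odot> x = \<zero>"
  by (rule co_inj) (auto simp: co_smult co_zero)

definition bs :: "nat \<Rightarrow> 'k" where
  "bs i = (SOME x. x \<in> carrier K \<and> (\<forall>j<N. co x j = of_bool (i = j)))"

lemma bs: "bs i \<in> carrier K" "j < N \<Longrightarrow> co (bs i) j = of_bool (i = j)"
proof -
  have "\<exists>x. x \<in> carrier K \<and> (\<forall>j<N. co x j = of_bool (i = j))"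
    using co_surj[of "\<lambda>j. of_bool (i = j)"] by blast
  from someI_ex[OF this, folded bs_def] show "bs i \<in> carrier K" "j < N \<Longrightarrow> co (bs i) j = of_bool (i = j)" by auto
qed

text \<open>The codomain is an arbitrary field of characteristic 0, so that coordinates and traces
  (rational) and characters (complex) fall under one notion.\<close>

definition lin :: "('k \<Rightarrow> 'f::field_char_0) \<Rightarrow> bool" where
  "lin F \<longleftrightarrow> (\<forall>x\<in>carrier K. \<forall>y\<in>carrier K. F (x \<oplus> y) = F x + F y) \<and> (\<forall>q. \<forall>x\<in>carrier K. F (q \<odot> x) = of_rat q * F x)"

lemma linD:
  assumes "lin F"
  shows "\<lbrakk>x \<in> carrier K; y \<in> carrier K\<rbrakk> \<Longrightarrow> F (x \<oplus> y) = F x + F y"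
    "x \<in> carrier K \<Longrightarrow> F (q \<odot> x) = of_rat q * F x"
  using assms by (auto simp: lin_def)

lemma lin_zero: "lin F \<Longrightarrow> F \<zero> = 0"
  using linD(1)[of F \<zero> \<zero>] by simp

lemma lin_minus: "\<lbrakk>lin F; x \<in> carrier K; y \<in> carrier K\<rbrakk> \<Longrightarrow> F (x \<ominus> y) = F x - F y"
  using linD(1)[of F "x \<ominus> y" y] by (simp add: minus_eq a_assoc l_neg)

text \<open>An element is assembled coordinate by coordinate: after k steps y agrees with x in the
  first k coordinates and is zero in the others. The rule stands in for an expansion of x as a
  finite sum in K.\<close>

lemma coord_induct [consumes 1, case_names zero step]:
  assumes x: "x \<in> carrier K" and z: "P \<zero>"
    and step: "\<And>q i y. \<lbrakk>i < N; y \<in> carrier K; P y\<rbrakk> \<Longrightarrow> P (y \<oplus> q \<odot> bs i)"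
  shows "P x"
proof -
  have "\<exists>y\<in>carrier K. (\<forall>i<N. co y i = (if i < k then co x i else 0)) \<and> P y" for k
  proof (induction k)
    case 0
    then show ?case using z by (auto simp: co_zero intro!: bexI[of _ "\<zero>"])
  next
    case (Suc k)
    then obtain y where y: "y \<in> carrier K" "\<And>i. i < N \<Longrightarrow> co y i = (if i < k then co x i else 0)" "P y" by blast
    show ?case
    proof (cases "k < N")
      case True
      then show ?thesis using y
        by (intro bexI[of _ "y \<oplus> co x k \<odot> bs k"]) (auto simp: co_add co_smult bs step less_Suc_eq)
    next
      case False
      then show ?thesis using y by (intro bexI[of _ y]) auto
    qed
  qed
  then obtain y where "y \<in> carrier K" "\<And>i. i < N \<Longrightarrow> co y i = (if i < N then co x i else 0)" "P y" by blast
  with x co_inj[of x y] show ?thesis by auto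
qed

lemma lin_expand:
  assumes F: "lin F" and x: "x \<in> carrier K"
  shows "F x = (\<Sum>j<N. of_rat (co x j) * F (bs j))"
  using x
proof (induction rule: coord_induct)
  case zero
  then show ?case by (simp add: lin_zero[OF F] co_zero)
next
  case (step q i y)
  have "of_rat (co (y \<oplus> q \<odot> bs i) j) * F (bs j) =
      of_rat (co y j) * F (bs j) + of_bool (i = j) * (of_rat q * F (bs j))" if "j < N" for j
    using that step by (simp add: co_add co_smult bs of_rat_add distrib_right)
  then have "(\<Sum>j<N. of_rat (co (y \<oplus> q \<odot> bs i) j) * F (bs j)) = F y + (\<Sum>j<N. of_bool (i = j) * (of_rat q * F (bs j)))"
    using step by (simp add: sum.distrib)
  also have "(\<Sum>j<N. of_bool (i = j) * (of_rat q * F (bs j))) = of_rat q * F (bs i)"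
    using step by (subst sum.mono_neutral_right[of _ "{i}"]) auto
  finally show ?case using step F by (simp add: linD bs)
qed

lemma lin_co: "i < N \<Longrightarrow> lin (\<lambda>x. co x i)"
  by (auto simp: lin_def co_add co_smult)

lemma lin_mult: "\<lbrakk>lin F; c \<in> carrier K\<rbrakk> \<Longrightarrow> lin (\<lambda>x. F (c \<otimes> x))"
  by (auto simp: lin_def r_distr mult_smult)

text \<open>The functionals form a square matrix G on coordinates; a trivial kernel gives a nonzero
  determinant and hence a right inverse. It serves twice: for inverting elements and for
  representing functionals by the trace form.\<close>

lemma lin_injective_imp_surjective:
  assumes lin: "\<And>i. i < N \<Longrightarrow> lin (\<lambda>x. \<phi> x i)"
    and inj: "\<And>x. \<lbrakk>x \<in> carrier K; \<And>i. i < N \<Longrightarrow> \<phi> x i = 0\<rbrakk> \<Longrightarrow> x = \<zero>"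
  shows "\<exists>x\<in>carrier K. \<forall>i<N. \<phi> x i = (f i :: rat)"
proof -
  define G where "G = mat N N (\<lambda>(i,j). \<phi> (bs j) i)"
  have G: "G \<in> carrier_mat N N" by (simp add: G_def)
  have ex: "\<exists>x\<in>carrier K. \<forall>i<N. \<phi> x i = (G *\<^sub>v v) $ i" if v: "v \<in> carrier_vec N" for v
  proof -
    obtain x where x: "x \<in> carrier K" "\<And>j. j < N \<Longrightarrow> co x j = v $ j" using co_surj[of "\<lambda>j. v $ j"] by blast
    show ?thesis
    proof (intro bexI allI impI)
      fix i assume i: "i < N"
      show "\<phi> x i = (G *\<^sub>v v) $ i"
        using lin_expand[OF lin[OF i] x(1)] i v x(2)
        by (simp add: G_def scalar_prod_def atLeast0LessThan mult.commute)
    qed fact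
  qed
  have "det G \<noteq> 0"
  proof
    assume "det G = 0"
    then obtain v where v: "v \<in> carrier_vec N" "v \<noteq> 0\<^sub>v N" "G *\<^sub>v v = 0\<^sub>v N"
      using det_0_iff_vec_prod_zero_field[OF G] by blast
    obtain x where x: "x \<in> carrier K" "\<And>j. j < N \<Longrightarrow> co x j = v $ j" using co_surj[of "\<lambda>j. v $ j"] by blast
    have "\<phi> x i = 0" if i: "i < N" for i
    proof -
      have "\<phi> x i = (G *\<^sub>v v) $ i" using lin_expand[OF lin[OF i] x(1)] i v(1) x(2)
        by (simp add: G_def scalar_prod_def atLeast0LessThan mult.commute)
      then show ?thesis using v(3) i by simp
    qed
    with inj x have "x = \<zero>" by blast
    with x co_zero v have "v = 0\<^sub>v N" by (intro eq_vecI) auto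
    with v show False by simp
  qed
  then obtain H where H: "H \<in> carrier_mat N N" "G * H = 1\<^sub>m N"
    using det_non_zero_imp_unit[OF G, of "()"] by (auto simp: Units_def ring_mat_def)
  have v: "H *\<^sub>v vec N f \<in> carrier_vec N" using H by simp
  have "G *\<^sub>v (H *\<^sub>v vec N f) = vec N f"
    using assoc_mult_mat_vec[OF G H(1), of "vec N f", symmetric] H by simp
  with ex[OF v] show ?thesis by auto
qed

definition trace :: "'k \<Rightarrow> rat" where
  "trace c = (\<Sum>i<N. co (c \<otimes> bs i) i)"

lemma lin_trace: "lin trace"
  by (simp add: lin_def trace_def bs l_distr co_add smult_mult co_smult sum.distrib sum_distrib_left)

definition mult_mat :: "'k \<Rightarrow> rat mat" where
  "mult_mat c = mat N N (\<lambda>(i,j). co (c \<otimes> bs j) i)"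

lemma mult_mat_carrier [simp]: "mult_mat c \<in> carrier_mat N N"
  by (simp add: mult_mat_def)

lemma co_mult:
  assumes "c \<in> carrier K" "x \<in> carrier K" "i < N"
  shows "co (c \<otimes> x) i = (\<Sum>j<N. co (c \<otimes> bs j) i * co x j)"
  using lin_expand[OF lin_mult[OF lin_co]] assms by (simp add: mult.commute)

lemma mult_mat_mult:
  assumes "c \<in> carrier K" "d \<in> carrier K"
  shows "mult_mat (c \<otimes> d) = mult_mat c * mult_mat d"
  by (rule eq_matI)
    (use assms in \<open>auto simp: mult_mat_def scalar_prod_def atLeast0LessThan m_assoc bs co_mult[of c "d \<otimes> bs _"]\<close>)

lemma mult_mat_one: "mult_mat \<one> = 1\<^sub>m N"
  by (rule eq_matI) (auto simp: mult_mat_def bs)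

lemma mult_mat_pow: "c \<in> carrier K \<Longrightarrow> mult_mat (c [^] (k::nat)) = mult_mat c ^\<^sub>m k"
  by (induction k) (auto simp: mult_mat_one mult_mat_mult carrier_matD[OF mult_mat_carrier])

subsection \<open>Characters\<close>

abbreviation chars :: "('k \<Rightarrow> complex) set" where "chars \<equiv> Ring.ring_hom K complex_ring"

lemma charD:
  assumes "\<psi> \<in> chars"
  shows "\<lbrakk>x \<in> carrier K; y \<in> carrier K\<rbrakk> \<Longrightarrow> \<psi> (x \<oplus> y) = \<psi> x + \<psi> y"
    "\<lbrakk>x \<in> carrier K; y \<in> carrier K\<rbrakk> \<Longrightarrow> \<psi> (x \<otimes> y) = \<psi> x * \<psi> y"
    "\<psi> \<one> = 1"
  using assms by (auto simp: Ring.ring_hom_def)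

lemma lin_times: "lin F \<Longrightarrow> c \<in> carrier K \<Longrightarrow> lin (\<lambda>x. F (x \<otimes> c))"
  by (auto simp: lin_def l_distr smult_mult)

text \<open>The functional x \<mapsto> F (q(c) x). As q has complex coefficients, q(c) is not an
  element of K, but this functional makes sense.\<close>

definition act :: "('k \<Rightarrow> complex) \<Rightarrow> 'k \<Rightarrow> complex poly \<Rightarrow> 'k \<Rightarrow> complex" where
  "act F c q x = (\<Sum>k\<le>Polynomial.degree q. Polynomial.coeff q k * F (c [^] k \<otimes> x))"

lemma act_bound: "Polynomial.degree q \<le> n \<Longrightarrow> act F c q x = (\<Sum>k\<le>n. Polynomial.coeff q k * F (c [^] k \<otimes> x))"
  unfolding act_def by (rule sum.mono_neutral_left) (auto simp: coeff_eq_0)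

lemma act_pCons:
  assumes c: "c \<in> carrier K" "x \<in> carrier K"
  shows "act F c (pCons a q) x = a * F x + act F c q (c \<otimes> x)"
proof -
  have m: "c [^] k \<otimes> c \<otimes> x = c [^] k \<otimes> (c \<otimes> x)" for k :: nat
    using c by (simp add: m_assoc)
  have "act F c (pCons a q) x = (\<Sum>k\<le>Suc (Polynomial.degree q). Polynomial.coeff (pCons a q) k * F (c [^] k \<otimes> x))"
    by (rule act_bound) (simp add: degree_pCons_le)
  also have "\<dots> = a * F x + (\<Sum>k\<le>Polynomial.degree q. Polynomial.coeff q k * F (c [^] k \<otimes> (c \<otimes> x)))"
    unfolding sum.atMost_Suc_shift using c by (simp add: m)
  finally show ?thesis by (simp add: act_def)
qed

lemma act_add: "act F c (p + q) x = act F c p x + act F c q x"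
proof -
  define n where "n = max (Polynomial.degree p) (Polynomial.degree q)"
  have "Polynomial.degree (p + q) \<le> n" "Polynomial.degree p \<le> n" "Polynomial.degree q \<le> n" by (auto simp: n_def degree_add_le)
  then show ?thesis by (simp add: act_bound distrib_right sum.distrib)
qed

lemma act_smult: "act F c (smult a q) x = a * act F c q x"
  unfolding act_bound[OF degree_smult_le] by (simp add: act_def sum_distrib_left mult.assoc)

lemma act_linear_factor:
  assumes c: "c \<in> carrier K" "x \<in> carrier K"
  shows "act F c ([:- \<mu>, 1:] * q) x = act F c q (c \<otimes> x) - \<mu> * act F c q x"
proof -
  have "[:- \<mu>, 1:] * q = smult (- \<mu>) q + pCons 0 q" by simp
  then show ?thesis using c by (simp only: act_add act_smult act_pCons) simp
qed

lemma lin_act: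
  assumes F: "lin F" and c: "c \<in> carrier K"
  shows "lin (act F c q)"
proof -
  have m: "lin (\<lambda>x. F (c [^] k \<otimes> x))" for k :: nat using F c by (simp add: lin_mult)
  show ?thesis unfolding lin_def act_def
    by (auto simp: linD[OF m] sum.distrib distrib_left sum_distrib_left mult_ac)
qed

lemma act_eigen:
  assumes c: "c \<in> carrier K" and b: "b \<in> carrier K" and e: "\<And>x. x \<in> carrier K \<Longrightarrow> F (b \<otimes> x) = l * F x"
    and x: "x \<in> carrier K"
  shows "act F c q (b \<otimes> x) = l * act F c q x"
proof -
  have "F (c [^] k \<otimes> (b \<otimes> x)) = l * F (c [^] k \<otimes> x)" for k :: nat
    using e[of "c [^] k \<otimes> x"] c b x by (simp add: m_lcomm)
  then show ?thesis by (simp add: act_def sum_distrib_left mult_ac)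
qed

text \<open>Write q = (X - \<mu>) p. If p(c) does not kill F, then \<open>act F c p\<close> is an
  eigenvector for \<mu>; if it does, p annihilates F and has smaller degree. The last conjunct says
  that eigenvalues of F under other elements survive, since multiplications commute; this is what
  permits treating one basis element after another.\<close>

lemma eigenfunctional_exists:
  assumes F: "lin F" and nz: "\<exists>x\<in>carrier K. F x \<noteq> 0" and c: "c \<in> carrier K"
    and q: "q \<noteq> 0" and ann: "\<And>x. x \<in> carrier K \<Longrightarrow> act F c q x = 0"
  shows "\<exists>\<mu> G. poly q \<mu> = 0 \<and> lin G \<and> (\<exists>x\<in>carrier K. G x \<noteq> 0) \<and> (\<forall>x\<in>carrier K. G (c \<otimes> x) = \<mu> * G x) \<and>
    (\<forall>b\<in>carrier K. \<forall>l. (\<forall>x\<in>carrier K. F (b \<otimes> x) = l * F x) \<longrightarrow> (\<forall>x\<in>carrier K. G (b \<otimes> x) = l * G x))"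
  using q ann
proof (induction "Polynomial.degree q" arbitrary: q)
  case 0
  then obtain a where a: "q = [:a:]" "a \<noteq> 0" by (metis degree_eq_zeroE pCons_0_0)
  have "F x = 0" if "x \<in> carrier K" for x
    using 0(3)[OF that] that a(2) unfolding a(1) by (simp add: act_def)
  with nz show ?case by auto
next
  case (Suc n)
  then have "\<not> constant (poly q)" by (simp add: constant_degree)
  from fundamental_theorem_of_algebra[OF this] obtain \<mu> where \<mu>: "poly q \<mu> = 0" by blast
  then obtain p where p: "q = [:- \<mu>, 1:] * p" by (metis dvdE poly_eq_0_iff_dvd)
  with Suc have p0: "p \<noteq> 0" by auto
  then have "Polynomial.degree q = Suc (Polynomial.degree p)" by (simp add: p degree_mult_eq del: mult_pCons_left)
  with Suc have dp: "n = Polynomial.degree p" by simp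
  have e: "act F c p (c \<otimes> x) = \<mu> * act F c p x" if "x \<in> carrier K" for x
    using Suc(4)[OF that] act_linear_factor[OF c that, of F \<mu> p] by (simp add: p)
  show ?case
  proof (cases "\<exists>x\<in>carrier K. act F c p x \<noteq> 0")
    case True
    have "\<forall>b\<in>carrier K. \<forall>l. (\<forall>x\<in>carrier K. F (b \<otimes> x) = l * F x) \<longrightarrow>
        (\<forall>x\<in>carrier K. act F c p (b \<otimes> x) = l * act F c p x)"
      using act_eigen[OF c] by blast
    with True \<mu> e lin_act[OF F c] show ?thesis by blast
  next
    case False
    then have "\<And>x. x \<in> carrier K \<Longrightarrow> act F c p x = 0" by blast
    from Suc(1)[OF dp p0 this] obtain \<nu> G where G: "poly p \<nu> = 0" "lin G" "\<exists>x\<in>carrier K. G x \<noteq> 0"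
      "\<forall>x\<in>carrier K. G (c \<otimes> x) = \<nu> * G x" "\<forall>b\<in>carrier K. \<forall>l. (\<forall>x\<in>carrier K. F (b \<otimes> x) = l * F x) \<longrightarrow>
        (\<forall>x\<in>carrier K. G (b \<otimes> x) = l * G x)" by blast
    moreover have "poly q \<nu> = 0" unfolding p poly_mult G(1) by simp
    ultimately show ?thesis by blast
  qed
qed

lemma annihilating_poly:
  assumes c: "c \<in> carrier K"
  obtains p where "p \<noteq> 0" "\<And>F x. \<lbrakk>lin F; x \<in> carrier K\<rbrakk> \<Longrightarrow> act F c p x = 0"
proof -
  \<comment> \<open>Column j holds the coordinates of c to the power j, for N + 1 powers. The zero
    row only makes the matrix square; it forces det G = 0, and a kernel vector is a linear relation
    between the powers.\<close>
  define G where "G = mat (Suc N) (Suc N) (\<lambda>(i,j). if i < N then co (c [^] j) i else 0)"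
  have G: "G \<in> carrier_mat (Suc N) (Suc N)" by (simp add: G_def)
  have "row G N = 0\<^sub>v (Suc N)" by (auto simp: G_def)
  then have "transpose_mat G *\<^sub>v unit_vec (Suc N) N = 0\<^sub>v (Suc N)"
    by (auto simp: G_def)
  then have "det (transpose_mat G) = 0"
    using det_0_iff_vec_prod_zero_field[of "transpose_mat G" "Suc N"] G
    by (metis lessI transpose_carrier_mat unit_vec_carrier unit_vec_nonzero)
  then have "det G = 0" using det_transpose[OF G] by simp
  then obtain v where v: "v \<in> carrier_vec (Suc N)" "v \<noteq> 0\<^sub>v (Suc N)" "G *\<^sub>v v = 0\<^sub>v (Suc N)"
    using det_0_iff_vec_prod_zero_field[OF G] by blast
  define p where "p = (\<Sum>k\<le>N. Polynomial.monom (of_rat (v $ k) :: complex) k)"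
  have cp: "Polynomial.coeff p k = of_rat (v $ k)" if "k \<le> N" for k
    using that by (simp add: p_def coeff_sum)
  have dp: "Polynomial.degree p \<le> N"
    unfolding p_def by (rule degree_sum_le) (auto intro: order_trans[OF degree_monom_le])
  show ?thesis
  proof
    from v obtain k where "k \<le> N" "v $ k \<noteq> 0" by (metis eq_vecI carrier_vecD index_zero_vec less_Suc_eq_le)
    with cp show "p \<noteq> 0" by force
    fix F :: "'k \<Rightarrow> complex" and x assume F: "lin F" and x: "x \<in> carrier K"
    have rel: "(\<Sum>k\<le>N. v $ k * co (c [^] k) i) = 0" if i: "i < N" for i
    proof -
      have "(\<Sum>k\<le>N. v $ k * co (c [^] k) i) = (G *\<^sub>v v) $ i"
        using v(1) i by (simp add: G_def scalar_prod_def atLeast0LessThan lessThan_Suc_atMost mult.commute)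
      then show ?thesis using v(3) i by simp
    qed
    have "act F c p x = (\<Sum>k\<le>N. of_rat (v $ k) * F (c [^] k \<otimes> x))"
      unfolding act_bound[OF dp] using cp by simp
    also have "\<dots> = (\<Sum>k\<le>N. of_rat (v $ k) * (\<Sum>i<N. of_rat (co (c [^] k) i) * F (bs i \<otimes> x)))"
      using lin_expand[OF lin_times[OF F x]] c by simp
    also have "\<dots> = (\<Sum>i<N. of_rat (\<Sum>k\<le>N. v $ k * co (c [^] k) i) * F (bs i \<otimes> x))"
      by (simp add: of_rat_sum of_rat_mult sum_distrib_left sum_distrib_right mult.assoc) (rule sum.swap)
    also have "\<dots> = 0" by (simp add: rel)
    finally show "act F c p x = 0" .
  qed
qed

text \<open>F is turned into an eigenvector of multiplication by \<open>bs 0\<close>,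
  \<open>bs 1\<close>, and so on, hence by every element; the eigenvalue as a function of the
  element is the character. Eigenvalues that F already has are kept, which prescribes the value of
  the character at those elements.\<close>

lemma char_of_functional:
  assumes F: "lin F" and nz: "\<exists>x\<in>carrier K. F x \<noteq> 0"
  obtains \<psi> where "\<psi> \<in> chars"
    "\<And>b l. \<lbrakk>b \<in> carrier K; \<And>x. x \<in> carrier K \<Longrightarrow> F (b \<otimes> x) = l * F x\<rbrakk> \<Longrightarrow> \<psi> b = l"
proof -
  have "\<exists>G. lin G \<and> (\<exists>x\<in>carrier K. G x \<noteq> 0) \<and> (\<forall>i<m. \<exists>l. \<forall>x\<in>carrier K. G (bs i \<otimes> x) = l * G x) \<and>
    (\<forall>b\<in>carrier K. \<forall>l. (\<forall>x\<in>carrier K. F (b \<otimes> x) = l * F x) \<longrightarrow> (\<forall>x\<in>carrier K. G (b \<otimes> x) = l * G x))" for m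
  proof (induction m)
    case 0
    then show ?case using F nz by blast
  next
    case (Suc m)
    then obtain G where G: "lin G" "\<exists>x\<in>carrier K. G x \<noteq> 0"
      and ei: "\<And>i. i < m \<Longrightarrow> \<exists>l. \<forall>x\<in>carrier K. G (bs i \<otimes> x) = l * G x"
      and ef: "\<And>b l. \<lbrakk>b \<in> carrier K; \<forall>x\<in>carrier K. F (b \<otimes> x) = l * F x\<rbrakk> \<Longrightarrow> \<forall>x\<in>carrier K. G (b \<otimes> x) = l * G x"
      by blast
    obtain p where p: "p \<noteq> 0" "\<And>x. x \<in> carrier K \<Longrightarrow> act G (bs m) p x = 0"
      using annihilating_poly[OF bs(1)[of m]] G(1) by metis
    from eigenfunctional_exists[OF G bs(1) p] obtain \<mu> H where
      H: "lin H" "\<exists>x\<in>carrier K. H x \<noteq> 0" "\<forall>x\<in>carrier K. H (bs m \<otimes> x) = \<mu> * H x"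
      "\<And>b l. \<lbrakk>b \<in> carrier K; \<forall>x\<in>carrier K. G (b \<otimes> x) = l * G x\<rbrakk> \<Longrightarrow> \<forall>x\<in>carrier K. H (b \<otimes> x) = l * H x"
      by blast
    have "\<exists>l. \<forall>x\<in>carrier K. H (bs i \<otimes> x) = l * H x" if "i < Suc m" for i
      using that H(3) H(4)[OF bs(1)] ei[of i] less_Suc_eq by metis
    moreover have "\<forall>x\<in>carrier K. H (b \<otimes> x) = l * H x"
      if "b \<in> carrier K" "\<forall>x\<in>carrier K. F (b \<otimes> x) = l * F x" for b l
      using H(4)[OF that(1) ef[OF that]] .
    ultimately show ?case using H by blast
  qed
  from this[of N] obtain G where G: "lin G" "\<exists>x\<in>carrier K. G x \<noteq> 0"
    and ei: "\<And>i. i < N \<Longrightarrow> \<exists>l. \<forall>x\<in>carrier K. G (bs i \<otimes> x) = l * G x"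
    and ef: "\<And>b l. \<lbrakk>b \<in> carrier K; \<forall>x\<in>carrier K. F (b \<otimes> x) = l * F x\<rbrakk> \<Longrightarrow> \<forall>x\<in>carrier K. G (b \<otimes> x) = l * G x"
    by blast
  have "\<exists>l. \<forall>x\<in>carrier K. G (b \<otimes> x) = l * G x" if "b \<in> carrier K" for b
    using that
  proof (induction rule: coord_induct)
    case zero
    then show ?case using lin_zero[OF G(1)] by (intro exI[of _ 0]) auto
  next
    case (step q i y)
    then obtain l l' where "\<forall>x\<in>carrier K. G (y \<otimes> x) = l * G x" "\<forall>x\<in>carrier K. G (bs i \<otimes> x) = l' * G x"
      using ei by blast
    then show ?case using step G(1)
      by (intro exI[of _ "l + of_rat q * l'"]) (auto simp: l_distr smult_mult bs linD algebra_simps)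
  qed
  then obtain \<phi> where \<phi>: "\<And>b x. \<lbrakk>b \<in> carrier K; x \<in> carrier K\<rbrakk> \<Longrightarrow> G (b \<otimes> x) = \<phi> b * G x" by metis
  \<comment> \<open>Evaluation at the unit recovers the eigenvalue: G is determined by its value at
    the unit, so that value is nonzero, and \<phi> b is G b divided by it.\<close>
  have G1: "G b = \<phi> b * G \<one>" if "b \<in> carrier K" for b
    using \<phi>[OF that one_closed] that by simp
  with G have n1: "G \<one> \<noteq> 0" by force
  have eq: "\<phi> b = l" if "b \<in> carrier K" "G b = l * G \<one>" for b l
    using that(2) G1[OF that(1)] n1 by simp
  show ?thesis
  proof
    have "\<phi> (x \<otimes> y) = \<phi> x * \<phi> y" if xy: "x \<in> carrier K" "y \<in> carrier K" for x y
      by (rule eq) (use xy \<phi>[of x y] G1[of y] in auto)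
    moreover have "\<phi> (x \<oplus> y) = \<phi> x + \<phi> y" if xy: "x \<in> carrier K" "y \<in> carrier K" for x y
      by (rule eq) (use xy G1[of x] G1[of y] linD(1)[OF G(1)] in \<open>auto simp: distrib_right\<close>)
    moreover have "\<phi> \<one> = 1" by (rule eq) auto
    ultimately show "\<phi> \<in> chars" by (auto intro!: ring_hom_memI)
    fix b l assume b: "b \<in> carrier K" "\<And>x. x \<in> carrier K \<Longrightarrow> F (b \<otimes> x) = l * F x"
    from ef[OF b(1)] b(2) b(1) have "\<forall>x\<in>carrier K. G (b \<otimes> x) = l * G x" by blast
    from bspec[OF this one_closed] b show "\<phi> b = l" by (intro eq) auto
  qed
qed

end

section \<open>Limits and signs of finite real sums\<close>

lemma sum_list_neg:
  fixes g :: "real \<Rightarrow> real"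
  assumes "\<And>r. r \<in> set rs \<Longrightarrow> g r \<le> 0" "r0 \<in> set rs" "g r0 < 0"
  shows "(\<Sum>r\<leftarrow>rs. g r) < 0"
  using assms
proof (induction rs)
  case (Cons a rs)
  have "(\<Sum>r\<leftarrow>rs. g r) \<le> 0" using Cons(2) by (intro sum_list_nonpos) auto
  moreover have "g a \<le> 0" using Cons(2) by simp
  ultimately show ?case using Cons by (cases "r0 = a") force+
qed simp

text \<open>Needed because polynomials evaluated inside the algebra must have rational roots, while
  the values to be avoided are merely real.\<close>

lemma rat_sequence_tendsto: "\<exists>q::nat \<Rightarrow> rat. (\<lambda>n. of_rat (q n)) \<longlonglongrightarrow> (d::real)"
proof -
  have "\<exists>q::rat. d < of_rat q \<and> of_rat q < d + 1 / Suc n" for n :: nat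
    by (rule of_rat_dense) simp
  then obtain q :: "nat \<Rightarrow> rat" where q: "\<And>n. d < of_rat (q n) \<and> of_rat (q n) < d + 1 / Suc n" by metis
  have "(\<lambda>n. of_rat (q n)) \<longlonglongrightarrow> d"
  proof (rule tendsto_sandwich[of "\<lambda>_. d" _ _ "\<lambda>n. d + 1 / Suc n"])
    show "(\<lambda>n. d + 1 / Suc n) \<longlonglongrightarrow> d"
      using tendsto_add[OF tendsto_const LIMSEQ_inverse_real_of_nat, of d] by (simp add: inverse_eq_divide)
  qed (use q in \<open>auto intro: less_imp_le always_eventually\<close>)
  then show ?thesis by blast
qed

lemma complex_of_real_of_rat: "complex_of_real (of_rat q) = of_rat q"
proof -
  obtain a b where "q = of_int a / of_int b" by (metis quotient_of_div surj_pair)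
  then show ?thesis by (simp add: of_rat_divide)
qed

lemma tendsto_prod_list:
  fixes f :: "'a \<Rightarrow> nat \<Rightarrow> real"
  assumes "\<And>x. x \<in> set xs \<Longrightarrow> f x \<longlonglongrightarrow> g x"
  shows "(\<lambda>n. \<Prod>x\<leftarrow>xs. f x n) \<longlonglongrightarrow> (\<Prod>x\<leftarrow>xs. g x)"
  using assms by (induction xs) (auto intro: tendsto_mult)

lemma tendsto_sum_list:
  fixes f :: "'a \<Rightarrow> nat \<Rightarrow> real"
  assumes "\<And>x. x \<in> set xs \<Longrightarrow> f x \<longlonglongrightarrow> g x"
  shows "(\<lambda>n. \<Sum>x\<leftarrow>xs. f x n) \<longlonglongrightarrow> (\<Sum>x\<leftarrow>xs. g x)"
  using assms by (induction xs) (auto intro: tendsto_add)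

section \<open>Traces as sums of character values\<close>

context rat_algebra
begin

lemma smult_add: "x \<in> carrier K \<Longrightarrow> (q + r) \<odot> x = q \<odot> x \<oplus> r \<odot> x"
  by (rule co_inj) (auto simp: co_add co_smult distrib_right)

lemma smult_smult: "x \<in> carrier K \<Longrightarrow> q \<odot> (r \<odot> x) = (q * r) \<odot> x"
  by (rule co_inj) (auto simp: co_smult)

lemma smult_one: "x \<in> carrier K \<Longrightarrow> 1 \<odot> x = x"
  by (rule co_inj) (auto simp: co_smult)

text \<open>A ring homomorphism to the complex numbers respects rational scalars automatically:
  additivity gives natural and then integer multiples, and multiplying by the denominator settles
  fractions.\<close>

lemma char_smult_one:
  assumes \<psi>: "\<psi> \<in> chars"
  shows "\<psi> (q \<odot> \<one>) = of_rat q"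
proof -
  have add: "\<psi> ((q + r) \<odot> \<one>) = \<psi> (q \<odot> \<one>) + \<psi> (r \<odot> \<one>)" for q r
    using charD(1)[OF \<psi>] by (simp add: smult_add)
  have z: "\<psi> (0 \<odot> \<one>) = 0" using add[of 0 0] by simp
  have nat: "\<psi> ((of_nat n * q) \<odot> \<one>) = of_nat n * \<psi> (q \<odot> \<one>)" for n q
  proof (induction n)
    case (Suc n)
    then show ?case using add[of q "of_nat n * q"] by (simp add: distrib_right)
  qed (use z in simp)
  have min: "\<psi> ((- q) \<odot> \<one>) = - \<psi> (q \<odot> \<one>)" for q
    using add[of q "- q"] z by (simp add: eq_neg_iff_add_eq_0 add.commute)
  have int: "\<psi> ((of_int n * q) \<odot> \<one>) = of_int n * \<psi> (q \<odot> \<one>)" for n q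
  proof (cases n)
    case (nonneg m)
    then show ?thesis using nat[of m q] by simp
  next
    case (neg m)
    then have "of_int n * q = - (of_nat (Suc m) * q)" by (simp only: of_int_minus of_int_of_nat_eq mult_minus_left)
    then show ?thesis using nat[of "Suc m" q] min[of "of_nat (Suc m) * q"] neg by (simp del: of_nat_Suc)
  qed
  obtain a b where ab: "q = of_int a / of_int b" "b > 0"
    by (metis quotient_of_denom_pos quotient_of_div surj_pair)
  have "of_int b * \<psi> (q \<odot> \<one>) = of_int a"
    using int[of b q] int[of a 1] ab charD(3)[OF \<psi>] by (simp add: smult_one)
  then show ?thesis using ab(2) unfolding ab(1) by (simp add: of_rat_divide field_simps)
qed

lemma lin_char: "\<psi> \<in> chars \<Longrightarrow> lin \<psi>"
  using charD[of \<psi>] char_smult_one[of \<psi>] smult_mult[of \<one>]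
  unfolding lin_def by (metis l_one one_closed smult_closed)

text \<open>An eigenvector of the transposed matrix is a functional F with F (c x) = l F x, which
  yields a character taking the value l at c. Conversely the values of a character on the basis form
  such an eigenvector. Transposition leaves the characteristic polynomial unchanged.\<close>

lemma eigenvalue_mult_mat_iff:
  assumes c: "c \<in> carrier K"
  shows "eigenvalue (map_mat of_rat (mult_mat c)) l \<longleftrightarrow> (\<exists>\<psi>\<in>chars. \<psi> c = l)"
proof -
  define M :: "complex mat" where "M = map_mat of_rat (mult_mat c)"
  have M: "M \<in> carrier_mat N N" by (simp add: M_def)
  then have MT: "transpose_mat M \<in> carrier_mat N N" by simp
  have row: "(transpose_mat M *\<^sub>v v) $ j = (\<Sum>i<N. of_rat (co (c \<otimes> bs j) i) * v $ i)"
    if "v \<in> carrier_vec N" "j < N" for v j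
    using that M by (simp add: M_def mult_mat_def scalar_prod_def atLeast0LessThan)
  have "eigenvalue M l \<longleftrightarrow> eigenvalue (transpose_mat M) l"
    using eigenvalue_root_char_poly[OF M] eigenvalue_root_char_poly[OF MT] M by simp
  also have "\<dots> \<longleftrightarrow> (\<exists>\<psi>\<in>chars. \<psi> c = l)"
  proof
    assume "eigenvalue (transpose_mat M) l"
    then obtain v where v: "v \<in> carrier_vec N" "v \<noteq> 0\<^sub>v N" "transpose_mat M *\<^sub>v v = l \<cdot>\<^sub>v v"
      using MT by (auto simp: eigenvalue_def eigenvector_def)
    define F where "F x = (\<Sum>i<N. of_rat (co x i) * v $ i)" for x
    have F: "lin F"
      by (auto simp: lin_def F_def co_add co_smult of_rat_add of_rat_mult sum.distrib distrib_right sum_distrib_left mult.assoc)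
    from v obtain k where k: "k < N" "v $ k \<noteq> 0" by (metis eq_vecI carrier_vecD index_zero_vec)
    have Fb: "F (bs j) = v $ j" if "j < N" for j
      using that by (simp add: F_def bs sum.delta' if_distrib[of of_rat] of_bool_def if_distrib[of "\<lambda>x. x * _"] cong: if_cong)
    have nz: "\<exists>x\<in>carrier K. F x \<noteq> 0" using Fb[OF k(1)] k bs(1) by metis
    have ev: "F (c \<otimes> x) = l * F x" if x: "x \<in> carrier K" for x
    proof -
      have "F (c \<otimes> x) = (\<Sum>j<N. of_rat (co x j) * F (c \<otimes> bs j))"
        using lin_expand[OF lin_mult[OF F c] x] .
      also have "\<dots> = (\<Sum>j<N. of_rat (co x j) * (l * v $ j))"
        using v row[OF v(1)] by (intro sum.cong) (auto simp: F_def)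
      finally show ?thesis by (simp add: F_def sum_distrib_left mult_ac)
    qed
    obtain \<psi> where "\<psi> \<in> chars" "\<psi> c = l" using char_of_functional[OF F nz] c ev by metis
    then show "\<exists>\<psi>\<in>chars. \<psi> c = l" by blast
  next
    assume "\<exists>\<psi>\<in>chars. \<psi> c = l"
    then obtain \<psi> where \<psi>: "\<psi> \<in> chars" "\<psi> c = l" by blast
    define v where "v = vec N (\<lambda>i. \<psi> (bs i))"
    have v: "v \<in> carrier_vec N" by (simp add: v_def)
    have ex: "\<psi> x = (\<Sum>i<N. of_rat (co x i) * v $ i)" if "x \<in> carrier K" for x
      using lin_expand[OF lin_char[OF \<psi>(1)] that] by (simp add: v_def)
    have "v \<noteq> 0\<^sub>v N" using ex[of \<one>] charD(3)[OF \<psi>(1)] by auto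
    moreover have "transpose_mat M *\<^sub>v v = l \<cdot>\<^sub>v v"
    proof (rule eq_vecI)
      fix j assume "j < dim_vec (l \<cdot>\<^sub>v v)"
      then have j: "j < N" by (simp add: v_def)
      have "(transpose_mat M *\<^sub>v v) $ j = \<psi> (c \<otimes> bs j)" using row[OF v j] ex c bs(1) by simp
      then show "(transpose_mat M *\<^sub>v v) $ j = (l \<cdot>\<^sub>v v) $ j"
        using charD(2)[OF \<psi>(1) c bs(1)] \<psi>(2) j by (simp add: v_def)
    qed (simp add: v_def M_def mult_mat_def)
    ultimately show "eigenvalue (transpose_mat M) l"
      using v MT by (auto simp: eigenvalue_def eigenvector_def)
  qed
  finally show ?thesis by (simp add: M_def)
qed

lemma trace_pow_chars:
  assumes c: "c \<in> carrier K"
  obtains es where "\<And>k. of_rat (trace (c [^] (k::nat))) = (\<Sum>e\<leftarrow>es. e ^ k)" "set es = (\<lambda>\<psi>. \<psi> c) ` chars"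
proof -
  define M :: "complex mat" where "M = map_mat of_rat (mult_mat c)"
  have M: "M \<in> carrier_mat N N" by (simp add: M_def)
  obtain es where es: "\<And>k. (\<Sum>i<N. (M ^\<^sub>m k) $$ (i,i)) = (\<Sum>e\<leftarrow>es. e ^ k)" "set es = {e. eigenvalue M e}"
    using trace_pow_eigenvalues[OF M] by blast
  have "of_rat (trace (c [^] k)) = (\<Sum>i<N. (M ^\<^sub>m k) $$ (i,i))" for k :: nat
  proof -
    have "M ^\<^sub>m k = map_mat of_rat (mult_mat (c [^] k))"
      unfolding M_def mult_mat_pow[OF c] by (rule of_rat_hom.mat_hom_pow[OF mult_mat_carrier, symmetric])
    then show ?thesis by (simp add: trace_def mult_mat_def of_rat_sum)
  qed
  moreover have "set es = (\<lambda>\<psi>. \<psi> c) ` chars"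
    unfolding es(2) M_def by (auto simp: eigenvalue_mult_mat_iff[OF c])
  ultimately show ?thesis using es(1) that by simp
qed

lemma char_ext:
  assumes "\<psi> \<in> chars" "\<psi>' \<in> chars" "\<And>i. i < N \<Longrightarrow> \<psi> (bs i) = \<psi>' (bs i)" "x \<in> carrier K"
  shows "\<psi> x = \<psi>' x"
  unfolding lin_expand[OF lin_char[OF assms(1)] assms(4)] lin_expand[OF lin_char[OF assms(2)] assms(4)]
  using assms(3) by simp

text \<open>Functions agreeing on the carrier are identified by \<open>restrict\<close>.\<close>

lemma finite_chars: "finite ((\<lambda>\<psi>. restrict \<psi> (carrier K)) ` chars)"
proof -
  \<comment> \<open>The values at one basis element are eigenvalues, hence finite in number, and the
    values on the whole basis determine a character on the carrier.\<close>
  define V where "V i = (\<lambda>\<psi>. \<psi> (bs i)) ` chars" for i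
  have V: "finite (V i)" for i
    using trace_pow_chars[OF bs(1)[of i]] unfolding V_def by (metis List.finite_set)
  let ?r = "\<lambda>\<phi>. restrict (\<lambda>i. \<phi> (bs i)) {..<N}"
  have "?r ` ((\<lambda>\<psi>. restrict \<psi> (carrier K)) ` chars) \<subseteq> PiE {..<N} V"
    by (auto simp: V_def bs PiE_iff extensional_def split: if_split_asm)
  then have "finite (?r ` ((\<lambda>\<psi>. restrict \<psi> (carrier K)) ` chars))"
    by (rule finite_subset) (simp add: finite_PiE V)
  moreover have "inj_on ?r ((\<lambda>\<psi>. restrict \<psi> (carrier K)) ` chars)"
  proof (rule inj_onI; clarify)
    fix \<psi> \<psi>' assume ch: "\<psi> \<in> chars" "\<psi>' \<in> chars"
      and eq: "?r (restrict \<psi> (carrier K)) = ?r (restrict \<psi>' (carrier K))"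
    have "\<psi> (bs i) = \<psi>' (bs i)" if "i < N" for i
      using fun_cong[OF eq, of i] that by (simp add: bs)
    then show "restrict \<psi> (carrier K) = restrict \<psi>' (carrier K)"
      using char_ext[OF ch] by (auto simp: restrict_def)
  qed
  ultimately show ?thesis by (rule finite_imageD)
qed

end

section \<open>Reduced algebras have enough characters\<close>

locale reduced_rat_algebra = rat_algebra +
  assumes reduced: "\<lbrakk>x \<in> carrier K; x [^] (n::nat) = \<zero>\<rbrakk> \<Longrightarrow> x = \<zero>"
begin

text \<open>Write an annihilating polynomial of c as X ^ k * q with q(0) nonzero. As c is not
  nilpotent, some coordinate functional of c ^ k * x is nonzero, and q(c) kills it. The eigenvalue
  so obtained is a root of q, hence nonzero, and it is the value of a character at c.\<close>

lemma chars_separate_zero: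
  assumes c: "c \<in> carrier K" and nz: "c \<noteq> \<zero>"
  shows "\<exists>\<psi>\<in>chars. \<psi> c \<noteq> 0"
proof -
  obtain p where p: "p \<noteq> 0" "\<And>F x. \<lbrakk>lin F; x \<in> carrier K\<rbrakk> \<Longrightarrow> act F c p x = 0"
    using annihilating_poly[OF c] by blast
  obtain q where q: "p = [:- 0, 1:] ^ order 0 p * q" "\<not> [:- 0, 1:] dvd q" using order_decomp[OF p(1)] by blast
  define k where "k = order 0 p"
  have sh: "act F c ([:- 0, 1:] ^ j * r) x = act F c r (c [^] j \<otimes> x)" if "x \<in> carrier K" for F j r x
    using that
  proof (induction j arbitrary: x)
    case (Suc j)
    have "[:- 0, 1:] ^ Suc j * r = pCons 0 ([:- 0, 1:] ^ j * r)" by simp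
    then show ?case using Suc c by (simp only: act_pCons) (simp add: m_assoc)
  qed simp
  have "c [^] k \<noteq> \<zero>" using reduced c nz by blast
  then obtain i where i: "i < N" "co (c [^] k) i \<noteq> 0"
    using co_inj[of "c [^] k" \<zero>] c by (auto simp: co_zero)
  define F where "F x = (of_rat (co x i) :: complex)" for x
  have F: "lin F" using i by (auto simp: F_def lin_def co_add co_smult of_rat_add of_rat_mult)
  define G where "G x = F (c [^] k \<otimes> x)" for x
  have G: "lin G" unfolding G_def using F c by (simp add: lin_mult)
  have nzG: "\<exists>x\<in>carrier K. G x \<noteq> 0" using i c by (intro bexI[of _ \<one>]) (auto simp: G_def F_def)
  have "act G c q x = 0" if x: "x \<in> carrier K" for x
  proof -
    have "act G c q x = act F c q (c [^] k \<otimes> x)"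
      using c x by (simp add: act_def G_def m_lcomm)
    also have "\<dots> = act F c p x" using sh[OF x, of F k q] q(1) by (simp add: k_def)
    finally show ?thesis using p(2)[OF F x] by simp
  qed
  moreover have "q \<noteq> 0" using q(2) by auto
  ultimately obtain \<mu> H where H: "poly q \<mu> = 0" "lin H" "\<exists>x\<in>carrier K. H x \<noteq> 0" "\<forall>x\<in>carrier K. H (c \<otimes> x) = \<mu> * H x"
    using eigenfunctional_exists[OF G nzG c, of q] by blast
  obtain \<psi> where "\<psi> \<in> chars" "\<psi> c = \<mu>" using char_of_functional[OF H(2,3)] c H(4) by metis
  moreover have "\<mu> \<noteq> 0" using H(1) q(2) poly_eq_0_iff_dvd by blast
  ultimately show ?thesis by blast
qed

lemma chars_separate:
  assumes "x \<in> carrier K" "y \<in> carrier K" "\<And>\<psi>. \<psi> \<in> chars \<Longrightarrow> \<psi> x = \<psi> y"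
  shows "x = y"
proof (rule ccontr)
  assume "x \<noteq> y"
  then have "x \<ominus> y \<noteq> \<zero>" using assms(1,2) by (metis r_right_minus_eq)
  then obtain \<psi> where \<psi>: "\<psi> \<in> chars" "\<psi> (x \<ominus> y) \<noteq> 0"
    using chars_separate_zero[of "x \<ominus> y"] assms(1,2) by auto
  show False
    using \<psi>(2) lin_minus[OF lin_char[OF \<psi>(1)] assms(1,2)] assms(3)[OF \<psi>(1)] by simp
qed

text \<open>An element x with c x = 0 is killed by all characters, so multiplication by c is
  injective, hence surjective, and reaches the unit.\<close>

lemma unit_if_chars_nonzero:
  assumes c: "c \<in> carrier K" and nz: "\<And>\<psi>. \<psi> \<in> chars \<Longrightarrow> \<psi> c \<noteq> 0"
  shows "c \<in> Units K"
proof -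
  have "\<exists>x\<in>carrier K. \<forall>i<N. co (c \<otimes> x) i = co \<one> i"
  proof (rule lin_injective_imp_surjective)
    fix x assume x: "x \<in> carrier K" "\<And>i. i < N \<Longrightarrow> co (c \<otimes> x) i = 0"
    then have "c \<otimes> x = \<zero>" using c by (intro co_inj) (auto simp: co_zero)
    then have "\<psi> c * \<psi> x = 0" if "\<psi> \<in> chars" for \<psi>
      using charD(2)[OF that c x(1)] lin_zero[OF lin_char[OF that]] by simp
    then show "x = \<zero>" using chars_separate_zero[OF x(1)] nz by fastforce
  qed (intro lin_mult[OF lin_co] c)
  then obtain x where x: "x \<in> carrier K" "c \<otimes> x = \<one>" using c by (metis co_inj m_closed one_closed)
  then show ?thesis using c m_comm[OF x(1) c] by (auto simp: Units_def intro!: bexI[of _ x])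
qed

end

section \<open>Conjugation and positivity of the trace form\<close>

locale cm_rat_algebra = reduced_rat_algebra K N co
  for K :: "(rat, 'k) module" (structure) and N co +
  fixes bar :: "'k \<Rightarrow> 'k"
  assumes bar_closed [simp, intro]: "x \<in> carrier K \<Longrightarrow> bar x \<in> carrier K"
    and char_bar: "\<lbrakk>\<psi> \<in> chars; x \<in> carrier K\<rbrakk> \<Longrightarrow> \<psi> (bar x) = cnj (\<psi> x)"
begin

text \<open>Here and in the next two lemmas an identity for conjugation is checked under each
  character, where it is an identity of complex conjugation; characters separate points.\<close>

lemma bar_add: "\<lbrakk>x \<in> carrier K; y \<in> carrier K\<rbrakk> \<Longrightarrow> bar (x \<oplus> y) = bar x \<oplus> bar y"
  by (rule chars_separate) (auto simp: char_bar charD)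

lemma bar_mult: "\<lbrakk>x \<in> carrier K; y \<in> carrier K\<rbrakk> \<Longrightarrow> bar (x \<otimes> y) = bar x \<otimes> bar y"
  by (rule chars_separate) (auto simp: char_bar charD)

lemma bar_bar: "x \<in> carrier K \<Longrightarrow> bar (bar x) = x"
  by (rule chars_separate) (auto simp: char_bar)

lemma char_mult_bar: "\<lbrakk>\<psi> \<in> chars; z \<in> carrier K\<rbrakk> \<Longrightarrow> \<psi> (z \<otimes> bar z) = of_real ((cmod (\<psi> z))\<^sup>2)"
  by (simp add: charD char_bar complex_norm_square[symmetric])

text \<open>The trace is a sum of terms |\<psi> z|^2 in which every character value occurs, and some
  \<psi> z is nonzero.\<close>

lemma trace_mult_bar_pos:
  assumes z: "z \<in> carrier K" "z \<noteq> \<zero>"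
  shows "trace (z \<otimes> bar z) > 0"
proof -
  have c: "z \<otimes> bar z \<in> carrier K" using z by simp
  obtain es where es: "\<And>k. of_rat (trace ((z \<otimes> bar z) [^] (k::nat))) = (\<Sum>e\<leftarrow>es. e ^ k)"
    "set es = (\<lambda>\<psi>. \<psi> (z \<otimes> bar z)) ` chars" using trace_pow_chars[OF c] by blast
  have Re_sum: "Re (sum_list xs) = (\<Sum>x\<leftarrow>xs. Re x)" for xs by (induction xs) auto
  have nn: "Re e \<ge> 0" if "e \<in> set es" for e
  proof -
    obtain \<psi> where "\<psi> \<in> chars" "e = \<psi> (z \<otimes> bar z)" using \<open>e \<in> set es\<close> es(2) by auto
    then show ?thesis using char_mult_bar[of \<psi> z] z(1) by (simp del: of_real_power)
  qed
  obtain \<psi> where \<psi>: "\<psi> \<in> chars" "\<psi> z \<noteq> 0" using chars_separate_zero[OF z] by blast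
  then have m: "\<psi> (z \<otimes> bar z) \<in> set es" "Re (\<psi> (z \<otimes> bar z)) > 0"
    unfolding es(2) by (blast, simp add: char_mult_bar[OF \<psi>(1) z(1)] del: of_real_power)
  have "real_of_rat (trace (z \<otimes> bar z)) = Re (of_rat (trace (z \<otimes> bar z)))"
    by (metis Re_complex_of_real complex_of_real_of_rat)
  also have "\<dots> = (\<Sum>e\<leftarrow>es. Re e)" using es(1)[of 1] c Re_sum by simp
  also have "\<dots> > 0"
    using sum_list_nonneg_eq_0_iff[of "map Re es"] sum_list_nonneg[of "map Re es"] nn m
    by fastforce
  finally show ?thesis by simp
qed

lemma trace_nondegenerate:
  assumes "z \<in> carrier K" "\<And>b. b \<in> carrier K \<Longrightarrow> trace (b \<otimes> z) = 0"
  shows "z = \<zero>"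
  using trace_mult_bar_pos[of z] assms m_comm[of z "bar z"] by (metis bar_closed less_irrefl)

text \<open>Nondegeneracy says that z \<mapsto> (trace (bs i z)) is injective on an N-dimensional
  space, so every vector of values on the basis is attained.\<close>

lemma trace_dual_exists:
  fixes l :: "'k \<Rightarrow> rat"
  assumes ll: "lin l"
  shows "\<exists>z\<in>carrier K. \<forall>b\<in>carrier K. trace (b \<otimes> z) = l b"
proof -
  have lt: "lin (\<lambda>b. trace (b \<otimes> z))" if "z \<in> carrier K" for z
    using lin_times[OF lin_trace that] .
  have "\<exists>z\<in>carrier K. \<forall>i<N. trace (bs i \<otimes> z) = l (bs i)"
  proof (rule lin_injective_imp_surjective)
    fix z assume z: "z \<in> carrier K" "\<And>i. i < N \<Longrightarrow> trace (bs i \<otimes> z) = 0"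
    then show "z = \<zero>" using lin_expand[OF lt[OF z(1)]] by (intro trace_nondegenerate) auto
  qed (simp add: lin_mult lin_trace bs)
  then show ?thesis using lin_expand[OF lt] lin_expand[OF ll] by (metis (no_types, lifting) lessThan_iff sum.cong)
qed

text \<open>Suppose the value r0 of u under \<open>\<psi>0\<close> is negative, and let p be a real
  polynomial vanishing at all other values of u but not at r0. For a = p(u) the trace of a * bar a *
  u would be the sum of p(r)^2 r over the values r with repetition, which is negative. Only p with
  rational roots define elements a, so the inequality is proved for those and carried over to real
  roots by a limit.\<close>

lemma char_pos_if_trace_form_nonneg:
  assumes u: "u \<in> carrier K" "bar u = u"
    and pos: "\<And>a. a \<in> carrier K \<Longrightarrow> trace (a \<otimes> bar a \<otimes> u) \<ge> 0"
    and \<psi>0: "\<psi>0 \<in> chars"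
  shows "\<psi>0 u \<in> \<real> \<and> Re (\<psi>0 u) \<ge> 0"
proof -
  have real: "\<psi> u = of_real (Re (\<psi> u))" if "\<psi> \<in> chars" for \<psi>
    using char_bar[OF that u(1)] u(2) by (metis Reals_cnj_iff of_real_Re)
  obtain es where es: "\<And>k. of_rat (trace (u [^] (k::nat))) = (\<Sum>e\<leftarrow>es. e ^ k)" "set es = (\<lambda>\<psi>. \<psi> u) ` chars"
    using trace_pow_chars[OF u(1)] by blast
  \<comment> \<open>The element is the product of u - t over \<open>ts\<close>. Its trace against
    all powers of u is carried along, since adding a factor raises the exponent by one.\<close>
  have pr: "\<exists>a\<in>carrier K. (\<forall>\<psi>\<in>chars. \<psi> a = (\<Prod>t\<leftarrow>ts. \<psi> u - of_rat t)) \<and>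
    (\<forall>k::nat. of_rat (trace (a \<otimes> u [^] k)) = (\<Sum>e\<leftarrow>es. (\<Prod>t\<leftarrow>ts. e - of_rat t) * e ^ k))" for ts
  proof (induction ts)
    case Nil
    then show ?case using u es(1) by (intro bexI[of _ \<one>]) (auto simp: charD)
  next
    case (Cons t ts)
    then obtain a where a: "a \<in> carrier K" "\<And>\<psi>. \<psi> \<in> chars \<Longrightarrow> \<psi> a = (\<Prod>t\<leftarrow>ts. \<psi> u - of_rat t)"
      "\<And>k::nat. of_rat (trace (a \<otimes> u [^] k)) = (\<Sum>e\<leftarrow>es. (\<Prod>t\<leftarrow>ts. e - of_rat t) * e ^ k)" by blast
    let ?b = "a \<otimes> u \<oplus> (- t) \<odot> a"
    have b: "?b \<in> carrier K" using a u by simp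
    have ch: "\<psi> ?b = (\<Prod>t\<leftarrow>t # ts. \<psi> u - of_rat t)" if "\<psi> \<in> chars" for \<psi>
      using a u linD[OF lin_char[OF that]] charD[OF that] that by (simp add: of_rat_minus algebra_simps)
    have tr: "of_rat (trace (?b \<otimes> u [^] k)) = (\<Sum>e\<leftarrow>es. (\<Prod>t\<leftarrow>t # ts. e - of_rat t) * e ^ k)" for k :: nat
    proof -
      have "?b \<otimes> u [^] k = a \<otimes> u [^] Suc k \<oplus> (- t) \<odot> (a \<otimes> u [^] k)"
        using a u by (simp add: l_distr smult_mult m_assoc m_comm[of u])
      then have "of_rat (trace (?b \<otimes> u [^] k)) =
          (of_rat (trace (a \<otimes> u [^] Suc k)) :: complex) - of_rat t * of_rat (trace (a \<otimes> u [^] k))"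
        using a(1) u(1) linD[OF lin_trace] by (simp add: of_rat_add of_rat_diff of_rat_mult of_rat_minus del: nat_pow_Suc)
      also have "\<dots> = (\<Sum>e\<leftarrow>es. (\<Prod>t\<leftarrow>t # ts. e - of_rat t) * e ^ k)"
        unfolding a(3) sum_list_const_mult[symmetric] sum_list_subtractf[symmetric]
        by (rule arg_cong[of _ _ sum_list]) (auto simp: algebra_simps)
      finally show ?thesis .
    qed
    show ?case by (rule bexI[OF _ b]) (use ch tr in blast)
  qed
  define rs where "rs = map Re es"
  have esr: "e = of_real (Re e)" if "e \<in> set es" for e using that es(2) real by auto
  have nonneg: "0 \<le> (\<Sum>r\<leftarrow>rs. (\<Prod>t\<leftarrow>ts. r - of_rat t)\<^sup>2 * r)" for ts
  proof -
    obtain a where a: "a \<in> carrier K" "\<And>\<psi>. \<psi> \<in> chars \<Longrightarrow> \<psi> a = (\<Prod>t\<leftarrow>ts. \<psi> u - of_rat t)"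
      using pr[of ts] by blast
    \<comment> \<open>Doubling the list yields the square of a. The values of a are real, so b
      equals a * bar a and the assumption on the trace form applies.\<close>
    obtain b where b: "b \<in> carrier K" "\<And>\<psi>. \<psi> \<in> chars \<Longrightarrow> \<psi> b = (\<Prod>t\<leftarrow>ts @ ts. \<psi> u - of_rat t)"
      "\<And>k::nat. of_rat (trace (b \<otimes> u [^] k)) = (\<Sum>e\<leftarrow>es. (\<Prod>t\<leftarrow>ts @ ts. e - of_rat t) * e ^ k)"
      using pr[of "ts @ ts"] by blast
    have prr: "(\<Prod>t\<leftarrow>ts. complex_of_real r - of_rat t) = of_real (\<Prod>t\<leftarrow>ts. r - of_rat t)" for r
      by (induction ts) (auto simp: complex_of_real_of_rat)
    have "a \<otimes> bar a = b"
    proof (rule chars_separate)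
      fix \<psi> assume ch: "\<psi> \<in> chars"
      have "\<psi> (a \<otimes> bar a) = \<psi> a * cnj (\<psi> a)" using ch a(1) by (simp add: charD char_bar)
      also have "cnj (\<psi> a) = \<psi> a"
        using prr[of "Re (\<psi> u)"] a(2)[OF ch] real[OF ch] by (metis complex_cnj_complex_of_real)
      finally show "\<psi> (a \<otimes> bar a) = \<psi> b" using a(2)[OF ch] b(2)[OF ch] by simp
    qed (use a b in auto)
    then have "trace (b \<otimes> u) \<ge> 0" using pos[OF a(1)] by simp
    then have nn: "real_of_rat (trace (b \<otimes> u)) \<ge> 0" by simp
    have "complex_of_real (real_of_rat (trace (b \<otimes> u))) = of_real (\<Sum>r\<leftarrow>rs. (\<Prod>t\<leftarrow>ts. r - of_rat t)\<^sup>2 * r)"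
    proof -
      have "complex_of_real (real_of_rat (trace (b \<otimes> u))) = (\<Sum>e\<leftarrow>es. (\<Prod>t\<leftarrow>ts @ ts. e - of_rat t) * e)"
        using b(3)[of 1] u by (simp add: complex_of_real_of_rat)
      also have "\<dots> = (\<Sum>e\<leftarrow>es. of_real ((\<Prod>t\<leftarrow>ts. Re e - of_rat t)\<^sup>2 * Re e))"
      proof (rule arg_cong[of _ _ sum_list], rule map_cong[OF refl])
        fix e assume "e \<in> set es"
        then obtain r where e: "e = of_real r" using esr by metis
        show "(\<Prod>t\<leftarrow>ts @ ts. e - of_rat t) * e = of_real ((\<Prod>t\<leftarrow>ts. Re e - of_rat t)\<^sup>2 * Re e)"
          unfolding e by (simp add: prr power2_eq_square)
      qed
      also have "\<dots> = of_real (\<Sum>e\<leftarrow>es. (\<Prod>t\<leftarrow>ts. Re e - of_rat t)\<^sup>2 * Re e)"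
        by (induction es) auto
      finally show ?thesis by (simp add: rs_def comp_def)
    qed
    then show ?thesis using nn unfolding of_real_eq_iff by simp
  qed
  define r0 where "r0 = Re (\<psi>0 u)"
  have r0: "r0 \<in> set rs" using \<psi>0 by (auto simp: r0_def rs_def es(2))
  have "r0 \<ge> 0"
  proof (rule ccontr)
    assume neg: "\<not> r0 \<ge> 0"
    \<comment> \<open>As roots these kill every value except r0; repetitions in the list are
      harmless.\<close>
    define ds where "ds = filter (\<lambda>r. r \<noteq> r0) rs"
    obtain q :: "real \<Rightarrow> nat \<Rightarrow> rat" where q: "\<And>d. (\<lambda>n. of_rat (q d n)) \<longlonglongrightarrow> d"
      using rat_sequence_tendsto by metis
    have "(\<lambda>n. \<Sum>r\<leftarrow>rs. (\<Prod>d\<leftarrow>ds. r - of_rat (q d n))\<^sup>2 * r) \<longlonglongrightarrow> (\<Sum>r\<leftarrow>rs. (\<Prod>d\<leftarrow>ds. r - d)\<^sup>2 * r)"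
      by (intro tendsto_sum_list tendsto_mult tendsto_power tendsto_prod_list tendsto_diff tendsto_const q)
    moreover have "(\<Sum>r\<leftarrow>rs. (\<Prod>d\<leftarrow>ds. r - of_rat (q d n))\<^sup>2 * r) \<ge> 0" for n
      using nonneg[of "map (\<lambda>d. q d n) ds"] by (simp add: comp_def)
    ultimately have "(\<Sum>r\<leftarrow>rs. (\<Prod>d\<leftarrow>ds. r - d)\<^sup>2 * r) \<ge> 0" by (intro LIMSEQ_le_const) auto
    moreover have "(\<Sum>r\<leftarrow>rs. (\<Prod>d\<leftarrow>ds. r - d)\<^sup>2 * r) < 0"
    proof (rule sum_list_neg[OF _ r0])
      have nz: "(\<Prod>d\<leftarrow>ds. r0 - d) \<noteq> 0" by (auto simp: prod_list_zero_iff ds_def)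
      then show "(\<Prod>d\<leftarrow>ds. r0 - d)\<^sup>2 * r0 < 0" using neg by (simp add: mult_pos_neg)
      fix r assume r: "r \<in> set rs"
      show "(\<Prod>d\<leftarrow>ds. r - d)\<^sup>2 * r \<le> 0"
      proof (cases "r = r0")
        case True
        then show ?thesis using neg by (simp add: mult_nonneg_nonpos)
      next
        case False
        then have "(\<Prod>d\<leftarrow>ds. r - d) = 0" using r by (auto simp: prod_list_zero_iff ds_def)
        then show ?thesis by (simp only:) simp
      qed
    qed
    ultimately show False by simp
  qed
  then show ?thesis using real[OF \<psi>0] by (metis Reals_of_real r0_def)
qed

end

section \<open>Agreement with the trace in an arbitrarily chosen basis\<close>

context rat_algebra
begin

abbreviation rat_ring :: "rat ring" where "rat_ring \<equiv> ring_of_type_algebra"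

lemma co_finsum:
  assumes "finite B" "\<And>b. b \<in> B \<Longrightarrow> f b \<in> carrier K" "i < N"
  shows "co (finsum K f B) i = (\<Sum>b\<in>B. co (f b) i)"
  using assms
proof (induction B rule: finite_induct)
  case (insert b B)
  then have "f \<in> B \<rightarrow> carrier K" "f b \<in> carrier K" by auto
  with insert show ?case by (simp add: co_add finsum_closed)
qed (simp add: co_zero)

lemma is_coords_iff:
  assumes B: "finite B" "B \<subseteq> carrier K" and x: "x \<in> carrier K"
  shows "is_coords rat_ring K B x c \<longleftrightarrow>
    c \<in> extensional B \<and> (\<forall>i<N. co x i = (\<Sum>b\<in>B. c b * co b i))"
proof -
  have "finsum K (\<lambda>b. c b \<odot> b) B \<in> carrier K" using B by (intro finsum_closed) auto
  moreover have "co (finsum K (\<lambda>b. c b \<odot> b) B) i = (\<Sum>b\<in>B. c b * co b i)" if "i < N" for i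
    using B that by (subst co_finsum) (auto intro!: sum.cong co_smult)
  ultimately show ?thesis using x co_inj unfolding is_coords_def PiE_def by auto
qed

text \<open>Provides the witness which guarantees that the choice inside \<open>endo_trace\<close>
  yields an actual basis.\<close>

lemma is_basis_bs: "is_basis rat_ring K (bs ` {..<N})"
proof -
  let ?B = "bs ` {..<N}"
  have inj: "inj_on bs {..<N}"
  proof (rule inj_onI)
    fix i j assume ij: "i \<in> {..<N}" "j \<in> {..<N}" "bs i = bs j"
    then have "co (bs j) i = 1" using bs(2)[of i i] by simp
    then show "i = j" using bs(2)[of i j] ij by (simp split: if_split_asm)
  qed
  have B: "finite ?B" "?B \<subseteq> carrier K" by (auto simp: bs)
  have s: "(\<Sum>b\<in>?B. c b * co b i) = c (bs i)" if i: "i < N" for c i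
  proof -
    have "(\<Sum>b\<in>?B. c b * co b i) = (\<Sum>j<N. c (bs j) * co (bs j) i)" by (simp add: sum.reindex[OF inj])
    also have "\<dots> = (\<Sum>j\<in>{i}. c (bs j) * co (bs j) i)" using i by (intro sum.mono_neutral_right) (auto simp: bs)
    finally show ?thesis using i by (simp add: bs)
  qed
  have "\<exists>!c. is_coords rat_ring K ?B x c" if x: "x \<in> carrier K" for x
  proof (rule ex1I)
    show "is_coords rat_ring K ?B x (restrict (\<lambda>b. co x (inv_into {..<N} bs b)) ?B)"
      unfolding is_coords_iff[OF B x] by (auto simp: s inv_into_f_f[OF inj])
    fix c assume "is_coords rat_ring K ?B x c"
    then have c: "c \<in> extensional ?B" "\<And>i. i < N \<Longrightarrow> co x i = c (bs i)"
      unfolding is_coords_iff[OF B x] by (auto simp: s)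
    then show "c = restrict (\<lambda>b. co x (inv_into {..<N} bs b)) ?B"
      by (intro extensionalityI[of _ ?B]) (auto simp: inv_into_f_f[OF inj])
  qed
  with B show ?thesis by (simp add: is_basis_def)
qed

text \<open>Passing to the coordinates with respect to a given basis makes the trace used here the
  literal \<^const>\<open>endo_trace\<close>, which is computed in a basis chosen by \<open>SOME\<close>.\<close>

lemma endo_trace_eq:
  obtains M co' where "rat_algebra K M co'"
    "\<And>x. x \<in> carrier K \<Longrightarrow> endo_trace rat_ring K (\<lambda>y. x \<otimes> y) = rat_algebra.trace K M co' x"
proof -
  define B where "B = (SOME B. is_basis rat_ring K B)"
  have "is_basis rat_ring K B" unfolding B_def using is_basis_bs by (rule someI)
  then have B: "finite B" "B \<subseteq> carrier K" and ex: "\<And>x. x \<in> carrier K \<Longrightarrow> \<exists>!c. is_coords rat_ring K B x c"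
    by (auto simp: is_basis_def)
  define C where "C x = (THE c. is_coords rat_ring K B x c)" for x
  have C: "is_coords rat_ring K B x (C x)" if "x \<in> carrier K" for x
    unfolding C_def by (rule theI'[OF ex[OF that]])
  \<comment> \<open>Uniqueness of coordinates: any c satisfying the coordinate equations of x must
    be the chosen function on B. All computations with \<open>C\<close> go through this.\<close>
  have CI: "C x b = c b" if "x \<in> carrier K" "\<And>i. i < N \<Longrightarrow> co x i = (\<Sum>b\<in>B. c b * co b i)" "b \<in> B" for x c b
  proof -
    have "is_coords rat_ring K B x (restrict c B)"
      unfolding is_coords_iff[OF B that(1)] using that(2) by simp
    with ex[OF that(1)] C[OF that(1)] have "C x = restrict c B" by blast
    with that(3) show ?thesis by simp
  qed
  have Cs: "co x i = (\<Sum>b\<in>B. C x b * co b i)" if "x \<in> carrier K" "i < N" for x i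
    using C[OF that(1)] that unfolding is_coords_iff[OF B that(1)] by blast
  \<comment> \<open>The chosen basis is enumerated by its own size M, and the locale is instantiated
    afresh with these coordinates, so no comparison of M with N is involved.\<close>
  obtain e M where e: "bij_betw e {..<M::nat} B" using ex_bij_betw_nat_finite[OF B(1)] by (metis atLeast0LessThan)
  then have eB: "e i \<in> B" if "i < M" for i using that by (auto simp: bij_betw_def)
  define co' where "co' x i = C x (e i)" for x i
  have fs: "finsum K (\<lambda>b. g b \<odot> b) B \<in> carrier K" for g using B by (intro finsum_closed) auto
  have cfs: "co (finsum K (\<lambda>b. g b \<odot> b) B) i = (\<Sum>b\<in>B. g b * co b i)" if "i < N" for g i
    using B that by (subst co_finsum) (auto intro!: sum.cong co_smult)
  have ra: "rat_algebra K M co'"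
  proof unfold_locales
    fix x y i assume xy: "x \<in> carrier K" "y \<in> carrier K" "i < M"
    show "co' (x \<oplus> y) i = co' x i + co' y i"
      unfolding co'_def using xy eB
      by (intro CI) (auto simp: co_add Cs[OF xy(1)] Cs[OF xy(2)] sum.distrib distrib_right)
  next
    fix x q i assume x: "x \<in> carrier K" "i < M"
    show "co' (q \<odot> x) i = q * co' x i"
      unfolding co'_def using x eB
      by (intro CI) (auto simp: co_smult Cs[OF x(1)] sum_distrib_left mult.assoc)
  next
    fix x y assume xy: "x \<in> carrier K" "y \<in> carrier K" and eq: "\<And>i. i < M \<Longrightarrow> co' x i = co' y i"
    have "C x b = C y b" if b: "b \<in> B" for b
    proof -
      from b e obtain i where "i < M" "b = e i" by (auto simp: bij_betw_def)
      then show ?thesis using eq[of i] by (simp add: co'_def)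
    qed
    then show "x = y" using xy by (intro co_inj) (simp_all add: Cs)
  next
    fix f :: "nat \<Rightarrow> rat"
    let ?x = "finsum K (\<lambda>b. f (inv_into {..<M} e b) \<odot> b) B"
    have "co' ?x i = f i" if "i < M" for i
    proof -
      have "co' ?x i = f (inv_into {..<M} e (e i))"
        unfolding co'_def using that eB by (intro CI fs cfs)
      then show ?thesis using e that by (simp add: bij_betw_def inv_into_f_f)
    qed
    then show "\<exists>x\<in>carrier K. \<forall>i<M. co' x i = f i" by (intro bexI[OF _ fs] allI impI)
  qed (auto simp: smult_mult)
  interpret R: rat_algebra K M co' by (rule ra)
  have Rbs: "R.bs i = e i" if i: "i < M" for i
  proof (rule R.co_inj)
    show "e i \<in> carrier K" using eB[OF i] B by blast
    fix j assume j: "j < M"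
    have "co' (e i) j = of_bool (e i = e j)"
      unfolding co'_def
    proof (rule CI)
      show "co (e i) k = (\<Sum>b\<in>B. of_bool (e i = b) * co b k)" for k
        using eB[OF i] B(1) by (simp add: of_bool_def if_distrib[of "\<lambda>x. x * _"] cong: if_cong)
    qed (use eB i j B in auto)
    also have "(e i = e j) = (i = j)" using e i j by (auto simp: bij_betw_def inj_on_def)
    finally show "co' (R.bs i) j = co' (e i) j" using R.bs(2)[OF j, of i] by simp
  qed (rule R.bs)
  have fsr: "finsum rat_ring g D = sum g D" if "finite D" for g :: "'k \<Rightarrow> rat" and D
  proof -
    interpret rr: ring rat_ring by (rule ring_from_type_algebra)
    show ?thesis using that by (induction rule: finite_induct) auto
  qed
  have "endo_trace rat_ring K (\<lambda>y. x \<otimes> y) = R.trace x" if x: "x \<in> carrier K" for x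
  proof -
    have "endo_trace rat_ring K (\<lambda>y. x \<otimes> y) = (\<Sum>b\<in>B. C (x \<otimes> b) b)"
      unfolding endo_trace_def Let_def B_def[symmetric] C_def by (rule fsr[OF B(1)])
    also have "\<dots> = (\<Sum>i<M. C (x \<otimes> e i) (e i))" by (rule sum.reindex_bij_betw[OF e, symmetric])
    finally show ?thesis by (simp add: R.trace_def co'_def Rbs)
  qed
  with ra that show ?thesis by blast
qed

end

section \<open>The algebra of fractions\<close>

lemma UN_eq_const: "\<lbrakk>p \<in> U; \<And>q. q \<in> U \<Longrightarrow> f q = C\<rbrakk> \<Longrightarrow> (\<Union>q\<in>U. f q) = C"
  by auto

context cm_order
begin

text \<open>Integer multiples in \<open>A\<close> are rewritten as ring products with
  \<open>iota k\<close>, so that statements about fractions reduce to commutative ring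
  arithmetic.\<close>

definition iota :: "int \<Rightarrow> 'a" where "iota k = add_pow A k \<one>"

lemma iota_closed [simp, intro]: "iota k \<in> carrier A"
  by (simp add: iota_def)

lemma add_pow_eq_iota: "a \<in> carrier A \<Longrightarrow> add_pow A (k::int) a = iota k \<otimes> a"
  using add_pow_ldistr_int[of \<one> a k] by (simp add: iota_def)

lemma iota_mult: "iota (j * k) = iota j \<otimes> iota k"
  using add.int_pow_pow[of \<one> j k] add_pow_eq_iota[of "iota k" j] by (simp add: iota_def mult.commute)

lemma iota_1 [simp]: "iota 1 = \<one>"
  unfolding iota_def by simp

lemma free_iso:
  obtains n h where "h \<in> iso (add_monoid A) (free_Abelian_group {..<n::nat})"
  using free by (auto simp: free_finite_rank_def is_iso_def)

lemma hom_add_pow: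
  assumes "h \<in> hom (add_monoid A) (free_Abelian_group S)" "a \<in> carrier A"
  shows "h (add_pow A (k::int) a) = frag_cmul k (h a)"
proof -
  interpret group_hom "add_monoid A" "free_Abelian_group S" h
    by (intro group_hom.intro group_hom_axioms.intro a_group group_free_Abelian_group assms(1))
  have "Poly_Mapping.keys (h a) \<subseteq> S" using hom_closed[of a] assms(2) by simp
  then show ?thesis using hom_int_pow[of a k] assms(2) by (simp add: add_pow_def)
qed

text \<open>In a free abelian group a nonzero integer can be cancelled coefficient by coefficient.
  This is what makes the fraction relation transitive.\<close>

lemma torsion_free:
  assumes a: "a \<in> carrier A" "b \<in> carrier A" and m: "m \<noteq> (0::int)" and eq: "iota m \<otimes> a = iota m \<otimes> b"
  shows "a = b"
proof -
  obtain n h where h: "h \<in> iso (add_monoid A) (free_Abelian_group {..<n::nat})" by (rule free_iso)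
  then have hh: "h \<in> hom (add_monoid A) (free_Abelian_group {..<n})" and inj: "inj_on h (carrier A)"
    by (auto simp: iso_def bij_betw_def)
  have "frag_cmul m (h a) = frag_cmul m (h b)"
    using hom_add_pow[OF hh a(1), of m] hom_add_pow[OF hh a(2), of m] eq a by (simp add: add_pow_eq_iota)
  from arg_cong[OF this, of "\<lambda>z. Poly_Mapping.lookup z i" for i] have "m * Poly_Mapping.lookup (h a) i = m * Poly_Mapping.lookup (h b) i" for i
    by simp
  with m have "h a = h b" by (simp add: poly_mapping_eq_iff fun_eq_iff)
  with inj a show ?thesis by (auto dest: inj_onD)
qed

lemma qfrac_rel_iff: "((a, m), (b, n)) \<in> qfrac_rel A \<longleftrightarrow>
    a \<in> carrier A \<and> b \<in> carrier A \<and> m \<noteq> 0 \<and> n \<noteq> 0 \<and> iota n \<otimes> a = iota m \<otimes> b"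
  by (auto simp: qfrac_rel_def add_pow_eq_iota)

lemma equiv_qfrac_rel: "equiv (carrier A \<times> {m. m \<noteq> 0}) (qfrac_rel A)"
proof (rule equivI)
  show "qfrac_rel A \<subseteq> (carrier A \<times> {m. m \<noteq> 0}) \<times> (carrier A \<times> {m. m \<noteq> 0})"
    by (auto simp: qfrac_rel_def)
  show "refl_on (carrier A \<times> {m. m \<noteq> 0}) (qfrac_rel A)"
    by (auto simp: refl_on_def qfrac_rel_def)
  show "sym (qfrac_rel A)" by (auto simp: sym_def qfrac_rel_def)
  show "trans (qfrac_rel A)"
  proof (rule transI; clarify)
    fix a b c m n k assume "((a, m), (b, n)) \<in> qfrac_rel A" "((b, n), (c, k)) \<in> qfrac_rel A"
    then have c: "a \<in> carrier A" "b \<in> carrier A" "c \<in> carrier A" "m \<noteq> 0" "n \<noteq> 0" "k \<noteq> 0"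
      and e: "iota n \<otimes> a = iota m \<otimes> b" "iota k \<otimes> b = iota n \<otimes> c" by (auto simp: qfrac_rel_iff)
    have "iota n \<otimes> (iota k \<otimes> a) = iota k \<otimes> (iota n \<otimes> a)" using c by (simp add: m_lcomm)
    also have "\<dots> = iota m \<otimes> (iota k \<otimes> b)" unfolding e(1) using c by (intro m_lcomm) auto
    also have "\<dots> = iota n \<otimes> (iota m \<otimes> c)" unfolding e(2) using c by (intro m_lcomm) auto
    finally have "iota n \<otimes> (iota k \<otimes> a) = iota n \<otimes> (iota m \<otimes> c)" .
    from torsion_free[OF _ _ \<open>n \<noteq> 0\<close> this] c have "iota k \<otimes> a = iota m \<otimes> c" by blast
    with c show "((a, m), (c, k)) \<in> qfrac_rel A" by (simp add: qfrac_rel_iff)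
  qed
qed

lemma qfrac_eq_iff:
  assumes "a \<in> carrier A" "b \<in> carrier A" "m \<noteq> 0" "n \<noteq> 0"
  shows "qfrac A a m = qfrac A b n \<longleftrightarrow> iota n \<otimes> a = iota m \<otimes> b"
  unfolding qfrac_def using eq_equiv_class_iff[OF equiv_qfrac_rel, of "(a,m)" "(b,n)"] assms
  by (simp add: qfrac_rel_iff)

lemma mem_qfrac: "(b, n) \<in> qfrac A a m \<longleftrightarrow>
    a \<in> carrier A \<and> b \<in> carrier A \<and> m \<noteq> 0 \<and> n \<noteq> 0 \<and> iota n \<otimes> a = iota m \<otimes> b"
  by (simp add: qfrac_def qfrac_rel_iff)

lemma AQ_carrier_iff: "x \<in> carrier (AQ A) \<longleftrightarrow> (\<exists>a m. a \<in> carrier A \<and> m \<noteq> 0 \<and> x = qfrac A a m)"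
  by (auto simp: AQ_def qfrac_def quotient_def)

lemma qfrac_closed [simp, intro]: "\<lbrakk>a \<in> carrier A; m \<noteq> 0\<rbrakk> \<Longrightarrow> qfrac A a m \<in> carrier (AQ A)"
  by (auto simp: AQ_carrier_iff)

lemma qfrac_cases [cases set]:
  assumes "x \<in> carrier (AQ A)"
  obtains a m where "a \<in> carrier A" "m \<noteq> 0" "x = qfrac A a m"
  using assms AQ_carrier_iff by blast

text \<open>The operations of \<open>AQ A\<close> are unions over all representatives. If each
  representative contributes the same set, the union is that set; so well-definedness and evaluation
  are proved together.\<close>

lemma qfrac_UN:
  assumes "a \<in> carrier A" "m \<noteq> 0"
    and "\<And>b n. \<lbrakk>b \<in> carrier A; n \<noteq> 0; iota n \<otimes> a = iota m \<otimes> b\<rbrakk> \<Longrightarrow> f b n = C"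
  shows "(\<Union>(b, n)\<in>qfrac A a m. f b n) = C"
proof (rule UN_eq_const[of "(a, m)"])
  show "(a, m) \<in> qfrac A a m" using assms(1,2) by (simp add: mem_qfrac)
  fix q assume "q \<in> qfrac A a m"
  then show "(case q of (b, n) \<Rightarrow> f b n) = C" by (cases q) (simp add: mem_qfrac assms(3))
qed

lemma AQ_mult:
  assumes a: "a \<in> carrier A" "m \<noteq> 0" "b \<in> carrier A" "n \<noteq> 0"
  shows "qfrac A a m \<otimes>\<^bsub>AQ A\<^esub> qfrac A b n = qfrac A (a \<otimes> b) (m * n)"
proof -
  have "qfrac A (a' \<otimes> b') (m' * n') = qfrac A (a \<otimes> b) (m * n)"
    if a': "a' \<in> carrier A" "m' \<noteq> 0" "iota m' \<otimes> a = iota m \<otimes> a'"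
      and b': "b' \<in> carrier A" "n' \<noteq> 0" "iota n' \<otimes> b = iota n \<otimes> b'" for a' m' b' n'
  proof -
    have "iota (m * n) \<otimes> (a' \<otimes> b') = (iota m \<otimes> a') \<otimes> (iota n \<otimes> b')"
      using a a'(1,2) b'(1,2) by (simp add: iota_mult m_ac)
    also have "\<dots> = iota (m' * n') \<otimes> (a \<otimes> b)"
      unfolding a'(3)[symmetric] b'(3)[symmetric] using a a'(1,2) b'(1,2) by (simp add: iota_mult m_ac)
    finally show ?thesis using a a' b' by (simp add: qfrac_eq_iff)
  qed
  then have "(\<Union>(a', m')\<in>qfrac A a m. \<Union>(b', n')\<in>qfrac A b n. qfrac A (a' \<otimes> b') (m' * n')) = qfrac A (a \<otimes> b) (m * n)"
    by (intro qfrac_UN a)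
  then show ?thesis by (simp add: AQ_def)
qed

lemma AQ_add:
  assumes a: "a \<in> carrier A" "m \<noteq> 0" "b \<in> carrier A" "n \<noteq> 0"
  shows "qfrac A a m \<oplus>\<^bsub>AQ A\<^esub> qfrac A b n = qfrac A (iota n \<otimes> a \<oplus> iota m \<otimes> b) (m * n)"
proof -
  have "qfrac A (add_pow A n' a' \<oplus> add_pow A m' b') (m' * n') = qfrac A (iota n \<otimes> a \<oplus> iota m \<otimes> b) (m * n)"
    if a': "a' \<in> carrier A" "m' \<noteq> 0" "iota m' \<otimes> a = iota m \<otimes> a'"
      and b': "b' \<in> carrier A" "n' \<noteq> 0" "iota n' \<otimes> b = iota n \<otimes> b'" for a' m' b' n'
  proof -
    have "iota (m * n) \<otimes> (iota n' \<otimes> a' \<oplus> iota m' \<otimes> b') =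
        iota n \<otimes> iota n' \<otimes> (iota m \<otimes> a') \<oplus> iota m \<otimes> iota m' \<otimes> (iota n \<otimes> b')"
      using a a'(1,2) b'(1,2) by (simp add: iota_mult r_distr m_ac)
    also have "\<dots> = iota (m' * n') \<otimes> (iota n \<otimes> a \<oplus> iota m \<otimes> b)"
      unfolding a'(3)[symmetric] b'(3)[symmetric] using a a'(1,2) b'(1,2) by (simp add: iota_mult r_distr m_ac)
    finally show ?thesis using a a' b' by (simp add: qfrac_eq_iff add_pow_eq_iota)
  qed
  then have "(\<Union>(a', m')\<in>qfrac A a m. \<Union>(b', n')\<in>qfrac A b n.
      qfrac A (add_pow A n' a' \<oplus> add_pow A m' b') (m' * n')) = qfrac A (iota n \<otimes> a \<oplus> iota m \<otimes> b) (m * n)"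
    by (intro qfrac_UN a)
  then show ?thesis by (simp add: AQ_def)
qed

lemma qfrac_cancel: "\<lbrakk>a \<in> carrier A; m \<noteq> 0; k \<noteq> 0\<rbrakk> \<Longrightarrow> qfrac A (iota k \<otimes> a) (k * m) = qfrac A a m"
  by (simp add: qfrac_eq_iff iota_mult m_ac)

lemma AQ_add_same:
  assumes "a \<in> carrier A" "b \<in> carrier A" "m \<noteq> 0"
  shows "qfrac A a m \<oplus>\<^bsub>AQ A\<^esub> qfrac A b m = qfrac A (a \<oplus> b) m"
proof -
  have "iota m \<otimes> a \<oplus> iota m \<otimes> b = iota m \<otimes> (a \<oplus> b)" using assms by (simp add: r_distr)
  then show ?thesis using assms by (simp add: AQ_add qfrac_cancel)
qed

text \<open>The definition uses the reduced fraction u/v of the scalar; cross multiplication k v = u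
  l carries it to an arbitrary representation k/l.\<close>

lemma AQ_smult:
  assumes a: "a \<in> carrier A" "m \<noteq> 0" and l: "l \<noteq> 0"
  shows "(of_int k / of_int l) \<odot>\<^bsub>AQ A\<^esub> qfrac A a m = qfrac A (iota k \<otimes> a) (l * m)"
proof -
  obtain u v where uv: "quotient_of (of_int k / of_int l) = (u, v)" by force
  then have v: "v > 0" "(of_int k / of_int l :: rat) = of_int u / of_int v"
    by (auto simp: quotient_of_denom_pos quotient_of_div)
  then have "(of_int (k * v) :: rat) = of_int (u * l)" using l by (simp add: field_simps)
  then have kv: "k * v = u * l" by (simp only: of_int_eq_iff)
  have "(of_int k / of_int l) \<odot>\<^bsub>AQ A\<^esub> qfrac A a m = (\<Union>(b, n)\<in>qfrac A a m. qfrac A (add_pow A u b) (v * n))"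
    by (simp add: AQ_def uv)
  also have "\<dots> = qfrac A (iota k \<otimes> a) (l * m)"
  proof (rule qfrac_UN)
    fix b n assume b: "b \<in> carrier A" "n \<noteq> 0" "iota n \<otimes> a = iota m \<otimes> b"
    have "iota (l * m) \<otimes> (iota u \<otimes> b) = iota (u * l) \<otimes> (iota m \<otimes> b)" using a b(1,2) by (simp add: iota_mult m_ac)
    also have "\<dots> = iota (v * n) \<otimes> (iota k \<otimes> a)"
      unfolding kv[symmetric] b(3)[symmetric] using a b(1,2) by (simp add: iota_mult m_ac)
    finally show "qfrac A (add_pow A u b) (v * n) = qfrac A (iota k \<otimes> a) (l * m)"
      using a b v l by (simp add: qfrac_eq_iff add_pow_eq_iota)
  qed (use a in auto)
  finally show ?thesis .
qed

lemma AQ_one: "\<one>\<^bsub>AQ A\<^esub> = qfrac A \<one> 1" and AQ_zero: "\<zero>\<^bsub>AQ A\<^esub> = qfrac A \<zero> 1"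
  by (simp_all add: AQ_def)

lemma AQ_zero': "m \<noteq> 0 \<Longrightarrow> \<zero>\<^bsub>AQ A\<^esub> = qfrac A \<zero> m"
  by (simp add: AQ_zero qfrac_eq_iff)

text \<open>Over one denominator addition is addition of numerators, so the ring axioms descend from
  those of \<open>A\<close>.\<close>

lemma common_denominator:
  assumes "x \<in> carrier (AQ A)" "y \<in> carrier (AQ A)"
  obtains a b m where "a \<in> carrier A" "b \<in> carrier A" "m \<noteq> 0" "x = qfrac A a m" "y = qfrac A b m"
proof -
  obtain a m b n where c: "a \<in> carrier A" "m \<noteq> 0" "x = qfrac A a m" "b \<in> carrier A" "n \<noteq> 0" "y = qfrac A b n"
    using assms by (meson qfrac_cases)
  show ?thesis
    by (rule that[of "iota n \<otimes> a" "iota m \<otimes> b" "n * m"])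
      (use c qfrac_cancel[of a m n] qfrac_cancel[of b n m] in \<open>auto simp: mult.commute\<close>)
qed

lemma common_denominator3:
  assumes "x \<in> carrier (AQ A)" "y \<in> carrier (AQ A)" "z \<in> carrier (AQ A)"
  obtains a b c m where "a \<in> carrier A" "b \<in> carrier A" "c \<in> carrier A" "m \<noteq> 0"
    "x = qfrac A a m" "y = qfrac A b m" "z = qfrac A c m"
proof -
  obtain a b m where c: "a \<in> carrier A" "b \<in> carrier A" "m \<noteq> 0" "x = qfrac A a m" "y = qfrac A b m"
    using assms common_denominator by blast
  obtain d n where d: "d \<in> carrier A" "n \<noteq> 0" "z = qfrac A d n" using assms by (meson qfrac_cases)
  show ?thesis
    by (rule that[of "iota n \<otimes> a" "iota n \<otimes> b" "iota m \<otimes> d" "n * m"])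
      (use c d qfrac_cancel[of a m n] qfrac_cancel[of b m n] qfrac_cancel[of d n m] in \<open>auto simp: mult.commute\<close>)
qed

lemma cring_AQ: "cring (AQ A)"
proof (rule cringI)
  show "abelian_group (AQ A)"
  proof (rule abelian_groupI)
    fix x y assume xy: "x \<in> carrier (AQ A)" "y \<in> carrier (AQ A)"
    obtain a b m where "a \<in> carrier A" "b \<in> carrier A" "m \<noteq> 0" "x = qfrac A a m" "y = qfrac A b m"
      using xy by (rule common_denominator)
    then show "x \<oplus>\<^bsub>AQ A\<^esub> y \<in> carrier (AQ A)" "x \<oplus>\<^bsub>AQ A\<^esub> y = y \<oplus>\<^bsub>AQ A\<^esub> x"
      by (simp_all add: AQ_add_same a_comm)
  next
    fix x y z assume xyz: "x \<in> carrier (AQ A)" "y \<in> carrier (AQ A)" "z \<in> carrier (AQ A)"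
    obtain a b c m where "a \<in> carrier A" "b \<in> carrier A" "c \<in> carrier A" "m \<noteq> 0"
      "x = qfrac A a m" "y = qfrac A b m" "z = qfrac A c m"
      using xyz by (rule common_denominator3)
    then show "x \<oplus>\<^bsub>AQ A\<^esub> y \<oplus>\<^bsub>AQ A\<^esub> z = x \<oplus>\<^bsub>AQ A\<^esub> (y \<oplus>\<^bsub>AQ A\<^esub> z)"
      by (simp add: AQ_add_same a_assoc)
  next
    fix x assume "x \<in> carrier (AQ A)"
    then obtain a m where a: "a \<in> carrier A" "m \<noteq> 0" "x = qfrac A a m" by (rule qfrac_cases)
    show "\<zero>\<^bsub>AQ A\<^esub> \<oplus>\<^bsub>AQ A\<^esub> x = x" using a by (simp add: AQ_zero'[of m] AQ_add_same)
    show "\<exists>y\<in>carrier (AQ A). y \<oplus>\<^bsub>AQ A\<^esub> x = \<zero>\<^bsub>AQ A\<^esub>"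
      using a by (intro bexI[of _ "qfrac A (\<ominus> a) m"]) (simp_all add: AQ_zero'[of m] AQ_add_same l_neg)
  qed (simp add: AQ_zero)
  show "comm_monoid (AQ A)"
  proof (rule comm_monoidI)
    fix x y assume xy: "x \<in> carrier (AQ A)" "y \<in> carrier (AQ A)"
    obtain a b m where "a \<in> carrier A" "b \<in> carrier A" "m \<noteq> 0" "x = qfrac A a m" "y = qfrac A b m"
      using xy by (rule common_denominator)
    then show "x \<otimes>\<^bsub>AQ A\<^esub> y \<in> carrier (AQ A)" "x \<otimes>\<^bsub>AQ A\<^esub> y = y \<otimes>\<^bsub>AQ A\<^esub> x"
      by (simp_all add: AQ_mult m_comm)
  next
    fix x y z assume xyz: "x \<in> carrier (AQ A)" "y \<in> carrier (AQ A)" "z \<in> carrier (AQ A)"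
    obtain a b c m where "a \<in> carrier A" "b \<in> carrier A" "c \<in> carrier A" "m \<noteq> 0"
      "x = qfrac A a m" "y = qfrac A b m" "z = qfrac A c m"
      using xyz by (rule common_denominator3)
    then show "x \<otimes>\<^bsub>AQ A\<^esub> y \<otimes>\<^bsub>AQ A\<^esub> z = x \<otimes>\<^bsub>AQ A\<^esub> (y \<otimes>\<^bsub>AQ A\<^esub> z)"
      by (simp add: AQ_mult m_assoc mult.assoc)
  next
    fix x assume "x \<in> carrier (AQ A)"
    then show "\<one>\<^bsub>AQ A\<^esub> \<otimes>\<^bsub>AQ A\<^esub> x = x" by (rule qfrac_cases) (simp add: AQ_one AQ_mult)
  qed (simp add: AQ_one)
  fix x y z assume xyz: "x \<in> carrier (AQ A)" "y \<in> carrier (AQ A)" "z \<in> carrier (AQ A)"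
  obtain a b c m where "a \<in> carrier A" "b \<in> carrier A" "c \<in> carrier A" "m \<noteq> 0"
    "x = qfrac A a m" "y = qfrac A b m" "z = qfrac A c m"
    using xyz by (rule common_denominator3)
  then show "(x \<oplus>\<^bsub>AQ A\<^esub> y) \<otimes>\<^bsub>AQ A\<^esub> z = x \<otimes>\<^bsub>AQ A\<^esub> z \<oplus>\<^bsub>AQ A\<^esub> y \<otimes>\<^bsub>AQ A\<^esub> z"
    by (simp add: AQ_add_same AQ_mult l_distr)
qed

lemma rat_cases: obtains k l where "l \<noteq> 0" "q = (of_int k / of_int l :: rat)"
  using quotient_of_div quotient_of_denom_pos by (metis less_irrefl prod.collapse)

text \<open>A basis of the free abelian group \<open>A\<close> becomes a rational basis: the
  coordinates of a/m are the integer coordinates of a divided by m.\<close>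

lemma rat_algebra_AQ: obtains n co where "rat_algebra (AQ A) n co"
proof -
  obtain n h where h: "h \<in> iso (add_monoid A) (free_Abelian_group {..<n::nat})" by (rule free_iso)
  then have hh: "h \<in> hom (add_monoid A) (free_Abelian_group {..<n})" and inj: "inj_on h (carrier A)"
    and sur: "h ` carrier A = carrier (free_Abelian_group {..<n})"
    by (auto simp: iso_def bij_betw_def)
  have hk: "h (iota k \<otimes> a) = frag_cmul k (h a)" if "a \<in> carrier A" for k a
    using hom_add_pow[OF hh that, of k] that by (simp add: add_pow_eq_iota)
  have ha: "h (a \<oplus> b) = h a + h b" if "a \<in> carrier A" "b \<in> carrier A" for a b
    using hom_mult[OF hh, of a b] that by simp
  \<comment> \<open>The coordinates are read off a chosen representative; the next fact shows that
    any representative gives the same result.\<close>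
  define co where "co x i = (case (SOME (a, m). a \<in> carrier A \<and> m \<noteq> 0 \<and> x = qfrac A a m) of
    (a, m) \<Rightarrow> of_int (Poly_Mapping.lookup (h a) i) / (of_int m :: rat))" for x i
  have co: "co (qfrac A a m) i = of_int (Poly_Mapping.lookup (h a) i) / of_int m" if a: "a \<in> carrier A" "m \<noteq> 0" for a m i
  proof -
    obtain b k where bk: "(SOME (b, k). b \<in> carrier A \<and> k \<noteq> 0 \<and> qfrac A a m = qfrac A b k) = (b, k)" by force
    have "case (b, k) of (b, k) \<Rightarrow> b \<in> carrier A \<and> k \<noteq> 0 \<and> qfrac A a m = qfrac A b k"
      unfolding bk[symmetric] by (rule someI[of _ "(a, m)"]) (use a in simp)
    then have b: "b \<in> carrier A" "k \<noteq> 0" "iota k \<otimes> a = iota m \<otimes> b" using a by (auto simp: qfrac_eq_iff)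
    have "frag_cmul k (h a) = frag_cmul m (h b)" using hk[OF a(1), of k] hk[OF b(1), of m] b(3) by simp
    from arg_cong[OF this, of "\<lambda>z. Poly_Mapping.lookup z i"] have "k * Poly_Mapping.lookup (h a) i = m * Poly_Mapping.lookup (h b) i" by simp
    then have "(of_int k * of_int (Poly_Mapping.lookup (h a) i) :: rat) = of_int m * of_int (Poly_Mapping.lookup (h b) i)"
      by (metis of_int_mult)
    then show ?thesis using a b by (simp add: co_def bk field_simps)
  qed
  have "rat_algebra (AQ A) n co"
  proof (intro rat_algebra.intro cring_AQ rat_algebra_axioms.intro)
    fix q x assume x: "x \<in> carrier (AQ A)"
    obtain a m where "a \<in> carrier A" "m \<noteq> 0" "x = qfrac A a m" using x by (rule qfrac_cases)
    then show "q \<odot>\<^bsub>AQ A\<^esub> x \<in> carrier (AQ A)"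
      by (cases q rule: rat_cases) (simp add: AQ_smult)
  next
    fix q x y assume xy: "x \<in> carrier (AQ A)" "y \<in> carrier (AQ A)"
    obtain a b m where "a \<in> carrier A" "b \<in> carrier A" "m \<noteq> 0" "x = qfrac A a m" "y = qfrac A b m"
      using xy by (rule common_denominator)
    then show "q \<odot>\<^bsub>AQ A\<^esub> x \<otimes>\<^bsub>AQ A\<^esub> y = q \<odot>\<^bsub>AQ A\<^esub> (x \<otimes>\<^bsub>AQ A\<^esub> y)"
      by (cases q rule: rat_cases) (simp add: AQ_smult AQ_mult m_assoc mult.assoc)
  next
    fix x y i assume xy: "x \<in> carrier (AQ A)" "y \<in> carrier (AQ A)"
    obtain a b m where "a \<in> carrier A" "b \<in> carrier A" "m \<noteq> 0" "x = qfrac A a m" "y = qfrac A b m"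
      using xy by (rule common_denominator)
    then show "co (x \<oplus>\<^bsub>AQ A\<^esub> y) i = co x i + co y i"
      by (simp add: AQ_add_same co ha lookup_add add_divide_distrib)
  next
    fix q x i assume x: "x \<in> carrier (AQ A)"
    obtain a m where "a \<in> carrier A" "m \<noteq> 0" "x = qfrac A a m" using x by (rule qfrac_cases)
    then show "co (q \<odot>\<^bsub>AQ A\<^esub> x) i = q * co x i"
      by (cases q rule: rat_cases) (simp add: AQ_smult co hk)
  next
    fix x y assume xy: "x \<in> carrier (AQ A)" "y \<in> carrier (AQ A)" and eq: "\<And>i. i < n \<Longrightarrow> co x i = co y i"
    obtain a b m where ab: "a \<in> carrier A" "b \<in> carrier A" "m \<noteq> 0" "x = qfrac A a m" "y = qfrac A b m"
      using xy by (rule common_denominator)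
    have "h a \<in> carrier (free_Abelian_group {..<n})" "h b \<in> carrier (free_Abelian_group {..<n})" using ab sur by blast+
    then have "Poly_Mapping.lookup (h a) i = Poly_Mapping.lookup (h b) i" for i
    proof (cases "i < n")
      case True
      then show ?thesis using eq[OF True] ab by (simp add: co)
    next
      case False
      then show ?thesis
        using \<open>h a \<in> _\<close> \<open>h b \<in> _\<close> by (metis carrier_free_Abelian_group_iff in_keys_iff lessThan_iff subsetD)
    qed
    then have "h a = h b" by (simp add: poly_mapping_eq_iff fun_eq_iff)
    with inj ab show "x = y" by (auto dest: inj_onD)
  next
    fix f :: "nat \<Rightarrow> rat"
    \<comment> \<open>A common denominator of the prescribed coordinates: times D they become
      integers, hence coordinates of some a in \<open>A\<close>, and a/D is the element
      sought.\<close>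
    define D where "D = (\<Prod>i<n. snd (quotient_of (f i)))"
    have D: "D \<noteq> 0" unfolding D_def using quotient_of_denom_pos' by (metis finite_lessThan less_irrefl prod_zero_iff)
    have "\<exists>z. f i * of_int D = of_int z" if "i < n" for i
    proof -
      have "snd (quotient_of (f i)) dvd D" unfolding D_def using that by (intro dvd_prodI) auto
      then obtain w where w: "D = snd (quotient_of (f i)) * w" by (elim dvdE)
      have "f i = of_int (fst (quotient_of (f i))) / of_int (snd (quotient_of (f i)))"
        using quotient_of_div by (metis prod.collapse)
      moreover have "(of_int (snd (quotient_of (f i))) :: rat) \<noteq> 0"
        using quotient_of_denom_pos'[of "f i"] by simp
      ultimately have "f i * of_int D = of_int (fst (quotient_of (f i)) * w)"
        unfolding w by (simp add: field_simps)
      then show ?thesis by blast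
    qed
    then obtain z where z: "\<And>i. i < n \<Longrightarrow> f i * of_int D = of_int (z i)" by metis
    define c where "c = (\<Sum>i<n. frag_cmul (z i) (frag_of i))"
    have lk: "Poly_Mapping.lookup c i = z i" if "i < n" for i
      using that by (simp add: c_def lookup_sum lookup_frag_of if_distrib[of "\<lambda>x. _ * x"] cong: if_cong)
    have "c \<in> carrier (free_Abelian_group {..<n})"
      unfolding c_def
    proof (rule sum_closed_free_Abelian_group)
      fix i assume "i \<in> {..<n}"
      then show "frag_cmul (z i) (frag_of i) \<in> carrier (free_Abelian_group {..<n})"
        using keys_cmul[of "z i" "frag_of i"] by simp blast
    qed
    then obtain a where a: "a \<in> carrier A" "h a = c" unfolding sur[symmetric] by (metis imageE)
    show "\<exists>x\<in>carrier (AQ A). \<forall>i<n. co x i = f i"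
    proof (intro bexI allI impI)
      fix i assume "i < n"
      then show "co (qfrac A a D) i = f i" using a D lk z[of i] by (simp add: co field_simps)
    qed (use a D in auto)
  qed
  then show ?thesis by (rule that)
qed

end

section \<open>Invariance of the trace under conjugation\<close>

context cm_rat_algebra
begin

lemma bar_smult: "x \<in> carrier K \<Longrightarrow> bar (q \<odot> x) = q \<odot> bar x"
proof (rule chars_separate)
  fix \<psi> assume x: "x \<in> carrier K" and ch: "\<psi> \<in> chars"
  have "cnj (of_rat q) = of_rat q" by (metis complex_cnj_complex_of_real complex_of_real_of_rat)
  then show "\<psi> (bar (q \<odot> x)) = \<psi> (q \<odot> bar x)"
    using x ch by (simp add: char_bar linD(2)[OF lin_char])
qed auto

text \<open>Multiplication by bar v is multiplication by v conjugated by the rational linear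
  involution \<open>bar\<close>, and conjugate endomorphisms have equal trace.\<close>

lemma trace_bar:
  assumes v: "v \<in> carrier K"
  shows "trace (bar v) = trace v"
proof -
  \<comment> \<open>The matrix of \<open>bar\<close>, which is its own inverse.\<close>
  define S where "S i j = co (bar (bs j)) i" for i j
  have lb: "lin (\<lambda>x. co (bar x) i)" if "i < N" for i
    using that by (auto simp: lin_def bar_add bar_smult co_add co_smult)
  have S: "co (bar x) i = (\<Sum>k<N. S i k * co x k)" if "x \<in> carrier K" "i < N" for x i
    using lin_expand[OF lb[OF that(2)] that(1)] by (simp add: S_def mult.commute)
  have SS: "(\<Sum>i<N. S l i * S i k) = of_bool (k = l)" if "k < N" "l < N" for k l
    using S[of "bar (bs k)" l] that bs by (simp add: S_def bar_bar)
  have e: "co (bar v \<otimes> bs i) i = (\<Sum>k<N. \<Sum>l<N. co (v \<otimes> bs l) k * (S l i * S i k))" if i: "i < N" for i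
  proof -
    have "bar v \<otimes> bs i = bar (v \<otimes> bar (bs i))" using v bs by (simp add: bar_mult bar_bar)
    then have "co (bar v \<otimes> bs i) i = (\<Sum>k<N. S i k * co (v \<otimes> bar (bs i)) k)"
      using S[of "v \<otimes> bar (bs i)" i] v bs i by simp
    also have "\<dots> = (\<Sum>k<N. S i k * (\<Sum>l<N. co (v \<otimes> bs l) k * S l i))"
      using co_mult[OF v, of "bar (bs i)"] bs by (simp add: S_def)
    finally show ?thesis by (simp add: sum_distrib_left mult_ac)
  qed
  have "trace (bar v) = (\<Sum>i<N. \<Sum>k<N. \<Sum>l<N. co (v \<otimes> bs l) k * (S l i * S i k))"
    unfolding trace_def by (intro sum.cong refl e) simp
  also have "\<dots> = (\<Sum>k<N. \<Sum>i<N. \<Sum>l<N. co (v \<otimes> bs l) k * (S l i * S i k))" by (rule sum.swap)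
  also have "\<dots> = (\<Sum>k<N. \<Sum>l<N. \<Sum>i<N. co (v \<otimes> bs l) k * (S l i * S i k))"
    by (intro sum.cong refl sum.swap)
  also have "\<dots> = (\<Sum>k<N. \<Sum>l<N. co (v \<otimes> bs l) k * of_bool (k = l))"
    by (intro sum.cong refl) (simp add: sum_distrib_left[symmetric] SS)
  also have "\<dots> = (\<Sum>k<N. co (v \<otimes> bs k) k)"
    by (intro sum.cong refl) (simp add: of_bool_def if_distrib[of "\<lambda>x. _ * x"] cong: if_cong)
  finally show ?thesis by (simp add: trace_def)
qed

end

section \<open>The algebra of fractions of a CM-order\<close>

context cm_order
begin

lemma bar_hom: "bar \<in> Ring.ring_hom A A"
  using bar_iso by (simp add: ring_iso_def)

lemma bar_simps [simp]:
  "a \<in> carrier A \<Longrightarrow> bar a \<in> carrier A"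
  "\<lbrakk>a \<in> carrier A; b \<in> carrier A\<rbrakk> \<Longrightarrow> bar (a \<otimes> b) = bar a \<otimes> bar b"
  "\<lbrakk>a \<in> carrier A; b \<in> carrier A\<rbrakk> \<Longrightarrow> bar (a \<oplus> b) = bar a \<oplus> bar b"
  "bar \<one> = \<one>"
  using bar_hom by (auto simp: Ring.ring_hom_def)

lemma bar_iota: "bar (iota k) = iota k"
proof -
  interpret group_hom "add_monoid A" "add_monoid A" bar
    by (intro group_hom.intro group_hom_axioms.intro a_group) (auto simp: hom_def)
  show ?thesis using hom_int_pow[of \<one> k] by (simp add: iota_def add_pow_def)
qed

lemma AQ_of_closed [simp, intro]: "a \<in> carrier A \<Longrightarrow> AQ_of A a \<in> carrier (AQ A)"
  by (simp add: AQ_of_def)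

lemma AQ_of_add: "\<lbrakk>a \<in> carrier A; b \<in> carrier A\<rbrakk> \<Longrightarrow> AQ_of A (a \<oplus> b) = AQ_of A a \<oplus>\<^bsub>AQ A\<^esub> AQ_of A b"
  by (simp add: AQ_of_def AQ_add_same)

lemma AQ_of_mult: "\<lbrakk>a \<in> carrier A; b \<in> carrier A\<rbrakk> \<Longrightarrow> AQ_of A (a \<otimes> b) = AQ_of A a \<otimes>\<^bsub>AQ A\<^esub> AQ_of A b"
  by (simp add: AQ_of_def AQ_mult)

lemma AQ_of_one: "AQ_of A \<one> = \<one>\<^bsub>AQ A\<^esub>"
  by (simp add: AQ_of_def AQ_one)

lemma AQ_of_zero: "AQ_of A \<zero> = \<zero>\<^bsub>AQ A\<^esub>"
  by (simp add: AQ_of_def AQ_zero)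

lemma AQ_of_inj: "\<lbrakk>a \<in> carrier A; b \<in> carrier A; AQ_of A a = AQ_of A b\<rbrakk> \<Longrightarrow> a = b"
  by (simp add: AQ_of_def qfrac_eq_iff)

lemma AQ_of_char: "\<psi> \<in> Ring.ring_hom (AQ A) complex_ring \<Longrightarrow> \<psi> \<circ> AQ_of A \<in> Ring.ring_hom A complex_ring"
  by (auto simp: Ring.ring_hom_def AQ_of_add AQ_of_mult AQ_of_one)

lemma qfrac_eq_smult: "\<lbrakk>a \<in> carrier A; m \<noteq> 0\<rbrakk> \<Longrightarrow> qfrac A a m = (1 / of_int m) \<odot>\<^bsub>AQ A\<^esub> AQ_of A a"
  using AQ_smult[of a 1 m 1] by (simp add: AQ_of_def)

lemma AQ_bar_qfrac:
  assumes "a \<in> carrier A" "m \<noteq> 0"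
  shows "AQ_bar A bar (qfrac A a m) = qfrac A (bar a) m"
  unfolding AQ_bar_def
proof (rule qfrac_UN[OF assms])
  fix b n assume b: "b \<in> carrier A" "n \<noteq> 0" "iota n \<otimes> a = iota m \<otimes> b"
  from arg_cong[OF this(3), of bar] have "iota n \<otimes> bar a = iota m \<otimes> bar b"
    using assms b(1) by (simp add: bar_iota)
  then show "qfrac A (bar b) n = qfrac A (bar a) m" using assms b(1,2) by (simp add: qfrac_eq_iff)
qed

lemma AQ_bar_AQ_of: "a \<in> carrier A \<Longrightarrow> AQ_bar A bar (AQ_of A a) = AQ_of A (bar a)"
  by (simp add: AQ_of_def AQ_bar_qfrac)

lemma AQ_pow: "\<lbrakk>a \<in> carrier A; m \<noteq> 0\<rbrakk> \<Longrightarrow> qfrac A a m [^]\<^bsub>AQ A\<^esub> (k::nat) = qfrac A (a [^] k) (m ^ k)"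
proof (induction k)
  case 0
  interpret Q: cring "AQ A" by (rule cring_AQ)
  show ?case by (simp add: AQ_one)
next
  case (Suc k)
  interpret Q: cring "AQ A" by (rule cring_AQ)
  show ?case using Suc by (simp add: AQ_mult mult.commute)
qed

lemma cm_rat_algebra_AQ:
  "\<exists>n co. cm_rat_algebra (AQ A) n co (AQ_bar A bar) \<and>
    (\<forall>x\<in>carrier (AQ A). AQ_trace A x = rat_algebra.trace (AQ A) n co x)"
proof -
  obtain n0 co0 where "rat_algebra (AQ A) n0 co0" by (rule rat_algebra_AQ)
  then interpret Q0: rat_algebra "AQ A" n0 co0 .
  obtain n co where ra: "rat_algebra (AQ A) n co"
    and tr: "\<And>x. x \<in> carrier (AQ A) \<Longrightarrow> AQ_trace A x = rat_algebra.trace (AQ A) n co x"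
    unfolding AQ_trace_def using Q0.endo_trace_eq by blast
  interpret Q: rat_algebra "AQ A" n co by (rule ra)
  have "cm_rat_algebra (AQ A) n co (AQ_bar A bar)"
  proof unfold_locales
    fix x and k :: nat assume x: "x \<in> carrier (AQ A)" "x [^]\<^bsub>AQ A\<^esub> k = \<zero>\<^bsub>AQ A\<^esub>"
    obtain a m where a: "a \<in> carrier A" "m \<noteq> 0" "x = qfrac A a m" using x(1) by (rule qfrac_cases)
    \<comment> \<open>Clearing the denominator, legitimate by torsion-freeness, moves nilpotency
      from the fraction to its numerator, where reducedness of \<open>A\<close> applies.\<close>
    with x(2) have "a [^] k = \<zero>" by (simp add: AQ_pow AQ_zero'[of "m ^ k"] qfrac_eq_iff) (metis torsion_free iota_closed nat_pow_closed power_not_zero r_null zero_closed)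
    then have "a = \<zero>" using reduced a by blast
    then show "x = \<zero>\<^bsub>AQ A\<^esub>" using a by (simp add: AQ_zero'[of m])
  next
    fix x assume x: "x \<in> carrier (AQ A)"
    obtain a m where a: "a \<in> carrier A" "m \<noteq> 0" "x = qfrac A a m" using x by (rule qfrac_cases)
    then show "AQ_bar A bar x \<in> carrier (AQ A)" by (simp add: AQ_bar_qfrac)
    fix \<psi> assume ch: "\<psi> \<in> Q.chars"
    have "AQ_bar A bar x = qfrac A (bar a) m" using a by (simp add: AQ_bar_qfrac)
    also have "\<dots> = (1 / of_int m) \<odot>\<^bsub>AQ A\<^esub> AQ_of A (bar a)" using a by (intro qfrac_eq_smult) simp
    finally have "\<psi> (AQ_bar A bar x) = of_rat (1 / of_int m) * \<psi> (AQ_of A (bar a))"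
      using a Q.linD(2)[OF Q.lin_char[OF ch]] by simp
    also have "\<psi> (AQ_of A (bar a)) = cnj (\<psi> (AQ_of A a))"
      using bar_cnj[OF AQ_of_char[OF ch] a(1)] by simp
    also have "of_rat (1 / of_int m) * cnj (\<psi> (AQ_of A a)) = cnj (of_rat (1 / of_int m) * \<psi> (AQ_of A a))"
      by (metis complex_cnj_complex_of_real complex_cnj_mult complex_of_real_of_rat)
    also have "of_rat (1 / of_int m) * \<psi> (AQ_of A a) = \<psi> x"
      using a Q.linD(2)[OF Q.lin_char[OF ch]] by (simp add: qfrac_eq_smult)
    finally show "\<psi> (AQ_bar A bar x) = cnj (\<psi> x)" .
  qed
  with tr show ?thesis by blast
qed

text \<open>One dimension with coordinates is fixed as a term, so that \<open>cm_order\<close> can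
  be made a sublocale of \<open>cm_rat_algebra\<close>; the choice is tied to coordinates whose
  trace is \<open>AQ_trace\<close>.\<close>

definition AQ_coords :: "nat \<times> (('a \<times> int) set \<Rightarrow> nat \<Rightarrow> rat)" where
  "AQ_coords = (SOME c. cm_rat_algebra (AQ A) (fst c) (snd c) (AQ_bar A bar) \<and>
    (\<forall>x\<in>carrier (AQ A). AQ_trace A x = rat_algebra.trace (AQ A) (fst c) (snd c) x))"

lemma AQ_coords: "cm_rat_algebra (AQ A) (fst AQ_coords) (snd AQ_coords) (AQ_bar A bar)"
    "x \<in> carrier (AQ A) \<Longrightarrow> AQ_trace A x = rat_algebra.trace (AQ A) (fst AQ_coords) (snd AQ_coords) x"
proof -
  have "\<exists>c. cm_rat_algebra (AQ A) (fst c) (snd c) (AQ_bar A bar) \<and>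
    (\<forall>x\<in>carrier (AQ A). AQ_trace A x = rat_algebra.trace (AQ A) (fst c) (snd c) x)"
    using cm_rat_algebra_AQ by auto
  from someI_ex[OF this, folded AQ_coords_def]
  show "cm_rat_algebra (AQ A) (fst AQ_coords) (snd AQ_coords) (AQ_bar A bar)"
    "x \<in> carrier (AQ A) \<Longrightarrow> AQ_trace A x = rat_algebra.trace (AQ A) (fst AQ_coords) (snd AQ_coords) x"
    by blast+
qed

end

sublocale cm_order \<subseteq> Q: cm_rat_algebra "AQ A" "fst AQ_coords" "snd AQ_coords" "AQ_bar A bar"
  by (rule AQ_coords)

context cm_order
begin

abbreviation AQ_times (infixl \<open>\<star>\<close> 70) where "x \<star> y \<equiv> x \<otimes>\<^bsub>AQ A\<^esub> y"
abbreviation "cnjQ \<equiv> AQ_bar A bar"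
abbreviation "emb \<equiv> AQ_of A"
abbreviation "QQ \<equiv> carrier (AQ A)"

lemma lin_AQ_trace: "Q.lin (AQ_trace A)"
  using Q.lin_trace by (simp add: Q.lin_def AQ_coords(2))

lemma bar_bar: "a \<in> carrier A \<Longrightarrow> bar (bar a) = a"
  by (rule AQ_of_inj) (simp_all add: AQ_bar_AQ_of[symmetric] Q.bar_bar)

lemma iota_add: "iota (j + k) = iota j \<oplus> iota k"
  using add.int_pow_mult[of \<one> j k] by (simp add: iota_def)

lemma additive_iota:
  fixes g :: "'a \<Rightarrow> rat"
  assumes add: "\<And>a b. \<lbrakk>a \<in> carrier A; b \<in> carrier A\<rbrakk> \<Longrightarrow> g (a \<oplus> b) = g a + g b" and a: "a \<in> carrier A"
  shows "g (iota k \<otimes> a) = of_int k * g a"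
proof (induction k rule: int_induct[of _ 0])
  case base
  have "iota 0 = \<zero>" by (simp add: iota_def add_pow_def int_pow_def nat_pow_def)
  moreover have "g \<zero> = 0" using add[of \<zero> \<zero>] by simp
  ultimately show ?case using a by simp
next
  case (step1 i)
  have "iota (i + 1) \<otimes> a = iota i \<otimes> a \<oplus> a" using a by (simp add: iota_add l_distr)
  then show ?case using step1 a add[of "iota i \<otimes> a" a] by (simp add: distrib_right)
next
  case (step2 i)
  have "iota i \<otimes> a = iota (i - 1) \<otimes> a \<oplus> a" using a iota_add[of "i - 1" 1] by (simp add: l_distr)
  then show ?case using step2 a add[of "iota (i - 1) \<otimes> a" a] by (simp add: left_diff_distrib)
qed

text \<open>Additive maps commute with integer multiples, so g a / m depends only on the fraction
  a/m. The case of interest is a \<mapsto> \<open>ip L (a x) y\<close>, which thereby becomes a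
  functional that the trace form can represent.\<close>

lemma additive_extends:
  fixes g :: "'a \<Rightarrow> rat"
  assumes add: "\<And>a b. \<lbrakk>a \<in> carrier A; b \<in> carrier A\<rbrakk> \<Longrightarrow> g (a \<oplus> b) = g a + g b"
  obtains l where "Q.lin l" "\<And>a. a \<in> carrier A \<Longrightarrow> l (emb a) = g a"
proof
  define l where "l x = (case (SOME (a, m). a \<in> carrier A \<and> m \<noteq> 0 \<and> x = qfrac A a m) of
    (a, m) \<Rightarrow> g a / (of_int m :: rat))" for x
  have l: "l (qfrac A a m) = g a / of_int m" if a: "a \<in> carrier A" "m \<noteq> 0" for a m
  proof -
    obtain b k where bk: "(SOME (b, k). b \<in> carrier A \<and> k \<noteq> 0 \<and> qfrac A a m = qfrac A b k) = (b, k)" by force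
    have "case (b, k) of (b, k) \<Rightarrow> b \<in> carrier A \<and> k \<noteq> 0 \<and> qfrac A a m = qfrac A b k"
      unfolding bk[symmetric] by (rule someI[of _ "(a, m)"]) (use a in simp)
    then have b: "b \<in> carrier A" "k \<noteq> 0" "iota k \<otimes> a = iota m \<otimes> b" using a by (auto simp: qfrac_eq_iff)
    have "of_int k * g a = of_int m * g b"
      using additive_iota[OF add a(1), of k] additive_iota[OF add b(1), of m] b(3) by simp
    then show ?thesis using a b by (simp add: l_def bk field_simps)
  qed
  show "Q.lin l"
    unfolding Q.lin_def
  proof (intro conjI ballI allI)
    fix x y assume xy: "x \<in> QQ" "y \<in> QQ"
    obtain a b m where "a \<in> carrier A" "b \<in> carrier A" "m \<noteq> 0" "x = qfrac A a m" "y = qfrac A b m"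
      using xy by (rule common_denominator)
    then show "l (x \<oplus>\<^bsub>AQ A\<^esub> y) = l x + l y"
      by (simp add: AQ_add_same l add add_divide_distrib)
  next
    fix q x assume x: "x \<in> QQ"
    obtain a m where "a \<in> carrier A" "m \<noteq> 0" "x = qfrac A a m" using x by (rule qfrac_cases)
    then show "l (q \<odot>\<^bsub>AQ A\<^esub> x) = of_rat q * l x"
      by (cases q rule: rat_cases) (simp add: AQ_smult l additive_iota[OF add])
  qed
  show "l (emb a) = g a" if "a \<in> carrier A" for a
    using that by (simp add: AQ_of_def l)
qed

lemma lin_eqI:
  fixes F G :: "('a \<times> int) set \<Rightarrow> 'f::field_char_0"
  assumes "Q.lin F" "Q.lin G" "\<And>a. a \<in> carrier A \<Longrightarrow> F (emb a) = G (emb a)" "x \<in> QQ"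
  shows "F x = G x"
proof -
  obtain a m where a: "a \<in> carrier A" "m \<noteq> 0" "x = qfrac A a m" using assms(4) by (rule qfrac_cases)
  then show ?thesis
    using Q.linD(2)[OF assms(1)] Q.linD(2)[OF assms(2)] assms(3) by (simp add: qfrac_eq_smult)
qed

text \<open>The image of \<open>A\<close> spans \<open>AQ A\<close> over the rationals, so testing
  against it is enough for nondegeneracy of the trace form.\<close>

lemma trace_emb_eqI:
  assumes "z \<in> QQ" "z' \<in> QQ" "\<And>a. a \<in> carrier A \<Longrightarrow> AQ_trace A (emb a \<star> z) = AQ_trace A (emb a \<star> z')"
  shows "z = z'"
proof -
  have t: "Q.lin (\<lambda>b. AQ_trace A (b \<star> y))" if "y \<in> QQ" for y
    using Q.lin_times[OF lin_AQ_trace that] .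
  have "AQ_trace A (b \<star> z) = AQ_trace A (b \<star> z')" if "b \<in> QQ" for b
    using lin_eqI[OF t[OF assms(1)] t[OF assms(2)] assms(3) that] .
  then have "Q.trace (b \<star> (z \<ominus>\<^bsub>AQ A\<^esub> z')) = 0" if "b \<in> QQ" for b
    using that assms(1,2) Q.lin_minus[OF Q.lin_mult[OF Q.lin_trace that] assms(1,2)]
    by (simp add: AQ_coords(2))
  then have "z \<ominus>\<^bsub>AQ A\<^esub> z' = \<zero>\<^bsub>AQ A\<^esub>" using assms(1,2) by (intro Q.trace_nondegenerate) auto
  then show ?thesis using assms(1,2) by simp
qed

end

section \<open>The Hermitian pairing of a lattice\<close>

context A_lattice
begin

definition pair :: "'b \<Rightarrow> 'b \<Rightarrow> ('a \<times> int) set" where "pair = x_ybar A L"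

text \<open>The description by \<open>THE\<close> is justified: existence comes from representing
  the extended functional by the trace form, uniqueness from nondegeneracy, and membership in the
  trace dual from integrality of the lattice form. The third clause is the working criterion for
  identifying a pairing.\<close>

lemma pair_props:
  assumes xy: "x \<in> carrier L" "y \<in> carrier L"
  shows "pair x y \<in> QQ" "a \<in> carrier A \<Longrightarrow> AQ_trace A (emb a \<star> pair x y) = ip L (a \<odot>\<^bsub>L\<^esub> x) y"
    "\<lbrakk>z \<in> QQ; \<And>a. a \<in> carrier A \<Longrightarrow> AQ_trace A (emb a \<star> z) = ip L (a \<odot>\<^bsub>L\<^esub> x) y\<rbrakk> \<Longrightarrow> pair x y = z"
proof -
  define P where "P z \<longleftrightarrow> z \<in> trace_dual A \<and>
    (\<forall>a\<in>carrier A. AQ_trace A (emb a \<star> z) = ip L (a \<odot>\<^bsub>L\<^esub> x) y)" for z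
  have P: "P z" if "z \<in> QQ" "\<And>a. a \<in> carrier A \<Longrightarrow> AQ_trace A (emb a \<star> z) = ip L (a \<odot>\<^bsub>L\<^esub> x) y" for z
    using that xy ip_Ints by (auto simp: P_def trace_dual_def Q.m_comm[of z])
  have u: "z = z'" if "P z" "P z'" for z z'
    using that by (intro trace_emb_eqI) (auto simp: P_def trace_dual_def)
  have "ip L ((a \<oplus> b) \<odot>\<^bsub>L\<^esub> x) y = ip L (a \<odot>\<^bsub>L\<^esub> x) y + ip L (b \<odot>\<^bsub>L\<^esub> x) y" if "a \<in> carrier A" "b \<in> carrier A" for a b
    using that xy by (simp add: smult_l_distr ip_add)
  then obtain l where l: "Q.lin l" "\<And>a. a \<in> carrier A \<Longrightarrow> l (emb a) = ip L (a \<odot>\<^bsub>L\<^esub> x) y"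
    using additive_extends[of "\<lambda>a. ip L (a \<odot>\<^bsub>L\<^esub> x) y"] by auto
  obtain z0 where z0: "z0 \<in> QQ" "\<And>b. b \<in> QQ \<Longrightarrow> Q.trace (b \<star> z0) = l b" using Q.trace_dual_exists[OF l(1)] by blast
  have Pz0: "P z0" using z0 l(2) by (intro P) (auto simp: AQ_coords(2))
  have e: "pair x y = (THE z. P z)" by (simp add: pair_def x_ybar_def P_def)
  have the: "pair x y = z" if "P z" for z unfolding e by (rule the_equality) (use that u in blast)+
  show "pair x y = z" if "z \<in> QQ" "\<And>a. a \<in> carrier A \<Longrightarrow> AQ_trace A (emb a \<star> z) = ip L (a \<odot>\<^bsub>L\<^esub> x) y" for z
    using the P[OF that] by blast
  show "pair x y \<in> QQ" "a \<in> carrier A \<Longrightarrow> AQ_trace A (emb a \<star> pair x y) = ip L (a \<odot>\<^bsub>L\<^esub> x) y"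
    using the[OF Pz0] Pz0 z0(1) by (auto simp: P_def)
qed

lemmas pair_closed [simp, intro] = pair_props(1)
lemmas pairI = pair_props(3)

lemma trace_pair: "\<lbrakk>x \<in> carrier L; y \<in> carrier L\<rbrakk> \<Longrightarrow> AQ_trace A (pair x y) = ip L x y"
  using pair_props(2)[of x y \<one>] by (simp add: AQ_of_one)

lemma pair_add:
  assumes "x \<in> carrier L" "x' \<in> carrier L" "y \<in> carrier L"
  shows "pair (x \<oplus>\<^bsub>L\<^esub> x') y = pair x y \<oplus>\<^bsub>AQ A\<^esub> pair x' y"
  using assms pair_props(2) Q.linD(1)[OF lin_AQ_trace]
  by (intro pairI) (simp_all add: Q.r_distr smult_r_distr ip_add)

lemma pair_smult:
  assumes "a \<in> carrier A" "x \<in> carrier L" "y \<in> carrier L"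
  shows "pair (a \<odot>\<^bsub>L\<^esub> x) y = emb a \<star> pair x y"
  using assms pair_props(2)[of x y]
  by (intro pairI) (simp_all add: Q.m_assoc[symmetric] AQ_of_mult[symmetric] smult_assoc1)

text \<open>Hermitian symmetry combines three facts: the trace is invariant under conjugation, the
  form is symmetric, and a and bar a are adjoint for it.\<close>

lemma pair_bar:
  assumes xy: "x \<in> carrier L" "y \<in> carrier L"
  shows "cnjQ (pair x y) = pair y x"
proof (rule pairI[symmetric])
  fix a assume a: "a \<in> carrier A"
  have "emb a \<star> cnjQ (pair x y) = cnjQ (emb (bar a) \<star> pair x y)"
    using a xy by (simp add: Q.bar_mult AQ_bar_AQ_of bar_bar)
  then have "AQ_trace A (emb a \<star> cnjQ (pair x y)) = AQ_trace A (emb (bar a) \<star> pair x y)"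
    using a xy Q.trace_bar[of "emb (bar a) \<star> pair x y"] by (simp add: AQ_coords(2))
  also have "\<dots> = ip L y (bar a \<odot>\<^bsub>L\<^esub> x)"
    using a xy pair_props(2)[OF xy, of "bar a"] ip_sym[of "bar a \<odot>\<^bsub>L\<^esub> x" y] by simp
  also have "\<dots> = ip L (a \<odot>\<^bsub>L\<^esub> y) x" using a xy by (simp only: ip_smult)
  finally show "AQ_trace A (emb a \<star> cnjQ (pair x y)) = ip L (a \<odot>\<^bsub>L\<^esub> y) x" .
qed (use xy in auto)

lemma pair_add_right:
  assumes "x \<in> carrier L" "y \<in> carrier L" "y' \<in> carrier L"
  shows "pair x (y \<oplus>\<^bsub>L\<^esub> y') = pair x y \<oplus>\<^bsub>AQ A\<^esub> pair x y'"
  using pair_add[of y y' x] assms by (simp add: pair_bar[of _ x, symmetric] Q.bar_add)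

text \<open>This is the balancing condition for a tensor product whose second factor carries the
  conjugated action.\<close>

lemma pair_smult_right:
  assumes "a \<in> carrier A" "x \<in> carrier L" "y \<in> carrier L"
  shows "pair x (bar a \<odot>\<^bsub>L\<^esub> y) = emb a \<star> pair x y"
  using pair_smult[of "bar a" y x] assms
  by (simp add: pair_bar[of _ x, symmetric] Q.bar_mult AQ_bar_AQ_of bar_bar)

lemma pair_self_zero: "\<lbrakk>x \<in> carrier L; pair x x = \<zero>\<^bsub>AQ A\<^esub>\<rbrakk> \<Longrightarrow> x = \<zero>\<^bsub>L\<^esub>"
  using trace_pair[of x x] ip_pos[of x] Q.lin_zero[OF lin_AQ_trace] by fastforce

end

section \<open>Tensor products\<close>

text \<open>The value of one formal sum; \<open>tensor_lift\<close> is the common value of this map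
  on a coset.\<close>

definition frag_eval :: "('p, 'c) ring_scheme \<Rightarrow> ('m \<Rightarrow> 'n \<Rightarrow> 'p) \<Rightarrow> ('m \<times> 'n \<Rightarrow>\<^sub>0 int) \<Rightarrow> 'p" where
  "frag_eval P \<beta> c = (\<Oplus>\<^bsub>P\<^esub>p\<in>Poly_Mapping.keys c. add_pow P (Poly_Mapping.lookup c p) (\<beta> (fst p) (snd p)))"

context abelian_group
begin

lemma add_pow_0_int: "add_pow G (0::int) x = \<zero>"
  by (simp add: add_pow_def int_pow_def nat_pow_def)

lemma frag_eval_superset:
  assumes "finite B" "Poly_Mapping.keys c \<subseteq> B" "\<And>p. p \<in> B \<Longrightarrow> \<beta> (fst p) (snd p) \<in> carrier G"
  shows "frag_eval G \<beta> c = (\<Oplus>p\<in>B. add_pow G (Poly_Mapping.lookup c p) (\<beta> (fst p) (snd p)))"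
  unfolding frag_eval_def
proof (rule add.finprod_mono_neutral_cong_left[OF assms(1,2)])
  show "add_pow G (Poly_Mapping.lookup c i) (\<beta> (fst i) (snd i)) = \<zero>" if "i \<in> B - Poly_Mapping.keys c" for i
    using that by (simp add: in_keys_iff add_pow_0_int)
  show "(\<lambda>p. add_pow G (Poly_Mapping.lookup c p) (\<beta> (fst p) (snd p))) \<in> B \<rightarrow> carrier G"
    using assms(3) by auto
qed simp

lemma frag_eval_closed:
  assumes "\<And>p. p \<in> Poly_Mapping.keys c \<Longrightarrow> \<beta> (fst p) (snd p) \<in> carrier G"
  shows "frag_eval G \<beta> c \<in> carrier G"
  unfolding frag_eval_def using assms by (intro finsum_closed) auto

lemma frag_eval_add:
  assumes "\<And>p. p \<in> S \<Longrightarrow> \<beta> (fst p) (snd p) \<in> carrier G"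
    and "Poly_Mapping.keys c \<subseteq> S" "Poly_Mapping.keys d \<subseteq> S"
  shows "frag_eval G \<beta> (c + d) = frag_eval G \<beta> c \<oplus> frag_eval G \<beta> d"
proof -
  define B where "B = Poly_Mapping.keys c \<union> Poly_Mapping.keys d"
  have B: "finite B" "Poly_Mapping.keys c \<subseteq> B" "Poly_Mapping.keys d \<subseteq> B" "Poly_Mapping.keys (c + d) \<subseteq> B"
    using keys_add[of c d] by (auto simp: B_def)
  have b: "\<beta> (fst p) (snd p) \<in> carrier G" if "p \<in> B" for p
    using that assms by (auto simp: B_def)
  have e: "frag_eval G \<beta> z = (\<Oplus>p\<in>B. add_pow G (Poly_Mapping.lookup z p) (\<beta> (fst p) (snd p)))"
    if "Poly_Mapping.keys z \<subseteq> B" for z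
    using frag_eval_superset[OF B(1) that] b by blast
  have "frag_eval G \<beta> (c + d) = (\<Oplus>p\<in>B. add_pow G (Poly_Mapping.lookup c p) (\<beta> (fst p) (snd p)) \<oplus>
      add_pow G (Poly_Mapping.lookup d p) (\<beta> (fst p) (snd p)))"
    unfolding e[OF B(4)]
    by (rule finsum_cong') (use b in \<open>auto simp: lookup_add add.int_pow_mult\<close>)
  also have "\<dots> = frag_eval G \<beta> c \<oplus> frag_eval G \<beta> d"
    unfolding e[OF B(2)] e[OF B(3)]
    by (rule finsum_addf) (use b in auto)
  finally show ?thesis .
qed

lemma frag_eval_zero [simp]: "frag_eval G \<beta> 0 = \<zero>"
  by (simp add: frag_eval_def)

lemma frag_eval_frag_of [simp]: "\<beta> x y \<in> carrier G \<Longrightarrow> frag_eval G \<beta> (frag_of (x, y)) = \<beta> x y"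
  by (simp add: frag_eval_def)

lemma frag_eval_diff:
  assumes "\<And>p. p \<in> S \<Longrightarrow> \<beta> (fst p) (snd p) \<in> carrier G"
    and "Poly_Mapping.keys c \<subseteq> S" "Poly_Mapping.keys d \<subseteq> S"
  shows "frag_eval G \<beta> (c - d) = frag_eval G \<beta> c \<ominus> frag_eval G \<beta> d"
proof -
  have k: "Poly_Mapping.keys (c - d) \<subseteq> S" using keys_diff[of c d] assms by auto
  have "frag_eval G \<beta> c = frag_eval G \<beta> (c - d) \<oplus> frag_eval G \<beta> d"
    using frag_eval_add[of S \<beta> "c - d" d] assms k by simp
  moreover have "frag_eval G \<beta> c \<in> carrier G" "frag_eval G \<beta> d \<in> carrier G" "frag_eval G \<beta> (c - d) \<in> carrier G"
    using assms k by (auto intro!: frag_eval_closed)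
  ultimately show ?thesis by (simp add: minus_eq a_assoc r_neg)
qed

end

locale tensor_product = M: module R M + N: module R N
  for R :: "('r, 'c) ring_scheme" (structure) and M :: "('r, 'm, 'd) module_scheme" and N :: "('r, 'n, 'e) module_scheme"
begin

abbreviation "pairs \<equiv> carrier M \<times> carrier N"
abbreviation "F \<equiv> free_Abelian_group pairs"
abbreviation "T \<equiv> tensor_relations R M N"
abbreviation act :: "'r \<Rightarrow> ('m \<times> 'n \<Rightarrow>\<^sub>0 int) \<Rightarrow> ('m \<times> 'n \<Rightarrow>\<^sub>0 int)" where
  "act r \<equiv> frag_extend (\<lambda>(x, y). frag_of (r \<odot>\<^bsub>M\<^esub> x, y))"

definition cls :: "('m \<times> 'n \<Rightarrow>\<^sub>0 int) \<Rightarrow> ('m \<times> 'n \<Rightarrow>\<^sub>0 int) set" where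
  "cls c = T #>\<^bsub>F\<^esub> c"

definition gens :: "('m \<times> 'n \<Rightarrow>\<^sub>0 int) set" where
  "gens = {frag_of (x \<oplus>\<^bsub>M\<^esub> x', y) - frag_of (x, y) - frag_of (x', y) | x x' y.
         x \<in> carrier M \<and> x' \<in> carrier M \<and> y \<in> carrier N} \<union>
      {frag_of (x, y \<oplus>\<^bsub>N\<^esub> y') - frag_of (x, y) - frag_of (x, y') | x y y'.
         x \<in> carrier M \<and> y \<in> carrier N \<and> y' \<in> carrier N} \<union>
      {frag_of (r \<odot>\<^bsub>M\<^esub> x, y) - frag_of (x, r \<odot>\<^bsub>N\<^esub> y) | r x y.
         r \<in> carrier R \<and> x \<in> carrier M \<and> y \<in> carrier N}"

lemma relations_eq: "T = generate F gens"
  by (simp only: tensor_relations_def gens_def)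

lemma gens_cases [consumes 1]:
  assumes "c \<in> gens"
  obtains (add_left) x x' y where "x \<in> carrier M" "x' \<in> carrier M" "y \<in> carrier N" "c = frag_of (x \<oplus>\<^bsub>M\<^esub> x', y) - frag_of (x, y) - frag_of (x', y)"
  | (add_right) x y y' where "x \<in> carrier M" "y \<in> carrier N" "y' \<in> carrier N" "c = frag_of (x, y \<oplus>\<^bsub>N\<^esub> y') - frag_of (x, y) - frag_of (x, y')"
  | (scale) r x y where "r \<in> carrier R" "x \<in> carrier M" "y \<in> carrier N" "c = frag_of (r \<odot>\<^bsub>M\<^esub> x, y) - frag_of (x, r \<odot>\<^bsub>N\<^esub> y)"
  using assms unfolding gens_def
  by (elim UnE CollectE exE conjE) (erule (3) that)+

lemma gens_keys:
  assumes "c \<in> gens"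
  shows "Poly_Mapping.keys c \<subseteq> pairs"
  using assms
proof (cases rule: gens_cases)
  case (add_left x x' y)
  then show ?thesis
    using keys_diff[of "frag_of (x \<oplus>\<^bsub>M\<^esub> x', y) - frag_of (x, y)" "frag_of (x', y)"]
      keys_diff[of "frag_of (x \<oplus>\<^bsub>M\<^esub> x', y)" "frag_of (x, y)"] by auto
next
  case (add_right x y y')
  then show ?thesis
    using keys_diff[of "frag_of (x, y \<oplus>\<^bsub>N\<^esub> y') - frag_of (x, y)" "frag_of (x, y')"]
      keys_diff[of "frag_of (x, y \<oplus>\<^bsub>N\<^esub> y')" "frag_of (x, y)"] by auto
next
  case (scale r x y)
  then show ?thesis using keys_diff[of "frag_of (r \<odot>\<^bsub>M\<^esub> x, y)" "frag_of (x, r \<odot>\<^bsub>N\<^esub> y)"] by auto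
qed

lemma subgroup_relations: "subgroup T F"
  unfolding relations_eq using gens_keys
  by (intro group.generate_is_subgroup[OF group_free_Abelian_group] subsetI) simp

lemma relations_keys: "c \<in> T \<Longrightarrow> Poly_Mapping.keys c \<subseteq> pairs"
  using subgroup.mem_carrier[OF subgroup_relations, of c] by simp

text \<open>Support in \<open>pairs\<close> is part of the conclusion, because the closure steps for
  P may assume it of their arguments.\<close>

lemma relations_induct [consumes 1, case_names zero add_left add_right scale neg add]:
  assumes "c \<in> T" and "P 0"
    "\<And>x x' y. \<lbrakk>x \<in> carrier M; x' \<in> carrier M; y \<in> carrier N\<rbrakk> \<Longrightarrow> P (frag_of (x \<oplus>\<^bsub>M\<^esub> x', y) - frag_of (x, y) - frag_of (x', y))"
    "\<And>x y y'. \<lbrakk>x \<in> carrier M; y \<in> carrier N; y' \<in> carrier N\<rbrakk> \<Longrightarrow> P (frag_of (x, y \<oplus>\<^bsub>N\<^esub> y') - frag_of (x, y) - frag_of (x, y'))"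
    "\<And>r x y. \<lbrakk>r \<in> carrier R; x \<in> carrier M; y \<in> carrier N\<rbrakk> \<Longrightarrow> P (frag_of (r \<odot>\<^bsub>M\<^esub> x, y) - frag_of (x, r \<odot>\<^bsub>N\<^esub> y))"
    "\<And>c. \<lbrakk>Poly_Mapping.keys c \<subseteq> pairs; P c\<rbrakk> \<Longrightarrow> P (- c)"
    "\<And>c d. \<lbrakk>Poly_Mapping.keys c \<subseteq> pairs; Poly_Mapping.keys d \<subseteq> pairs; P c; P d\<rbrakk> \<Longrightarrow> P (c + d)"
  shows "Poly_Mapping.keys c \<subseteq> pairs \<and> P c"
proof -
  have g: "P h" if "h \<in> gens" for h
    using that by (cases rule: gens_cases) (simp_all add: assms(3-5))
  show ?thesis using assms(1) unfolding relations_eq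
  proof (induction rule: generate.induct)
    case one
    then show ?case using assms(2) by simp
  next
    case (incl h)
    then show ?case using g gens_keys by blast
  next
    case (inv h)
    then show ?case using g[OF inv] gens_keys[OF inv] assms(6) by simp
  next
    case (eng h1 h2)
    then show ?case using assms(7)[of h1 h2] keys_add[of h1 h2] by (simp add: subset_iff) blast
  qed
qed

lemma relations_incl:
  "\<lbrakk>x \<in> carrier M; x' \<in> carrier M; y \<in> carrier N\<rbrakk> \<Longrightarrow> frag_of (x \<oplus>\<^bsub>M\<^esub> x', y) - frag_of (x, y) - frag_of (x', y) \<in> T"
  "\<lbrakk>x \<in> carrier M; y \<in> carrier N; y' \<in> carrier N\<rbrakk> \<Longrightarrow> frag_of (x, y \<oplus>\<^bsub>N\<^esub> y') - frag_of (x, y) - frag_of (x, y') \<in> T"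
  "\<lbrakk>r \<in> carrier R; x \<in> carrier M; y \<in> carrier N\<rbrakk> \<Longrightarrow> frag_of (r \<odot>\<^bsub>M\<^esub> x, y) - frag_of (x, r \<odot>\<^bsub>N\<^esub> y) \<in> T"
  unfolding relations_eq gens_def by (rule generate.incl; blast)+

lemma relations_zero: "0 \<in> T"
  using subgroup.one_closed[OF subgroup_relations] by simp

lemma relations_add: "\<lbrakk>c \<in> T; d \<in> T\<rbrakk> \<Longrightarrow> c + d \<in> T"
  using subgroup.m_closed[OF subgroup_relations] by simp

lemma relations_uminus: "c \<in> T \<Longrightarrow> - c \<in> T"
  using subgroup.m_inv_closed[OF subgroup_relations, of c] relations_keys[of c] by simp

lemma normal_relations: "T \<lhd> F"
  by (rule comm_group.subgroup_imp_normal[OF abelian_free_Abelian_group subgroup_relations])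

lemma cls_eq_iff:
  assumes "Poly_Mapping.keys c \<subseteq> pairs" "Poly_Mapping.keys d \<subseteq> pairs"
  shows "cls c = cls d \<longleftrightarrow> c - d \<in> T"
proof
  assume "cls c = cls d"
  moreover have "c \<in> cls c" using relations_zero by (auto simp: cls_def r_coset_def)
  ultimately obtain t where "t \<in> T" "c = t + d" by (auto simp: cls_def r_coset_def)
  then show "c - d \<in> T" by simp
next
  assume d: "c - d \<in> T"
  have *: "cls c \<subseteq> cls d" if d: "c - d \<in> T" for c d
  proof
    fix z assume "z \<in> cls c"
    then obtain t where t: "t \<in> T" "z = t + c" by (auto simp: cls_def r_coset_def)
    then have "t + (c - d) \<in> T" "z = (t + (c - d)) + d" using relations_add[OF _ d] by auto
    then show "z \<in> cls d" unfolding cls_def r_coset_def by (intro UN_I[of "t + (c - d)"]) simp_all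
  qed
  have "d - c \<in> T" using relations_uminus[OF d] by simp
  with d * show "cls c = cls d" by blast
qed

lemma mem_cls: "z \<in> cls c \<longleftrightarrow> z - c \<in> T"
  by (auto simp: cls_def r_coset_def) (metis diff_add_cancel)

lemma act_keys:
  assumes "r \<in> carrier R" "Poly_Mapping.keys c \<subseteq> pairs"
  shows "Poly_Mapping.keys (act r c) \<subseteq> pairs"
  using keys_frag_extend[of "\<lambda>(x, y). frag_of (r \<odot>\<^bsub>M\<^esub> x, y)" c] assms by (force split: prod.splits)

lemma act_frag_of [simp]: "act r (frag_of (x, y)) = frag_of (r \<odot>\<^bsub>M\<^esub> x, y)"
  by (simp add: frag_extend_of)

text \<open>Well-definedness of the scalar action on cosets.\<close>

lemma act_relations:
  assumes r: "r \<in> carrier R" and c: "c \<in> T"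
  shows "act r c \<in> T"
proof -
  have "Poly_Mapping.keys c \<subseteq> pairs \<and> act r c \<in> T"
    using c
  proof (induction rule: relations_induct)
    case (scale s x y)
    \<comment> \<open>Commutativity of R enters here: the acting scalar r must pass the scalar s
      that is being moved across the tensor sign.\<close>
    have "r \<odot>\<^bsub>M\<^esub> (s \<odot>\<^bsub>M\<^esub> x) = s \<odot>\<^bsub>M\<^esub> (r \<odot>\<^bsub>M\<^esub> x)"
      using r scale by (simp add: M.smult_assoc1[symmetric] M.m_comm)
    then show ?case using r scale relations_incl(3)[of s "r \<odot>\<^bsub>M\<^esub> x" y] by (simp add: frag_extend_diff)
  qed (use r relations_zero relations_add relations_uminus relations_incl in
        \<open>simp_all add: frag_extend_diff frag_extend_add frag_extend_minus M.smult_r_distr\<close>)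
  then show ?thesis ..
qed

lemma tensor_carrier: "carrier (tensor R M N) = cls ` carrier F"
  by (auto simp: tensor_def Let_def FactGroup_def RCOSETS_def cls_def)

lemma tensor_add:
  assumes "Poly_Mapping.keys c \<subseteq> pairs" "Poly_Mapping.keys d \<subseteq> pairs"
  shows "cls c \<oplus>\<^bsub>tensor R M N\<^esub> cls d = cls (c + d)"
  using normal.rcos_sum[OF normal_relations, of c d] assms
  by (simp add: tensor_def Let_def FactGroup_def cls_def)

lemma tensor_smult:
  assumes r: "r \<in> carrier R" and c: "Poly_Mapping.keys c \<subseteq> pairs"
  shows "r \<odot>\<^bsub>tensor R M N\<^esub> cls c = cls (act r c)"
proof -
  have "(\<Union>z\<in>cls c. cls (act r z)) = cls (act r c)"
  proof (rule UN_eq_const)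
    show "c \<in> cls c" by (simp add: mem_cls relations_zero)
    fix z assume "z \<in> cls c"
    then have t: "z - c \<in> T" by (simp add: mem_cls)
    then have "Poly_Mapping.keys z \<subseteq> pairs"
      using keys_add[of "z - c" c] relations_keys[OF t] c by auto
    moreover have "act r z - act r c \<in> T"
      using act_relations[OF r t] by (simp add: frag_extend_diff)
    ultimately show "cls (act r z) = cls (act r c)"
      using act_keys[OF r] c by (simp add: cls_eq_iff)
  qed
  then show ?thesis by (simp add: tensor_def Let_def cls_def)
qed

text \<open>The equations match the three kinds of generating relations. P is treated as an additive
  group; its compatibility with scalars is expressed by balancing alone.\<close>

definition bilinear_into :: "('p, 'q) ring_scheme \<Rightarrow> ('m \<Rightarrow> 'n \<Rightarrow> 'p) \<Rightarrow> bool" where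
  "bilinear_into P \<beta> \<longleftrightarrow> (\<forall>x\<in>carrier M. \<forall>y\<in>carrier N. \<beta> x y \<in> carrier P) \<and>
    (\<forall>x\<in>carrier M. \<forall>x'\<in>carrier M. \<forall>y\<in>carrier N. \<beta> (x \<oplus>\<^bsub>M\<^esub> x') y = \<beta> x y \<oplus>\<^bsub>P\<^esub> \<beta> x' y) \<and>
    (\<forall>x\<in>carrier M. \<forall>y\<in>carrier N. \<forall>y'\<in>carrier N. \<beta> x (y \<oplus>\<^bsub>N\<^esub> y') = \<beta> x y \<oplus>\<^bsub>P\<^esub> \<beta> x y') \<and>
    (\<forall>r\<in>carrier R. \<forall>x\<in>carrier M. \<forall>y\<in>carrier N. \<beta> (r \<odot>\<^bsub>M\<^esub> x) y = \<beta> x (r \<odot>\<^bsub>N\<^esub> y))"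

lemma frag_eval_relations:
  assumes P: "abelian_group P" and b: "bilinear_into P \<beta>" and c: "c \<in> T"
  shows "frag_eval P \<beta> c = \<zero>\<^bsub>P\<^esub>"
proof -
  interpret P: abelian_group P by (rule P)
  have cl: "\<beta> (fst p) (snd p) \<in> carrier P" if "p \<in> pairs" for p using b that by (auto simp: bilinear_into_def)
  have cl': "\<beta> x y \<in> carrier P" if "x \<in> carrier M" "y \<in> carrier N" for x y using cl[of "(x, y)"] that by simp
  note diff = P.frag_eval_diff[where S = pairs and \<beta> = \<beta>, OF cl]
  have d3: "frag_eval P \<beta> (frag_of (x, y) - frag_of (x', y') - frag_of (x'', y'')) = \<beta> x y \<ominus>\<^bsub>P\<^esub> \<beta> x' y' \<ominus>\<^bsub>P\<^esub> \<beta> x'' y''"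
    if "x \<in> carrier M" "y \<in> carrier N" "x' \<in> carrier M" "y' \<in> carrier N" "x'' \<in> carrier M" "y'' \<in> carrier N" for x y x' y' x'' y''
    using that keys_diff[of "frag_of (x, y)" "frag_of (x', y')"] cl'
    by (subst diff) (auto simp: diff)
  have "Poly_Mapping.keys c \<subseteq> pairs \<and> frag_eval P \<beta> c = \<zero>\<^bsub>P\<^esub>"
    using c
  proof (induction rule: relations_induct)
    case (add_left x x' y)
    then have "\<beta> (x \<oplus>\<^bsub>M\<^esub> x') y = \<beta> x y \<oplus>\<^bsub>P\<^esub> \<beta> x' y" using b by (simp add: bilinear_into_def)
    then show ?case using add_left cl' by (simp add: d3 P.minus_eq P.a_ac P.r_neg P.r_neg1)
  next
    case (add_right x y y')
    then have "\<beta> x (y \<oplus>\<^bsub>N\<^esub> y') = \<beta> x y \<oplus>\<^bsub>P\<^esub> \<beta> x y'" using b by (simp add: bilinear_into_def)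
    then show ?case using add_right cl' by (simp add: d3 P.minus_eq P.a_ac P.r_neg P.r_neg1)
  next
    case (scale r x y)
    then have "\<beta> (r \<odot>\<^bsub>M\<^esub> x) y = \<beta> x (r \<odot>\<^bsub>N\<^esub> y)" using b by (simp add: bilinear_into_def)
    then show ?case using scale cl' by (subst diff) (auto simp: P.minus_eq P.r_neg)
  next
    case (neg c)
    then show ?case using diff[of 0 c] by (simp add: P.minus_eq)
  next
    case (add c d)
    then show ?case using P.frag_eval_add[where S = pairs and \<beta> = \<beta>, OF cl] by simp
  qed simp
  then show ?thesis ..
qed

lemma frag_eval_cong_cls:
  assumes P: "abelian_group P" and b: "bilinear_into P \<beta>"
    and cd: "Poly_Mapping.keys c \<subseteq> pairs" "Poly_Mapping.keys d \<subseteq> pairs" "cls c = cls d"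
  shows "frag_eval P \<beta> c = frag_eval P \<beta> d"
proof -
  interpret P: abelian_group P by (rule P)
  have cl: "\<beta> (fst p) (snd p) \<in> carrier P" if "p \<in> pairs" for p using b that by (auto simp: bilinear_into_def)
  have t: "c - d \<in> T" using cd by (simp add: cls_eq_iff)
  have "frag_eval P \<beta> d \<in> carrier P" by (rule P.frag_eval_closed) (use cl cd in blast)
  then have "frag_eval P \<beta> ((c - d) + d) = frag_eval P \<beta> d"
    using P.frag_eval_add[where S = pairs and \<beta> = \<beta>, OF cl relations_keys[OF t] cd(2)] frag_eval_relations[OF P b t]
    by simp
  then show ?thesis by simp
qed

text \<open>Members of a coset differ by relations, on which a balanced map evaluates to zero; the
  image of the coset is therefore a singleton.\<close>

lemma tensor_lift_cls:
  assumes P: "abelian_group P" and b: "bilinear_into P \<beta>" and c: "Poly_Mapping.keys c \<subseteq> pairs"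
  shows "tensor_lift P \<beta> (cls c) = frag_eval P \<beta> c"
proof -
  have e: "frag_eval P \<beta> z = frag_eval P \<beta> c" if "z \<in> cls c" for z
  proof (rule frag_eval_cong_cls[OF P b _ c])
    have t: "z - c \<in> T" using that by (simp add: mem_cls)
    then show k: "Poly_Mapping.keys z \<subseteq> pairs"
      using keys_add[of "z - c" c] relations_keys[OF t] c by auto
    show "cls z = cls c" using t k c by (simp add: cls_eq_iff)
  qed
  have c': "c \<in> cls c" by (simp add: mem_cls relations_zero)
  have "frag_eval P \<beta> ` cls c = (\<lambda>_. frag_eval P \<beta> c) ` cls c" by (rule image_cong[OF refl e])
  also have "\<dots> = {frag_eval P \<beta> c}" by (rule image_constant[OF c'])
  finally show ?thesis by (simp add: tensor_lift_def frag_eval_def[abs_def])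
qed

end

section \<open>Invertible lattices\<close>

lemma (in abelian_group) eq_minusI: "\<lbrakk>x \<oplus> b = a; x \<in> carrier G; b \<in> carrier G\<rbrakk> \<Longrightarrow> x = a \<ominus> b"
  by (auto simp: minus_eq a_assoc r_neg)

context rat_algebra
begin

lemma module_rat: "module rat_ring K"
  by (rule moduleI)
    (auto intro: cring_from_type_algebra is_abelian_group simp: smult_add smult_smult smult_one co_add co_smult distrib_left intro!: co_inj)

end

context cm_order
begin

lemma module_AQ_sub: "module A (AQ_sub A QQ)"
proof (rule moduleI)
  show "abelian_group (AQ_sub A QQ)"
  proof (rule abelian_groupI)
    show "\<exists>y\<in>carrier (AQ_sub A QQ). y \<oplus>\<^bsub>AQ_sub A QQ\<^esub> x = \<zero>\<^bsub>AQ_sub A QQ\<^esub>" if "x \<in> carrier (AQ_sub A QQ)" for x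
      using that by (intro bexI[of _ "\<ominus>\<^bsub>AQ A\<^esub> x"]) (auto simp: AQ_sub_def Q.l_neg)
  qed (auto simp: AQ_sub_def Q.a_ac)
qed (auto simp: AQ_sub_def is_cring AQ_of_add AQ_of_mult AQ_of_one Q.l_distr Q.r_distr Q.m_assoc)

lemma bar_minus: "\<lbrakk>a \<in> carrier A; b \<in> carrier A\<rbrakk> \<Longrightarrow> bar (a \<ominus> b) = bar a \<ominus> bar b"
proof -
  assume ab: "a \<in> carrier A" "b \<in> carrier A"
  have "bar (a \<ominus> b) \<oplus> bar b = bar (a \<ominus> b \<oplus> b)" using ab by (simp del: bar_simps add: bar_simps(3)[symmetric])
  also have "a \<ominus> b \<oplus> b = a" using ab by (simp add: minus_eq a_assoc l_neg)
  finally have "bar (a \<ominus> b) \<oplus> bar b = bar a" .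
  then show ?thesis using ab by (intro eq_minusI) auto
qed

lemma AQ_of_minus:
  assumes "a \<in> carrier A" "b \<in> carrier A"
  shows "AQ_of A (a \<ominus> b) = AQ_of A a \<ominus>\<^bsub>AQ A\<^esub> AQ_of A b"
proof -
  have "AQ_of A (a \<ominus> b) \<oplus>\<^bsub>AQ A\<^esub> AQ_of A b = AQ_of A a"
    using assms by (simp add: AQ_of_add[symmetric] minus_eq a_assoc l_neg)
  then show ?thesis using assms by (intro Q.eq_minusI) auto
qed

lemma char_emb_iota: "\<psi> \<in> Q.chars \<Longrightarrow> \<psi> (emb (iota k)) = of_int k"
proof -
  assume ch: "\<psi> \<in> Q.chars"
  have "emb (iota k) = of_int k \<odot>\<^bsub>AQ A\<^esub> \<one>\<^bsub>AQ A\<^esub>"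
    using AQ_smult[of \<one> 1 1 k] by (simp add: AQ_of_def AQ_one)
  then show ?thesis using Q.char_smult_one[OF ch] by simp
qed

end

context A_lattice
begin

lemma bar_module_sel [simp]:
  "carrier (bar_module bar L) = carrier L" "x \<oplus>\<^bsub>bar_module bar L\<^esub> y = x \<oplus>\<^bsub>L\<^esub> y"
  "\<zero>\<^bsub>bar_module bar L\<^esub> = \<zero>\<^bsub>L\<^esub>" "a \<odot>\<^bsub>bar_module bar L\<^esub> x = bar a \<odot>\<^bsub>L\<^esub> x"
  by (simp_all add: bar_module_def)

lemma module_bar_module: "module A (bar_module bar L)"
proof (rule moduleI)
  show "abelian_group (bar_module bar L)"
  proof (rule abelian_groupI)
    show "\<exists>y\<in>carrier (bar_module bar L). y \<oplus>\<^bsub>bar_module bar L\<^esub> x = \<zero>\<^bsub>bar_module bar L\<^esub>"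
      if "x \<in> carrier (bar_module bar L)" for x
      using that by (intro bexI[of _ "\<ominus>\<^bsub>L\<^esub> x"]) (auto simp: M.l_neg)
  qed (auto simp: M.a_ac)
qed (auto simp: is_cring smult_l_distr smult_r_distr smult_assoc1)

end

sublocale A_lattice \<subseteq> TP: tensor_product A L "bar_module bar L"
  by (intro tensor_product.intro module_axioms module_bar_module)

section \<open>The map \<open>phi_L\<close> on formal sums\<close>

context A_lattice
begin

definition Frag :: "('b \<times> 'b \<Rightarrow>\<^sub>0 int) set" where
  "Frag = {c. Poly_Mapping.keys c \<subseteq> carrier L \<times> carrier L}"

lemma FragD: "c \<in> Frag \<Longrightarrow> Poly_Mapping.keys c \<subseteq> carrier L \<times> carrier L"
  by (simp add: Frag_def)

lemma Frag_simps [simp]: "0 \<in> Frag" "frag_of (x, y) \<in> Frag \<longleftrightarrow> x \<in> carrier L \<and> y \<in> carrier L"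
  "\<lbrakk>c \<in> Frag; d \<in> Frag\<rbrakk> \<Longrightarrow> c - d \<in> Frag" "\<lbrakk>c \<in> Frag; d \<in> Frag\<rbrakk> \<Longrightarrow> c + d \<in> Frag"
  "\<lbrakk>a \<in> carrier A; c \<in> Frag\<rbrakk> \<Longrightarrow> TP.act a c \<in> Frag"
  using keys_diff[of c d] keys_add[of c d] TP.act_keys[of a c] by (auto simp: Frag_def)

lemma Frag_induct [consumes 1, case_names zero diff frag_of]:
  assumes "c \<in> Frag" "P 0" "\<And>c d. \<lbrakk>c \<in> Frag; d \<in> Frag; P c; P d\<rbrakk> \<Longrightarrow> P (c - d)"
    "\<And>x y. \<lbrakk>x \<in> carrier L; y \<in> carrier L\<rbrakk> \<Longrightarrow> P (frag_of (x, y))"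
  shows "P c"
  using assms by (intro free_Abelian_group_induct[of c "carrier L \<times> carrier L" P]) (auto simp: Frag_def)

text \<open>This is \<open>phi_L\<close> before passing to cosets; \<open>phi_cls\<close> makes the
  connection.\<close>

definition ev :: "('b \<times> 'b \<Rightarrow>\<^sub>0 int) \<Rightarrow> ('a \<times> int) set" where
  "ev = frag_eval (AQ A) pair"

lemma bilinear_pair: "TP.bilinear_into (AQ A) pair"
  by (simp add: TP.bilinear_into_def pair_add pair_add_right pair_smult pair_smult_right)

lemma ev_simps [simp]:
  "ev 0 = \<zero>\<^bsub>AQ A\<^esub>" "\<lbrakk>x \<in> carrier L; y \<in> carrier L\<rbrakk> \<Longrightarrow> ev (frag_of (x, y)) = pair x y"
  by (simp_all add: ev_def)

lemma ev_diff: "\<lbrakk>c \<in> Frag; d \<in> Frag\<rbrakk> \<Longrightarrow> ev (c - d) = ev c \<ominus>\<^bsub>AQ A\<^esub> ev d"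
  unfolding ev_def by (rule Q.frag_eval_diff[where S = "carrier L \<times> carrier L"]) (auto simp: Frag_def)

lemma ev_add: "\<lbrakk>c \<in> Frag; d \<in> Frag\<rbrakk> \<Longrightarrow> ev (c + d) = ev c \<oplus>\<^bsub>AQ A\<^esub> ev d"
  unfolding ev_def by (rule Q.frag_eval_add[where S = "carrier L \<times> carrier L"]) (auto simp: Frag_def)

lemma ev_closed [simp]: "c \<in> Frag \<Longrightarrow> ev c \<in> QQ"
  unfolding ev_def by (rule Q.frag_eval_closed) (auto simp: Frag_def)

lemma act_diff_frag: "TP.act a (c - d) = TP.act a c - TP.act a d"
  by (rule frag_extend_diff)

lemma ev_act:
  assumes a: "a \<in> carrier A" and c: "c \<in> Frag"
  shows "ev (TP.act a c) = emb a \<star> ev c"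
  using c
proof (induction rule: Frag_induct)
  case (diff c d)
  have "emb a \<star> (ev c \<ominus>\<^bsub>AQ A\<^esub> ev d) = emb a \<star> ev c \<ominus>\<^bsub>AQ A\<^esub> emb a \<star> ev d"
    using a diff by (simp add: Q.minus_eq Q.r_distr Q.r_minus)
  then show ?case using diff a by (simp add: act_diff_frag ev_diff)
qed (use a in \<open>simp_all add: pair_smult\<close>)

lemma phi_cls: "c \<in> Frag \<Longrightarrow> phi_L A L (TP.cls c) = ev c"
  unfolding phi_L_def pair_def[symmetric] ev_def
  by (rule TP.tensor_lift_cls[OF Q.is_abelian_group bilinear_pair]) (simp add: FragD)

lemma tensor_carrier: "carrier (tensor A L (bar_module bar L)) = TP.cls ` Frag"
  unfolding TP.tensor_carrier by (simp add: free_Abelian_group_def Frag_def)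

text \<open>Additivity and linearity of \<open>phi_L\<close> hold for every lattice, so
  invertibility comes down to integral values on pure tensors, attaining 1, and injectivity.
  Attaining 1 suffices for surjectivity: acting by a on a preimage of 1 gives a preimage of
  a.\<close>

lemma invertible_iff:
  "invertible_A_lattice A bar L \<longleftrightarrow>
    (\<forall>x\<in>carrier L. \<forall>y\<in>carrier L. pair x y \<in> emb ` carrier A) \<and> (\<exists>c\<in>Frag. ev c = \<one>\<^bsub>AQ A\<^esub>) \<and>
    (\<forall>c\<in>Frag. \<forall>d\<in>Frag. ev c = ev d \<longrightarrow> TP.cls c = TP.cls d)" (is "?l \<longleftrightarrow> ?r")
proof
  let ?T = "tensor A L (bar_module bar L)"
  let ?E = "AQ_sub A (emb ` carrier A)"
  have E: "carrier ?E = emb ` carrier A" by (simp add: AQ_sub_def)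
  {
    assume ?l
    then have bij: "bij_betw (phi_L A L) (carrier ?T) (emb ` carrier A)"
      by (simp add: invertible_A_lattice_def module_isos_def iso_def E)
    show ?r
    proof (intro conjI ballI impI)
      fix x y assume "x \<in> carrier L" "y \<in> carrier L"
      then have f: "frag_of (x, y) \<in> Frag" "ev (frag_of (x, y)) = pair x y" by simp_all
      then have "phi_L A L (TP.cls (frag_of (x, y))) \<in> emb ` carrier A"
        using bij unfolding tensor_carrier bij_betw_def by blast
      then show "pair x y \<in> emb ` carrier A" using phi_cls[OF f(1)] f(2) by simp
    next
      have "\<one>\<^bsub>AQ A\<^esub> \<in> phi_L A L ` TP.cls ` Frag"
        using bij one_closed AQ_of_one unfolding tensor_carrier bij_betw_def by (metis imageI)
      then obtain c where c: "c \<in> Frag" "\<one>\<^bsub>AQ A\<^esub> = phi_L A L (TP.cls c)" by (elim imageE) simp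
      then show "\<exists>c\<in>Frag. ev c = \<one>\<^bsub>AQ A\<^esub>" using phi_cls[OF c(1)] by (intro bexI[OF _ c(1)]) simp
    next
      fix c d assume cd: "c \<in> Frag" "d \<in> Frag" "ev c = ev d"
      have "phi_L A L (TP.cls c) = phi_L A L (TP.cls d)" using phi_cls[OF cd(1)] phi_cls[OF cd(2)] cd(3) by simp
      then show "TP.cls c = TP.cls d"
        using bij cd(1,2) unfolding tensor_carrier bij_betw_def by (elim conjE) (drule (1) inj_onD; blast)
    qed
  next
    assume r: ?r
    then obtain c0 where c0: "c0 \<in> Frag" "ev c0 = \<one>\<^bsub>AQ A\<^esub>" by blast
    have int: "ev c \<in> emb ` carrier A" if "c \<in> Frag" for c
      using that
    proof (induction rule: Frag_induct)
      case zero
      then show ?case using AQ_of_zero[symmetric] by simp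
    next
      case (diff c d)
      then obtain a b where ab: "a \<in> carrier A" "b \<in> carrier A" "ev c = emb a" "ev d = emb b" by blast
      then have "ev (c - d) = emb (a \<ominus> b)" using diff(1,2) AQ_of_minus[of a b] by (simp add: ev_diff)
      then show ?case using ab by blast
    qed (use r in simp)
    have "phi_L A L \<in> hom (add_monoid ?T) (add_monoid ?E)"
    proof (rule homI)
      fix t assume "t \<in> carrier (add_monoid ?T)"
      then show "phi_L A L t \<in> carrier (add_monoid ?E)" by (auto simp: tensor_carrier E phi_cls int)
    next
      fix t u assume "t \<in> carrier (add_monoid ?T)" "u \<in> carrier (add_monoid ?T)"
      then obtain c d where cd: "c \<in> Frag" "t = TP.cls c" "d \<in> Frag" "u = TP.cls d" by (auto simp: tensor_carrier)
      then have "t \<oplus>\<^bsub>?T\<^esub> u = TP.cls (c + d)" by (simp add: TP.tensor_add FragD)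
      then show "phi_L A L (t \<otimes>\<^bsub>add_monoid ?T\<^esub> u) = phi_L A L t \<otimes>\<^bsub>add_monoid ?E\<^esub> phi_L A L u"
        using cd Frag_simps(4)[OF cd(1,3)] by (simp add: phi_cls ev_add AQ_sub_def)
    qed
    moreover have "bij_betw (phi_L A L) (carrier ?T) (emb ` carrier A)"
      unfolding tensor_carrier
    proof (rule bij_betw_imageI)
      show "inj_on (phi_L A L) (TP.cls ` Frag)"
      proof (rule inj_onI; elim imageE)
        fix t u c d assume h: "phi_L A L t = phi_L A L u" "t = TP.cls c" "c \<in> Frag" "u = TP.cls d" "d \<in> Frag"
        then have "ev c = ev d" using phi_cls[of c] phi_cls[of d] by simp
        with r h(3,5) have "TP.cls c = TP.cls d" by blast
        with h show "t = u" by simp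
      qed
      show "phi_L A L ` TP.cls ` Frag = emb ` carrier A"
      proof (intro equalityI subsetI)
        fix z assume "z \<in> phi_L A L ` TP.cls ` Frag"
        then obtain c where "c \<in> Frag" "z = phi_L A L (TP.cls c)" by (elim imageE) simp
        then show "z \<in> emb ` carrier A" using int[of c] phi_cls[of c] by simp
      next
        fix z assume "z \<in> emb ` carrier A"
        then obtain a where a: "a \<in> carrier A" "z = emb a" by blast
        then have f: "TP.act a c0 \<in> Frag" "ev (TP.act a c0) = z" using c0 ev_act[of a c0] by simp_all
        then have "z = phi_L A L (TP.cls (TP.act a c0))" using phi_cls[OF f(1)] by simp
        then show "z \<in> phi_L A L ` TP.cls ` Frag" using f(1) by blast
      qed
    qed
    moreover have "phi_L A L (a \<odot>\<^bsub>?T\<^esub> t) = a \<odot>\<^bsub>?E\<^esub> phi_L A L t" if a: "a \<in> carrier A" and t: "t \<in> carrier ?T" for a t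
    proof -
      obtain c where c: "c \<in> Frag" "t = TP.cls c" using t unfolding tensor_carrier by blast
      then have "a \<odot>\<^bsub>?T\<^esub> t = TP.cls (TP.act a c)" using a by (simp add: TP.tensor_smult FragD)
      then show ?thesis
        using phi_cls[OF Frag_simps(5)[OF a c(1)]] c a phi_cls[OF c(1)] ev_act[OF a c(1)] by (simp add: AQ_sub_def)
    qed
    ultimately show ?l by (simp add: invertible_A_lattice_def module_isos_def iso_def E)
  }
qed

end

section \<open>Integral pairings and the rank one identity\<close>

locale integral_A_lattice = A_lattice A bar L
  for A :: "('a, 'c) ring_scheme" (structure) and bar and L :: "('a, 'b) form_module" (structure) +
  assumes pair_integral: "\<lbrakk>x \<in> carrier L; y \<in> carrier L\<rbrakk> \<Longrightarrow> pair x y \<in> AQ_of A ` carrier A"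
begin

text \<open>The pairing pulled back from \<open>AQ A\<close> to \<open>A\<close>, so that its values
  can act on \<open>L\<close> as scalars.\<close>

definition s :: "'b \<Rightarrow> 'b \<Rightarrow> 'a" where "s x y = inv_into (carrier A) emb (pair x y)"

lemma emb_s: "\<lbrakk>x \<in> carrier L; y \<in> carrier L\<rbrakk> \<Longrightarrow> emb (s x y) = pair x y"
  unfolding s_def by (rule f_inv_into_f[OF pair_integral])

lemma s_closed [simp, intro]: "\<lbrakk>x \<in> carrier L; y \<in> carrier L\<rbrakk> \<Longrightarrow> s x y \<in> carrier A"
  unfolding s_def by (rule inv_into_into[OF pair_integral])

lemma s_add: "\<lbrakk>x \<in> carrier L; x' \<in> carrier L; y \<in> carrier L\<rbrakk> \<Longrightarrow> s (x \<oplus>\<^bsub>L\<^esub> x') y = s x y \<oplus> s x' y"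
  by (rule AQ_of_inj) (simp_all add: AQ_of_add emb_s pair_add)

lemma s_smult: "\<lbrakk>a \<in> carrier A; x \<in> carrier L; y \<in> carrier L\<rbrakk> \<Longrightarrow> s (a \<odot>\<^bsub>L\<^esub> x) y = a \<otimes> s x y"
  by (rule AQ_of_inj) (simp_all add: AQ_of_mult emb_s pair_smult)

lemma bar_s: "\<lbrakk>x \<in> carrier L; y \<in> carrier L\<rbrakk> \<Longrightarrow> bar (s x y) = s y x"
  by (rule AQ_of_inj) (simp_all add: AQ_bar_AQ_of[symmetric] emb_s pair_bar)

lemma s_add_right: "\<lbrakk>x \<in> carrier L; y \<in> carrier L; y' \<in> carrier L\<rbrakk> \<Longrightarrow> s x (y \<oplus>\<^bsub>L\<^esub> y') = s x y \<oplus> s x y'"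
  by (rule AQ_of_inj) (simp_all add: AQ_of_add emb_s pair_add_right)

lemma s_smult_right: "\<lbrakk>a \<in> carrier A; x \<in> carrier L; y \<in> carrier L\<rbrakk> \<Longrightarrow> s x (bar a \<odot>\<^bsub>L\<^esub> y) = a \<otimes> s x y"
  by (rule AQ_of_inj) (simp_all add: AQ_of_mult emb_s pair_smult_right)

lemma s_self_zero: "\<lbrakk>x \<in> carrier L; s x x = \<zero>\<rbrakk> \<Longrightarrow> x = \<zero>\<^bsub>L\<^esub>"
  using pair_self_zero[of x] emb_s[of x x] AQ_of_zero by simp

lemma s_zero: "y \<in> carrier L \<Longrightarrow> s \<zero>\<^bsub>L\<^esub> y = \<zero>"
  using s_smult[of \<zero> "\<zero>\<^bsub>L\<^esub>" y] by simp

lemma s_minus: "\<lbrakk>x \<in> carrier L; x' \<in> carrier L; y \<in> carrier L\<rbrakk> \<Longrightarrow> s (x \<ominus>\<^bsub>L\<^esub> x') y = s x y \<ominus> s x' y"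
proof -
  assume h: "x \<in> carrier L" "x' \<in> carrier L" "y \<in> carrier L"
  have "s (x \<ominus>\<^bsub>L\<^esub> x') y \<oplus> s x' y = s x y"
    using h by (simp add: s_add[symmetric] M.minus_eq M.a_assoc M.l_neg)
  then show ?thesis using h by (intro abelian_group.eq_minusI[OF is_abelian_group]) auto
qed

text \<open>Pairing both sides with a further vector gives the vanishing of all 2 by 2 minors of
  \<open>s\<close>, as in \<open>rank_one_s\<close>; this is why the name is apt.\<close>

definition rank_one :: bool where
  "rank_one \<longleftrightarrow> (\<forall>x\<in>carrier L. \<forall>y\<in>carrier L. \<forall>z\<in>carrier L. s x y \<odot>\<^bsub>L\<^esub> z = s z y \<odot>\<^bsub>L\<^esub> x)"

lemma rank_oneD: "\<lbrakk>rank_one; x \<in> carrier L; y \<in> carrier L; z \<in> carrier L\<rbrakk> \<Longrightarrow> s x y \<odot>\<^bsub>L\<^esub> z = s z y \<odot>\<^bsub>L\<^esub> x"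
  by (simp add: rank_one_def)

lemma rank_one_s:
  assumes "rank_one" "x \<in> carrier L" "y \<in> carrier L" "z \<in> carrier L" "v \<in> carrier L"
  shows "s x y \<otimes> s z v = s z y \<otimes> s x v"
  using arg_cong[OF rank_oneD[OF assms(1-4)], of "\<lambda>u. s u v"] assms by (simp add: s_smult)

text \<open>With \<open>u\<close> the preimage of \<open>1\<close> we have \<open>z \<otimes> y = s z y \<cdot> u\<close>. Contracting with \<open>x\<close> gives
  \<open>s x y \<cdot> z = s z y \<cdot> t x\<close> for some \<open>t\<close>, and \<open>n = z - t z\<close> satisfies \<open>s n n ^ 2 = 0\<close>.\<close>

lemma rank_one_if_injective:
  assumes c0: "c0 \<in> Frag" "ev c0 = \<one>\<^bsub>AQ A\<^esub>"
    and inj: "\<And>c d. \<lbrakk>c \<in> Frag; d \<in> Frag; ev c = ev d\<rbrakk> \<Longrightarrow> TP.cls c = TP.cls d"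
  shows "rank_one"
proof -
  \<comment> \<open>For fixed x this is balanced, the conjugation in the second factor being undone
    by the conjugate linearity of \<open>s\<close>; it thus passes to the tensor product with values
    in \<open>L\<close>.\<close>
  define \<beta> where "\<beta> x u v = s x v \<odot>\<^bsub>L\<^esub> u" for x u v
  have b: "TP.bilinear_into L (\<beta> x)" if "x \<in> carrier L" for x
    using that unfolding TP.bilinear_into_def \<beta>_def
    by (auto simp: smult_r_distr s_add_right smult_l_distr s_smult_right smult_assoc1[symmetric] m_comm)
  have bc: "\<beta> x (fst p) (snd p) \<in> carrier L" if "x \<in> carrier L" "p \<in> carrier L \<times> carrier L" for x p
    using that by (auto simp: \<beta>_def)
  define t where "t x = frag_eval L (\<beta> x) c0" for x
  have tc: "t x \<in> carrier L" if "x \<in> carrier L" for x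
    unfolding t_def by (rule M.frag_eval_closed) (use bc[OF that] FragD[OF c0(1)] in blast)
  have ea: "frag_eval L (\<beta> x) (TP.act a c) = a \<odot>\<^bsub>L\<^esub> frag_eval L (\<beta> x) c \<and> frag_eval L (\<beta> x) c \<in> carrier L"
    if x: "x \<in> carrier L" and a: "a \<in> carrier A" and c: "c \<in> Frag" for x a c
    using c
  proof (induction rule: Frag_induct)
    case (diff c d)
    have k: "Poly_Mapping.keys c \<subseteq> carrier L \<times> carrier L" "Poly_Mapping.keys d \<subseteq> carrier L \<times> carrier L"
      "Poly_Mapping.keys (TP.act a c) \<subseteq> carrier L \<times> carrier L" "Poly_Mapping.keys (TP.act a d) \<subseteq> carrier L \<times> carrier L"
      using FragD[OF diff(1)] FragD[OF diff(2)] FragD[OF Frag_simps(5)[OF a diff(1)]] FragD[OF Frag_simps(5)[OF a diff(2)]] by simp_all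
    have d: "frag_eval L (\<beta> x) (u - v) = frag_eval L (\<beta> x) u \<ominus>\<^bsub>L\<^esub> frag_eval L (\<beta> x) v"
      if "Poly_Mapping.keys u \<subseteq> carrier L \<times> carrier L" "Poly_Mapping.keys v \<subseteq> carrier L \<times> carrier L" for u v
      by (rule M.frag_eval_diff[OF _ that]) (use bc[OF x] in blast)
    show ?case
      unfolding act_diff_frag d[OF k(1,2)] d[OF k(3,4)]
      using diff a by (simp add: M.minus_eq smult_r_distr smult_r_minus)
  next
    case (frag_of u v)
    then show ?case using x a by (simp add: \<beta>_def smult_assoc1[symmetric] m_comm)
  qed (use a in simp)
  have main: "s x y \<odot>\<^bsub>L\<^esub> z = s z y \<odot>\<^bsub>L\<^esub> t x" if xyz: "x \<in> carrier L" "y \<in> carrier L" "z \<in> carrier L" for x y z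
  proof -
    have f: "frag_of (z, y) \<in> Frag" "TP.act (s z y) c0 \<in> Frag" using xyz c0 by simp_all
    have "ev (frag_of (z, y)) = ev (TP.act (s z y) c0)"
      using xyz c0 ev_act[of "s z y" c0] by (simp add: emb_s)
    from inj[OF f this] have "frag_eval L (\<beta> x) (frag_of (z, y)) = frag_eval L (\<beta> x) (TP.act (s z y) c0)"
      using f by (intro TP.frag_eval_cong_cls[OF M.abelian_group_axioms b[OF xyz(1)]]) (simp_all add: FragD)
    then show ?thesis using ea[OF xyz(1) _ c0(1), of "s z y"] xyz by (simp add: \<beta>_def t_def)
  qed
  have "t z = z" if z: "z \<in> carrier L" for z
  proof -
    define n where "n = z \<ominus>\<^bsub>L\<^esub> t z"
    have n: "n \<in> carrier L" using z tc by (simp add: n_def)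
    \<comment> \<open>\<open>main\<close> at (z, n, z) shows that \<open>s z n\<close> kills n = z -
      t z. The next fact takes \<open>main\<close> at (z, n, n), and expanding \<open>s n n\<close>
      in its first argument then gives a vanishing square.\<close>
    have 1: "s z n \<otimes> s n n = \<zero>"
    proof -
      have "s z n \<odot>\<^bsub>L\<^esub> n = \<zero>\<^bsub>L\<^esub>"
        using main[OF z n z] z tc[OF z] n by (simp add: n_def M.minus_eq smult_r_distr smult_r_minus M.r_neg)
      then show ?thesis using s_smult[of "s z n" n n] z n by (simp add: s_zero)
    qed
    have 2: "s n n \<otimes> s (t z) n = s z n \<otimes> s n n"
      using arg_cong[OF main[OF z n n], of "\<lambda>u. s u n"] z n tc[OF z] by (simp add: s_smult)
    have "s n n = s z n \<ominus> s (t z) n"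
      using s_minus[OF z tc[OF z] n] by (simp add: n_def)
    then have "s n n \<otimes> s n n = s n n \<otimes> (s z n \<ominus> s (t z) n)" by simp
    also have "\<dots> = s n n \<otimes> s z n \<ominus> s n n \<otimes> s (t z) n"
      using n z tc[OF z] by (simp add: a_minus_def r_distr r_minus)
    also have "\<dots> = \<zero>" using 1 2 n z by (simp add: m_comm[of "s n n" "s z n"] a_minus_def)
    finally have "s n n [^] (2::nat) = \<zero>" using n by (simp add: numeral_2_eq_2)
    then have "n = \<zero>\<^bsub>L\<^esub>" using reduced[of "s n n" 2] s_self_zero[OF n] n by blast
    then have "z \<oplus>\<^bsub>L\<^esub> \<ominus>\<^bsub>L\<^esub> t z \<oplus>\<^bsub>L\<^esub> t z = t z" using z tc[OF z] by (simp add: n_def M.minus_eq)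
    then show ?thesis using z tc[OF z] by (simp add: M.a_assoc M.l_neg)
  qed
  then show ?thesis using main by (simp add: rank_one_def)
qed

end

section \<open>Injectivity from the rank one identity\<close>

context tensor_product
begin

lemma frag_minus_right_relation:
  "\<lbrakk>x \<in> carrier M; y \<in> carrier N; y' \<in> carrier N\<rbrakk> \<Longrightarrow>
    frag_of (x, y \<ominus>\<^bsub>N\<^esub> y') - (frag_of (x, y) - frag_of (x, y')) \<in> T"
  using relations_uminus[OF relations_incl(2)[of x "y \<ominus>\<^bsub>N\<^esub> y'" y']]
  by (simp add: N.minus_eq N.a_assoc N.l_neg algebra_simps)

lemma frag_minus_left_relation:
  "\<lbrakk>x \<in> carrier M; x' \<in> carrier M; y \<in> carrier N\<rbrakk> \<Longrightarrow>
    frag_of (x \<ominus>\<^bsub>M\<^esub> x', y) - (frag_of (x, y) - frag_of (x', y)) \<in> T"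
  using relations_uminus[OF relations_incl(1)[of "x \<ominus>\<^bsub>M\<^esub> x'" x' y]]
  by (simp add: M.minus_eq M.a_assoc M.l_neg algebra_simps)

lemma frag_zero_right: "x \<in> carrier M \<Longrightarrow> frag_of (x, \<zero>\<^bsub>N\<^esub>) \<in> T"
  using relations_uminus[OF relations_incl(2)[of x "\<zero>\<^bsub>N\<^esub>" "\<zero>\<^bsub>N\<^esub>"]] by simp

lemma relations_diff: "\<lbrakk>c \<in> T; d \<in> T\<rbrakk> \<Longrightarrow> c - d \<in> T"
  using relations_add[OF _ relations_uminus] by force

text \<open>On formal sums the action is not additive in the scalar; it becomes so modulo
  relations.\<close>

lemma act_minus_relation:
  assumes a: "a \<in> carrier R" "b \<in> carrier R" and c: "Poly_Mapping.keys c \<subseteq> pairs"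
  shows "act (a \<ominus> b) c - (act a c - act b c) \<in> T"
proof (rule free_Abelian_group_induct[OF c, of "\<lambda>c. act (a \<ominus> b) c - (act a c - act b c) \<in> T"])
  show "act (a \<ominus> b) 0 - (act a 0 - act b 0) \<in> T" by (simp add: relations_zero)
next
  fix c d assume "act (a \<ominus> b) c - (act a c - act b c) \<in> T" "act (a \<ominus> b) d - (act a d - act b d) \<in> T"
  from relations_diff[OF this]
  show "act (a \<ominus> b) (c - d) - (act a (c - d) - act b (c - d)) \<in> T"
    by (simp add: frag_extend_diff algebra_simps)
next
  fix p assume "p \<in> pairs"
  then obtain x y where p: "p = (x, y)" "x \<in> carrier M" "y \<in> carrier N" by auto
  have "(a \<ominus> b) \<odot>\<^bsub>M\<^esub> x = a \<odot>\<^bsub>M\<^esub> x \<ominus>\<^bsub>M\<^esub> b \<odot>\<^bsub>M\<^esub> x"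
    using a p by (simp add: a_minus_def M.smult_l_distr M.smult_l_minus)
  then show "act (a \<ominus> b) (frag_of p) - (act a (frag_of p) - act b (frag_of p)) \<in> T"
    using frag_minus_left_relation[of "a \<odot>\<^bsub>M\<^esub> x" "b \<odot>\<^bsub>M\<^esub> x" y] a p by simp
qed

end

context integral_A_lattice
begin

lemma ev_integral: "c \<in> Frag \<Longrightarrow> \<exists>a\<in>carrier A. ev c = emb a"
proof (induction rule: Frag_induct)
  case zero
  then show ?case using AQ_of_zero by auto
next
  case (diff c d)
  then obtain a b where ab: "a \<in> carrier A" "b \<in> carrier A" "ev c = emb a" "ev d = emb b" by blast
  then have "ev (c - d) = emb (a \<ominus> b)" using diff(1,2) AQ_of_minus[of a b] by (simp add: ev_diff)
  then show ?case using ab by blast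
next
  case (frag_of x y)
  then show ?case using emb_s by (intro bexI[of _ "s x y"]) auto
qed

lemma emb_eq_ev_diff:
  assumes cd: "c \<in> Frag" "d \<in> Frag" and a: "a \<in> carrier A" "emb a = ev (c - d)"
  obtains b b' where "b \<in> carrier A" "b' \<in> carrier A" "emb b = ev c" "emb b' = ev d" "a = b \<ominus> b'"
proof -
  obtain b b' where b: "b \<in> carrier A" "b' \<in> carrier A" "ev c = emb b" "ev d = emb b'"
    using ev_integral cd by meson
  then have "a = b \<ominus> b'" using a cd by (intro AQ_of_inj) (simp_all add: AQ_of_minus ev_diff)
  with b that show ?thesis by simp
qed

lemma injective_if_rank_one:
  assumes r1: "rank_one" and c0: "c0 \<in> Frag" "ev c0 = \<one>\<^bsub>AQ A\<^esub>"
    and c: "c \<in> Frag" "d \<in> Frag" "ev c = ev d"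
  shows "TP.cls c = TP.cls d"
proof -
  let ?T = "tensor_relations A L (bar_module bar L)"
  \<comment> \<open>For c a pure tensor of u and v the rank one identity is used twice: s(x,y) u =
    s(u,y) x turns the left factor into x, the scalar crosses over with a bar, and s(y,u) v = s(v,u)
    y turns the right factor into y. The case of interest is c = \<open>c0\<close> and a = 1, where
    the scalar s(x,y) times \<open>c0\<close> becomes the tensor of x and y.\<close>
  have absorb: "TP.act (s x y) c - frag_of (x, bar a \<odot>\<^bsub>L\<^esub> y) \<in> ?T"
    if c: "c \<in> Frag" and a: "a \<in> carrier A" "emb a = ev c" and xy: "x \<in> carrier L" "y \<in> carrier L" for c a x y
    using c a
  proof (induction arbitrary: a rule: Frag_induct)
    case zero
    then have "a = \<zero>" by (intro AQ_of_inj) (simp_all add: AQ_of_zero)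
    then have "bar a \<odot>\<^bsub>L\<^esub> y = \<zero>\<^bsub>L\<^esub>" using bar_minus[of \<zero> \<zero>] xy by (simp add: a_minus_def)
    then show ?case using TP.relations_uminus[OF TP.frag_zero_right] xy by simp
  next
    case (diff c d)
    obtain b b' where b: "b \<in> carrier A" "b' \<in> carrier A" "emb b = ev c" "emb b' = ev d" "a = b \<ominus> b'"
      using emb_eq_ev_diff[OF diff(1,2,5,6)] .
    let ?f = "\<lambda>a. frag_of (x, bar a \<odot>\<^bsub>L\<^esub> y)"
    have "bar a \<odot>\<^bsub>L\<^esub> y = bar b \<odot>\<^bsub>L\<^esub> y \<ominus>\<^bsub>L\<^esub> bar b' \<odot>\<^bsub>L\<^esub> y"
      using b xy by (simp add: bar_minus) (simp add: a_minus_def smult_l_distr smult_l_minus)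
    moreover have "u \<ominus>\<^bsub>bar_module bar L\<^esub> v = u \<ominus>\<^bsub>L\<^esub> v" for u v
      by (simp add: a_minus_def a_inv_def bar_module_def m_inv_def)
    ultimately have "?f a - (?f b - ?f b') \<in> ?T"
      using TP.frag_minus_right_relation[of x "bar b \<odot>\<^bsub>L\<^esub> y" "bar b' \<odot>\<^bsub>L\<^esub> y"] b xy by simp
    from TP.relations_diff[OF TP.relations_diff[OF diff(3)[OF b(1,3)] diff(4)[OF b(2,4)]] this]
    show ?case by (simp add: act_diff_frag algebra_simps)
  next
    case (frag_of u v)
    then have a: "a = s u v" by (intro AQ_of_inj) (simp_all add: emb_s)
    have "TP.act (s x y) (frag_of (u, v)) = frag_of (s u y \<odot>\<^bsub>L\<^esub> x, v)"
      using rank_oneD[OF r1 xy frag_of(1)] by simp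
    moreover have "frag_of (s u y \<odot>\<^bsub>L\<^esub> x, v) - frag_of (x, bar (s u y) \<odot>\<^bsub>L\<^esub> v) \<in> ?T"
      using TP.relations_incl(3)[of "s u y" x v] frag_of xy by simp
    moreover have "bar (s u y) \<odot>\<^bsub>L\<^esub> v = bar a \<odot>\<^bsub>L\<^esub> y"
      using rank_oneD[OF r1 xy(2) frag_of(1,2)] frag_of xy by (simp add: bar_s a)
    ultimately show ?case by simp
  qed
  \<comment> \<open>Every class is thus a multiple of that of \<open>c0\<close>, with multiplier its
    value under \<open>ev\<close>; equal values then force equal classes.\<close>
  have norm: "c - TP.act a c0 \<in> ?T" if "c \<in> Frag" "a \<in> carrier A" "emb a = ev c" for c a
    using that
  proof (induction arbitrary: a rule: Frag_induct)
    case zero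
    then have "a = \<zero>" by (intro AQ_of_inj) (simp_all add: AQ_of_zero)
    then show ?case using TP.act_minus_relation[of \<zero> \<zero> c0] TP.relations_uminus[of "TP.act \<zero> c0"] FragD[OF c0(1)]
      by (simp add: a_minus_def)
  next
    case (diff c d)
    obtain b b' where b: "b \<in> carrier A" "b' \<in> carrier A" "emb b = ev c" "emb b' = ev d" "a = b \<ominus> b'"
      using emb_eq_ev_diff[OF diff(1,2,5,6)] .
    have "TP.act a c0 - (TP.act b c0 - TP.act b' c0) \<in> ?T"
      using TP.act_minus_relation[of b b' c0] b FragD[OF c0(1)] by simp
    from TP.relations_diff[OF TP.relations_diff[OF diff(3)[OF b(1,3)] diff(4)[OF b(2,4)]] this]
    show ?case by (simp add: algebra_simps)
  next
    case (frag_of x y)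
    then have a: "a = s x y" by (intro AQ_of_inj) (simp_all add: emb_s)
    have "TP.act (s x y) c0 - frag_of (x, y) \<in> ?T"
      using absorb[OF c0(1) one_closed _ frag_of(1,2)] c0(2) frag_of by (simp add: AQ_of_one)
    from TP.relations_uminus[OF this] show ?case by (simp add: a)
  qed
  obtain a where a: "a \<in> carrier A" "ev c = emb a" using ev_integral[OF c(1)] by blast
  have "c - d \<in> ?T"
    using TP.relations_diff[OF norm[OF c(1) a(1)] norm[OF c(2) a(1)]] a c(3) by simp
  then show ?thesis using c FragD by (simp add: TP.cls_eq_iff)
qed

section \<open>A vector isotropic for no character\<close>

lemma char_pair_mult:
  assumes "rank_one" "\<psi> \<in> Q.chars" "x \<in> carrier L" "y \<in> carrier L" "z \<in> carrier L" "v \<in> carrier L"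
  shows "\<psi> (pair x y) * \<psi> (pair z v) = \<psi> (pair z y) * \<psi> (pair x v)"
proof -
  have "pair x y \<star> pair z v = pair z y \<star> pair x v"
    using arg_cong[OF rank_one_s[OF assms(1,3-6)], of emb] assms by (simp add: AQ_of_mult emb_s)
  then show ?thesis using assms Q.charD(2)[OF assms(2)] by (metis pair_closed)
qed

lemma char_pair_cnj: "\<lbrakk>\<psi> \<in> Q.chars; x \<in> carrier L; y \<in> carrier L\<rbrakk> \<Longrightarrow> \<psi> (pair y x) = cnj (\<psi> (pair x y))"
  using Q.char_bar[of \<psi> "pair x y"] by (simp add: pair_bar)

text \<open>Rank one is equality in Cauchy-Schwarz: |\<psi>(pair x y)|^2 = \<psi>(pair x x)
  \<psi>(pair y y). If all vectors were isotropic, \<psi> would vanish on every pairing, hence on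
  \<open>ev c0\<close> = 1.\<close>

lemma exists_char_nonzero:
  assumes r1: "rank_one" and c0: "c0 \<in> Frag" "ev c0 = \<one>\<^bsub>AQ A\<^esub>" and ch: "\<psi> \<in> Q.chars"
  shows "\<exists>x\<in>carrier L. \<psi> (pair x x) \<noteq> 0"
proof (rule ccontr)
  assume "\<not> ?thesis"
  then have z: "\<psi> (pair x x) = 0" if "x \<in> carrier L" for x using that by blast
  have z2: "\<psi> (pair x y) = 0" if "x \<in> carrier L" "y \<in> carrier L" for x y
    using char_pair_mult[OF r1 ch, of x y y x] char_pair_cnj[OF ch that] z[OF that(2)] that by simp
  have "\<psi> (ev c) = 0" if "c \<in> Frag" for c
    using that
  proof (induction rule: Frag_induct)
    case (diff c d)
    then show ?case by (simp add: ev_diff Q.lin_minus[OF Q.lin_char[OF ch]])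
  qed (simp_all add: z2 Q.lin_zero[OF Q.lin_char[OF ch]])
  from this[OF c0(1)] show False by (simp add: c0 Q.charD(3)[OF ch])
qed

text \<open>Given e good for D and isotropic for \<phi>, take x nonisotropic for \<phi> and look at
  x + k e. For \<psi> in D the value is a polynomial in k with leading coefficient \<psi>(pair e e)
  \<noteq> 0, so only finitely many k are bad; for \<phi> the value does not depend on k.\<close>

lemma exists_nonvanishing_finite:
  assumes r1: "rank_one" and c0: "c0 \<in> Frag" "ev c0 = \<one>\<^bsub>AQ A\<^esub>"
    and D: "finite D" "D \<subseteq> Q.chars"
  shows "\<exists>e\<in>carrier L. \<forall>\<psi>\<in>D. \<psi> (pair e e) \<noteq> 0"
  using D
proof (induction rule: finite_induct)
  case empty
  then show ?case by auto
next
  case (insert \<phi> D)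
  then obtain e where e: "e \<in> carrier L" "\<And>\<psi>. \<psi> \<in> D \<Longrightarrow> \<psi> (pair e e) \<noteq> 0" by auto
  show ?case
  proof (cases "\<phi> (pair e e) = 0")
    case False
    then show ?thesis using e by auto
  next
    case True
    have \<phi>: "\<phi> \<in> Q.chars" using insert by simp
    obtain x where x: "x \<in> carrier L" "\<phi> (pair x x) \<noteq> 0" using exists_char_nonzero[OF r1 c0 \<phi>] by blast
    define p where "p \<psi> = [:\<psi> (pair x x), \<psi> (pair x e) + \<psi> (pair e x), \<psi> (pair e e):]" for \<psi> :: "('a \<times> int) set \<Rightarrow> complex"
    define f where "f k = x \<oplus>\<^bsub>L\<^esub> iota k \<odot>\<^bsub>L\<^esub> e" for k
    have f: "f k \<in> carrier L" for k using x e by (simp add: f_def)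
    have pv: "\<psi> (pair (f k) (f k)) = poly (p \<psi>) (of_int k)" if ch: "\<psi> \<in> Q.chars" for \<psi> k
    proof -
      have sr: "pair u (iota k \<odot>\<^bsub>L\<^esub> v) = emb (iota k) \<star> pair u v" if "u \<in> carrier L" "v \<in> carrier L" for u v
        using pair_smult_right[of "iota k" u v] that by (simp add: bar_iota)
      have "\<psi> (pair (f k) (f k)) = \<psi> (pair x x) + of_int k * \<psi> (pair x e) +
          of_int k * (\<psi> (pair e x) + of_int k * \<psi> (pair e e))"
        using x e by (simp add: f_def pair_add pair_add_right pair_smult sr Q.charD[OF ch] char_emb_iota[OF ch] distrib_left)
      then show ?thesis by (simp add: p_def algebra_simps)
    qed
    have fin: "finite (\<Union>\<psi>\<in>D. {k::int. poly (p \<psi>) (of_int k) = 0})"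
    proof (intro finite_UN_I insert(1))
      fix \<psi> assume "\<psi> \<in> D"
      then have "p \<psi> \<noteq> 0" using e by (simp add: p_def)
      then have "finite {z. poly (p \<psi>) z = 0}" by (rule poly_roots_finite)
      then have "finite ((of_int :: int \<Rightarrow> complex) -` {z. poly (p \<psi>) z = 0})"
        by (rule finite_vimageI) (simp add: inj_on_def)
      then show "finite {k::int. poly (p \<psi>) (of_int k) = 0}" by (simp add: vimage_def)
    qed
    then obtain k where k: "k \<notin> (\<Union>\<psi>\<in>D. {k::int. poly (p \<psi>) (of_int k) = 0})"
      using infinite_UNIV_int by (metis ex_new_if_finite)
    \<comment> \<open>Rank one makes an isotropic vector orthogonal to everything under \<phi>, so
      the terms linear in k vanish along with the quadratic one.\<close>
    have "\<phi> (pair e x) = 0"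
      using char_pair_mult[OF r1 \<phi> e(1) x(1) x(1) e(1)] char_pair_cnj[OF \<phi> e(1) x(1)] True by simp
    then have "\<phi> (pair (f k) (f k)) = \<phi> (pair x x)"
      using True char_pair_cnj[OF \<phi> e(1) x(1)] by (simp add: pv[OF \<phi>] p_def)
    moreover have "\<psi> (pair (f k) (f k)) \<noteq> 0" if "\<psi> \<in> D" for \<psi>
      using k that insert(4) pv[of \<psi> k] by auto
    ultimately have "\<forall>\<psi>\<in>insert \<phi> D. \<psi> (pair (f k) (f k)) \<noteq> 0" using x by simp
    with f show ?thesis by blast
  qed
qed

text \<open>Characters may differ outside the carrier, so finiteness holds only for their
  restrictions; D picks one character for each restriction.\<close>

lemma exists_nonvanishing:
  assumes r1: "rank_one" and c0: "c0 \<in> Frag" "ev c0 = \<one>\<^bsub>AQ A\<^esub>"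
  obtains e where "e \<in> carrier L" "\<And>\<psi>. \<psi> \<in> Q.chars \<Longrightarrow> \<psi> (pair e e) \<noteq> 0"
proof -
  let ?r = "\<lambda>\<psi>. restrict \<psi> QQ"
  obtain D where D: "D \<subseteq> Q.chars" "finite D" "?r ` Q.chars = ?r ` D"
    using finite_subset_image[OF Q.finite_chars, of ?r Q.chars] by blast
  obtain e where e: "e \<in> carrier L" "\<forall>\<psi>\<in>D. \<psi> (pair e e) \<noteq> 0"
    using exists_nonvanishing_finite[OF r1 c0 D(2,1)] by blast
  have "\<psi> (pair e e) \<noteq> 0" if ch: "\<psi> \<in> Q.chars" for \<psi>
  proof -
    have "?r \<psi> \<in> ?r ` D" using ch D(3) by blast
    then obtain \<psi>' where d: "\<psi>' \<in> D" "?r \<psi> = ?r \<psi>'" by blast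
    from fun_cong[OF d(2), of "pair e e"] have "\<psi> (pair e e) = \<psi>' (pair e e)" using e(1) by simp
    with e d(1) show ?thesis by simp
  qed
  with e that show ?thesis by blast
qed

text \<open>With b = a/m, the trace of b * bar b * (e bar e) is the norm of a e divided by m^2,
  hence nonnegative. The criterion on trace forms makes all character values nonnegative, and they
  are nonzero by assumption.\<close>

lemma pair_self_totally_positive:
  assumes e: "e \<in> carrier L" and nz: "\<And>\<psi>. \<psi> \<in> Q.chars \<Longrightarrow> \<psi> (pair e e) \<noteq> 0"
  shows "pair e e \<in> totally_positive A"
proof -
  have "\<psi> (pair e e) \<in> \<real> \<and> Re (\<psi> (pair e e)) \<ge> 0" if ch: "\<psi> \<in> Q.chars" for \<psi>
  proof (rule Q.char_pos_if_trace_form_nonneg[OF _ _ _ ch])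
    fix b assume "b \<in> QQ"
    then obtain a m where a: "a \<in> carrier A" "m \<noteq> 0" "b = qfrac A a m" by (rule qfrac_cases)
    let ?q = "1 / of_int m :: rat"
    have b: "b = ?q \<odot>\<^bsub>AQ A\<^esub> emb a" using a by (simp add: qfrac_eq_smult)
    have pe: "pair (a \<odot>\<^bsub>L\<^esub> e) (a \<odot>\<^bsub>L\<^esub> e) = emb a \<star> emb (bar a) \<star> pair e e"
      using pair_smult_right[of "bar a" e e] a e by (simp add: pair_smult bar_bar Q.m_assoc)
    have "b \<star> cnjQ b \<star> pair e e = (?q * ?q) \<odot>\<^bsub>AQ A\<^esub> pair (a \<odot>\<^bsub>L\<^esub> e) (a \<odot>\<^bsub>L\<^esub> e)"
      unfolding b pe using a e
      by (simp add: Q.bar_smult AQ_bar_AQ_of Q.smult_mult Q.mult_smult Q.smult_smult)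
    then have "Q.trace (b \<star> cnjQ b \<star> pair e e) = ?q * ?q * ip L (a \<odot>\<^bsub>L\<^esub> e) (a \<odot>\<^bsub>L\<^esub> e)"
      using a e Q.linD(2)[OF Q.lin_trace] trace_pair[of "a \<odot>\<^bsub>L\<^esub> e" "a \<odot>\<^bsub>L\<^esub> e"]
      by (simp add: AQ_coords(2)[symmetric])
    moreover have "ip L (a \<odot>\<^bsub>L\<^esub> e) (a \<odot>\<^bsub>L\<^esub> e) \<ge> 0"
    proof (cases "a \<odot>\<^bsub>L\<^esub> e = \<zero>\<^bsub>L\<^esub>")
      case True
      then show ?thesis using ip_add[of "\<zero>\<^bsub>L\<^esub>" "\<zero>\<^bsub>L\<^esub>" "\<zero>\<^bsub>L\<^esub>"] by simp
    next
      case False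
      then show ?thesis using ip_pos[of "a \<odot>\<^bsub>L\<^esub> e"] a e by simp
    qed
    ultimately show "Q.trace (b \<star> cnjQ b \<star> pair e e) \<ge> 0" by (simp del: times_divide_eq_left)
  qed (use e pair_bar in auto)
  moreover have "Re z \<noteq> 0" if "z \<in> \<real>" "z \<noteq> 0" for z using that complex_is_Real_iff by (metis complex_eq_0 power_zero_numeral add_0)
  ultimately show ?thesis
    using nz e by (auto simp: totally_positive_def order_less_le)
qed

end

section \<open>Ideal lattices\<close>

lemma ideal_lattice_sel [simp]:
  "carrier (ideal_lattice A bar I w) = I"
  "x \<oplus>\<^bsub>ideal_lattice A bar I w\<^esub> y = x \<oplus>\<^bsub>AQ A\<^esub> y"
  "a \<odot>\<^bsub>ideal_lattice A bar I w\<^esub> x = AQ_of A a \<otimes>\<^bsub>AQ A\<^esub> x"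
  "ip (ideal_lattice A bar I w) x y = AQ_trace A (x \<otimes>\<^bsub>AQ A\<^esub> AQ_bar A bar y \<otimes>\<^bsub>AQ A\<^esub> inv\<^bsub>AQ A\<^esub> w)"
  by (simp_all add: ideal_lattice_def module.extend_def form_module.fields_def AQ_sub_def)

lemma AQ_sub_sel [simp]:
  "carrier (AQ_sub A I) = I" "x \<oplus>\<^bsub>AQ_sub A I\<^esub> y = x \<oplus>\<^bsub>AQ A\<^esub> y" "\<zero>\<^bsub>AQ_sub A I\<^esub> = \<zero>\<^bsub>AQ A\<^esub>"
  "a \<odot>\<^bsub>AQ_sub A I\<^esub> x = AQ_of A a \<otimes>\<^bsub>AQ A\<^esub> x"
  by (simp_all add: AQ_sub_def)

lemma AQ_sub_minus: "\<ominus>\<^bsub>AQ_sub A I\<^esub> x = \<ominus>\<^bsub>AQ (A :: ('a, 'c) ring_scheme)\<^esub> x" if "I = carrier (AQ A)"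
  by (simp add: a_inv_def m_inv_def that)

context cm_order
begin

text \<open>Nonzero character values give invertibility; real ones give invariance under
  conjugation.\<close>

lemma totally_positive_unit:
  assumes "w \<in> totally_positive A"
  shows "w \<in> Units (AQ A)" "cnjQ w = w"
proof -
  have w: "w \<in> QQ" and p: "\<And>\<psi>. \<psi> \<in> Q.chars \<Longrightarrow> \<psi> w \<in> \<real> \<and> 0 < Re (\<psi> w)"
    using assms by (auto simp: totally_positive_def)
  show "w \<in> Units (AQ A)" using w p by (intro Q.unit_if_chars_nonzero) force+
  show "cnjQ w = w" using w p by (intro Q.chars_separate) (auto simp: Q.char_bar Reals_cnj_iff)
qed

end

context A_lattice
begin

text \<open>Finite generation phrased as an induction rule: a subset containing 0 and S and closed
  under differences is everything. In this form it can be applied directly to membership in a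
  submodule.\<close>

lemma lattice_span:
  obtains S where "finite S" "S \<subseteq> carrier L"
    "\<And>P x. \<lbrakk>P \<zero>\<^bsub>L\<^esub>; \<And>x y. \<lbrakk>x \<in> carrier L; y \<in> carrier L; P x; P y\<rbrakk> \<Longrightarrow> P (x \<ominus>\<^bsub>L\<^esub> y);
      \<And>x. x \<in> S \<Longrightarrow> P x; x \<in> carrier L\<rbrakk> \<Longrightarrow> P x"
proof -
  obtain n g where g: "g \<in> iso (add_monoid L) (free_Abelian_group {..<n::nat})"
    using free_lattice by (auto simp: free_finite_rank_def is_iso_def)
  then have gh: "g \<in> hom (add_monoid L) (free_Abelian_group {..<n})" and inj: "inj_on g (carrier L)"
    and sur: "g ` carrier L = carrier (free_Abelian_group {..<n})"
    by (auto simp: iso_def bij_betw_def)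
  have add: "g (x \<oplus>\<^bsub>L\<^esub> y) = g x + g y" if "x \<in> carrier L" "y \<in> carrier L" for x y
    using hom_mult[OF gh, of x y] that by simp
  have diff: "g (x \<ominus>\<^bsub>L\<^esub> y) = g x - g y" if "x \<in> carrier L" "y \<in> carrier L" for x y
    using add[of "x \<ominus>\<^bsub>L\<^esub> y" y] that by (simp add: M.minus_eq M.a_assoc M.l_neg)
  have zero: "g \<zero>\<^bsub>L\<^esub> = 0" using add[of "\<zero>\<^bsub>L\<^esub>" "\<zero>\<^bsub>L\<^esub>"] by simp
  define h where "h = inv_into (carrier L) g"
  have h: "h c \<in> carrier L" "g (h c) = c" if "Poly_Mapping.keys c \<subseteq> {..<n}" for c
    using that sur unfolding h_def by (auto intro!: inv_into_into f_inv_into_f)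
  have span: "P x" if P: "P \<zero>\<^bsub>L\<^esub>" "\<And>x y. \<lbrakk>x \<in> carrier L; y \<in> carrier L; P x; P y\<rbrakk> \<Longrightarrow> P (x \<ominus>\<^bsub>L\<^esub> y)"
    "\<And>x. x \<in> (\<lambda>i. h (frag_of i)) ` {..<n} \<Longrightarrow> P x" and x: "x \<in> carrier L" for P x
  proof -
    have k: "Poly_Mapping.keys (g x) \<subseteq> {..<n}" using sur x by force
    have "\<forall>x\<in>carrier L. g x = c \<longrightarrow> P x" if "Poly_Mapping.keys c \<subseteq> {..<n}" for c
    proof (rule free_Abelian_group_induct[OF that, of "\<lambda>c. \<forall>x\<in>carrier L. g x = c \<longrightarrow> P x"])
      show "\<forall>x\<in>carrier L. g x = 0 \<longrightarrow> P x" using zero inj P(1) by (metis M.zero_closed inj_onD)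
    next
      fix c d assume k: "Poly_Mapping.keys c \<subseteq> {..<n}" "Poly_Mapping.keys d \<subseteq> {..<n}"
        and ih: "\<forall>x\<in>carrier L. g x = c \<longrightarrow> P x" "\<forall>x\<in>carrier L. g x = d \<longrightarrow> P x"
      show "\<forall>x\<in>carrier L. g x = c - d \<longrightarrow> P x"
      proof (intro ballI impI)
        fix x assume x: "x \<in> carrier L" "g x = c - d"
        have "x = h c \<ominus>\<^bsub>L\<^esub> h d" using diff h k x by (intro inj_onD[OF inj]) auto
        then show "P x" using P(2)[of "h c" "h d"] ih h k by simp
      qed
    next
      fix i assume i: "i \<in> {..<n}"
      then have "h (frag_of i) \<in> carrier L" "g (h (frag_of i)) = frag_of i" using h by auto
      then show "\<forall>x\<in>carrier L. g x = frag_of i \<longrightarrow> P x" using P(3) i inj by (metis image_eqI inj_onD)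
    qed
    with x k show ?thesis by blast
  qed
  show ?thesis
  proof (rule that)
    show "finite ((\<lambda>i. h (frag_of i)) ` {..<n})" by simp
    show "(\<lambda>i. h (frag_of i)) ` {..<n} \<subseteq> carrier L" using h by auto
  qed (fact span)
qed

end

section \<open>The ideal attached to a nonisotropic vector\<close>

context integral_A_lattice
begin

context
  fixes e
  assumes r1: "rank_one" and e: "e \<in> carrier L" and tp: "pair e e \<in> totally_positive A"
begin

definition I_e :: "('a \<times> int) set set" where "I_e = (\<lambda>x. pair x e) ` carrier L"

lemma unit_e: "pair e e \<in> Units (AQ A)"
  using totally_positive_unit[OF tp] by simp

lemma I_e_subset: "I_e \<subseteq> QQ"
  using e by (auto simp: I_e_def)

lemma pair_zero: "y \<in> carrier L \<Longrightarrow> pair \<zero>\<^bsub>L\<^esub> y = \<zero>\<^bsub>AQ A\<^esub>"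
  using pair_add[of "\<zero>\<^bsub>L\<^esub>" "\<zero>\<^bsub>L\<^esub>" y] by simp

lemma pair_minus:
  assumes "x \<in> carrier L" "x' \<in> carrier L" "y \<in> carrier L"
  shows "pair (x \<ominus>\<^bsub>L\<^esub> x') y = pair x y \<ominus>\<^bsub>AQ A\<^esub> pair x' y"
proof (rule Q.eq_minusI)
  show "pair (x \<ominus>\<^bsub>L\<^esub> x') y \<oplus>\<^bsub>AQ A\<^esub> pair x' y = pair x y"
    using assms by (simp add: pair_add[symmetric] M.minus_eq M.a_assoc M.l_neg)
qed (use assms in auto)

lemma pair_uminus: "\<lbrakk>x \<in> carrier L; y \<in> carrier L\<rbrakk> \<Longrightarrow> pair (\<ominus>\<^bsub>L\<^esub> x) y = \<ominus>\<^bsub>AQ A\<^esub> pair x y"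
  using pair_minus[of "\<zero>\<^bsub>L\<^esub>" x y] by (simp add: pair_zero M.minus_eq Q.minus_eq)

text \<open>In suggestive notation (x bar e)(e bar y) = (x bar y)(e bar e), a 2 by 2 minor. It
  yields both the product of the ideal with its conjugate and the comparison of inner
  products.\<close>

lemma pair_pair: "\<lbrakk>x \<in> carrier L; y \<in> carrier L\<rbrakk> \<Longrightarrow> pair x e \<star> cnjQ (pair y e) = pair x y \<star> pair e e"
  using arg_cong[OF rank_one_s[OF r1, of x e e y], of emb] e
  by (simp add: pair_bar AQ_of_mult emb_s Q.m_comm)

lemma inj_pair_e: "inj_on (\<lambda>x. pair x e) (carrier L)"
proof (rule inj_onI)
  fix x y assume xy: "x \<in> carrier L" "y \<in> carrier L" "pair x e = pair y e"
  define n where "n = x \<ominus>\<^bsub>L\<^esub> y"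
  have n: "n \<in> carrier L" "pair n e = \<zero>\<^bsub>AQ A\<^esub>" using xy e by (simp_all add: n_def pair_minus Q.minus_eq Q.r_neg)
  \<comment> \<open>Orthogonality to e forces \<open>pair n n\<close> times a unit to vanish, and
    definiteness of the form then gives n = 0.\<close>
  then have "pair n n \<star> pair e e = \<zero>\<^bsub>AQ A\<^esub>" using pair_pair[OF n(1) n(1)] e by simp
  then have "pair n n \<star> pair e e \<star> inv\<^bsub>AQ A\<^esub> pair e e = \<zero>\<^bsub>AQ A\<^esub>" using Q.Units_inv_closed[OF unit_e] by simp
  then have "pair n n = \<zero>\<^bsub>AQ A\<^esub>" using n e Q.Units_inv_closed[OF unit_e] Q.Units_r_inv[OF unit_e] by (simp add: Q.m_assoc)
  then have "n = \<zero>\<^bsub>L\<^esub>" using pair_self_zero n by simp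
  then have "x \<ominus>\<^bsub>L\<^esub> y \<oplus>\<^bsub>L\<^esub> y = y" using xy by (simp add: n_def)
  then show "x = y" using xy by (simp add: M.minus_eq M.a_assoc M.l_neg)
qed

lemma submodule_I_e: "Module.submodule I_e A (AQ_sub A QQ)"
proof (rule module.submoduleI[OF module_AQ_sub])
  show "I_e \<subseteq> carrier (AQ_sub A QQ)" using I_e_subset by simp
  show "\<zero>\<^bsub>AQ_sub A QQ\<^esub> \<in> I_e" using pair_zero[OF e] unfolding I_e_def AQ_sub_sel by (metis M.zero_closed imageI)
next
  fix a assume "a \<in> I_e"
  then obtain x where "x \<in> carrier L" "a = pair x e" by (auto simp: I_e_def)
  then show "\<ominus>\<^bsub>AQ_sub A QQ\<^esub> a \<in> I_e"
    using pair_uminus[of x e] e unfolding I_e_def by (simp add: AQ_sub_minus) (metis M.a_inv_closed imageI)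
next
  fix a b assume "a \<in> I_e" "b \<in> I_e"
  then obtain x y where "x \<in> carrier L" "a = pair x e" "y \<in> carrier L" "b = pair y e" by (auto simp: I_e_def)
  then show "a \<oplus>\<^bsub>AQ_sub A QQ\<^esub> b \<in> I_e"
    using pair_add[of x y e] e unfolding I_e_def by simp (metis M.a_closed imageI)
next
  fix a b assume a: "a \<in> carrier A" and "b \<in> I_e"
  then obtain x where "x \<in> carrier L" "b = pair x e" by (auto simp: I_e_def)
  then show "a \<odot>\<^bsub>AQ_sub A QQ\<^esub> b \<in> I_e"
    using pair_smult[of a x e] e a unfolding I_e_def by simp (metis smult_closed imageI)
qed

lemma fractional_ideal_I_e: "fractional_ideal A I_e"
  unfolding fractional_ideal_def
proof (intro conjI)
  show "Module.submodule I_e A (AQ_sub A QQ)" by (rule submodule_I_e)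
  show "\<exists>S. finite S \<and> S \<subseteq> I_e \<and> module_span A (AQ_sub A QQ) S = I_e"
  proof (rule lattice_span)
    fix S assume S: "finite S" "S \<subseteq> carrier L"
      "\<And>P x. \<lbrakk>P \<zero>\<^bsub>L\<^esub>; \<And>x y. \<lbrakk>x \<in> carrier L; y \<in> carrier L; P x; P y\<rbrakk> \<Longrightarrow> P (x \<ominus>\<^bsub>L\<^esub> y);
        \<And>x. x \<in> S \<Longrightarrow> P x; x \<in> carrier L\<rbrakk> \<Longrightarrow> P x"
    let ?S = "(\<lambda>x. pair x e) ` S"
    have "module_span A (AQ_sub A QQ) ?S = I_e"
      unfolding module_span_def
    proof (rule hull_unique)
      show "?S \<subseteq> I_e" using S(2) by (auto simp: I_e_def)
      fix N assume N: "?S \<subseteq> N" "Module.submodule N A (AQ_sub A QQ)"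
      note NE = module.submoduleE[OF module_AQ_sub N(2)]
      have NQ: "N \<subseteq> QQ" using NE(1) by simp
      have "pair x e \<in> N" if "x \<in> carrier L" for x
      proof (rule S(3)[OF _ _ _ that])
        show "pair \<zero>\<^bsub>L\<^esub> e \<in> N"
        proof -
          obtain v where v: "v \<in> N" using NE(2) by blast
          then have "\<zero> \<odot>\<^bsub>AQ_sub A QQ\<^esub> v \<in> N" by (intro NE(4)) auto
          then show ?thesis using v NQ e by (simp add: AQ_of_zero pair_zero subset_iff)
        qed
        show "pair (x \<ominus>\<^bsub>L\<^esub> y) e \<in> N" if "x \<in> carrier L" "y \<in> carrier L" "pair x e \<in> N" "pair y e \<in> N" for x y
          using NE(5)[OF that(3) NE(3)[OF that(4)]] that(1,2) e by (simp add: pair_minus Q.minus_eq AQ_sub_minus)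
        show "pair x e \<in> N" if "x \<in> S" for x using N(1) that by blast
      qed
      then show "I_e \<subseteq> N" by (auto simp: I_e_def)
    qed (rule submodule_I_e)
    then show "\<exists>S. finite S \<and> S \<subseteq> I_e \<and> module_span A (AQ_sub A QQ) S = I_e"
      using S(1,2) by (intro exI[of _ ?S]) (auto simp: I_e_def)
  qed
  show "module_span Q.rat_ring (AQ A) I_e = QQ"
    unfolding module_span_def
  proof (rule hull_unique)
    show "I_e \<subseteq> QQ" by (rule I_e_subset)
    show "Module.submodule QQ Q.rat_ring (AQ A)" by (rule module.carrier_is_submodule[OF Q.module_rat])
    fix N assume N: "I_e \<subseteq> N" "Module.submodule N Q.rat_ring (AQ A)"
    show "QQ \<subseteq> N"
    proof
      fix x assume x: "x \<in> QQ"
      let ?u = "pair e e"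
      have i: "inv\<^bsub>AQ A\<^esub> ?u \<in> QQ" using unit_e by simp
      have "x \<star> inv\<^bsub>AQ A\<^esub> ?u \<in> QQ" using x i by simp
      \<comment> \<open>The ideal contains the unit \<open>pair e e\<close>, so x is divided by it
        and the quotient written as a fraction a/m; x is then 1/m times the image of a e.\<close>
      then obtain a m where a: "a \<in> carrier A" "m \<noteq> 0" "x \<star> inv\<^bsub>AQ A\<^esub> ?u = qfrac A a m" by (rule qfrac_cases)
      have "x = x \<star> inv\<^bsub>AQ A\<^esub> ?u \<star> ?u" using x i e Q.Units_l_inv[OF unit_e] by (simp add: Q.m_assoc)
      also have "\<dots> = (1 / of_int m) \<odot>\<^bsub>AQ A\<^esub> pair (a \<odot>\<^bsub>L\<^esub> e) e"
        unfolding a(3) using a(1,2) e by (simp add: qfrac_eq_smult Q.smult_mult pair_smult)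
      finally have xe: "x = (1 / of_int m) \<odot>\<^bsub>AQ A\<^esub> pair (a \<odot>\<^bsub>L\<^esub> e) e" .
      have "pair (a \<odot>\<^bsub>L\<^esub> e) e \<in> N" using N(1) a e by (auto simp: I_e_def)
      then show "x \<in> N" unfolding xe by (intro module.submoduleE(4)[OF Q.module_rat N(2)]) auto
    qed
  qed
qed

text \<open>One inclusion is \<open>pair_pair\<close> with integrality of the pairing. For the
  other, multiplying the expression of 1 as a sum of pairings by a and by \<open>pair e e\<close>
  exhibits each multiple of \<open>pair e e\<close> as a sum of products.\<close>

lemma ideal_prod_I_e:
  assumes c0: "c0 \<in> Frag" "ev c0 = \<one>\<^bsub>AQ A\<^esub>"
  shows "ideal_prod (AQ A) I_e (cnjQ ` I_e) = principal_frac_ideal A (pair e e)"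
proof (intro equalityI subsetI)
  fix v assume "v \<in> ideal_prod (AQ A) I_e (cnjQ ` I_e)"
  then show "v \<in> principal_frac_ideal A (pair e e)"
  proof (induction rule: ideal_prod.induct)
    case (prod i j)
    then obtain x y where xy: "x \<in> carrier L" "i = pair x e" "y \<in> carrier L" "j = cnjQ (pair y e)" by (auto simp: I_e_def)
    then have "i \<star> j = emb (s x y) \<star> pair e e" by (simp add: pair_pair emb_s)
    then show ?case using xy by (auto simp: principal_frac_ideal_def)
  next
    case (sum v v')
    then obtain a b where "a \<in> carrier A" "b \<in> carrier A" "v = emb a \<star> pair e e" "v' = emb b \<star> pair e e"
      by (auto simp: principal_frac_ideal_def)
    then have "v \<oplus>\<^bsub>AQ A\<^esub> v' = emb (a \<oplus> b) \<star> pair e e" "a \<oplus> b \<in> carrier A" using e by (simp_all add: AQ_of_add Q.l_distr)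
    then show ?case by (auto simp: principal_frac_ideal_def)
  qed
next
  let ?P = "ideal_prod (AQ A) I_e (cnjQ ` I_e)"
  have ip: "pair x y \<star> pair e e \<in> ?P" if "x \<in> carrier L" "y \<in> carrier L" for x y
    unfolding pair_pair[OF that, symmetric] using that by (intro ideal_prod.prod) (auto simp: I_e_def)
  \<comment> \<open>\<open>ideal_prod\<close> is generated under sums only, whereas formal sums are
    built by differences; the induction therefore carries the negatives too.\<close>
  have "ev c \<star> pair e e \<in> ?P \<and> \<ominus>\<^bsub>AQ A\<^esub> (ev c \<star> pair e e) \<in> ?P" if "c \<in> Frag" for c
    using that
  proof (induction rule: Frag_induct)
    case zero
    then show ?case using ip[of "\<zero>\<^bsub>L\<^esub>" e] e by (simp add: pair_zero)
  next
    case (diff c d)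
    have eq: "ev (c - d) \<star> pair e e = ev c \<star> pair e e \<oplus>\<^bsub>AQ A\<^esub> \<ominus>\<^bsub>AQ A\<^esub> (ev d \<star> pair e e)"
      using diff e by (simp add: ev_diff Q.minus_eq Q.l_distr Q.l_minus)
    have eq': "\<ominus>\<^bsub>AQ A\<^esub> (ev (c - d) \<star> pair e e) = \<ominus>\<^bsub>AQ A\<^esub> (ev c \<star> pair e e) \<oplus>\<^bsub>AQ A\<^esub> ev d \<star> pair e e"
      unfolding eq using diff e by (simp add: Q.minus_add)
    show ?case unfolding eq' unfolding eq using diff(3,4) by (auto intro!: ideal_prod.sum)
  next
    case (frag_of x y)
    then show ?case using ip[of x y] ip[of "\<ominus>\<^bsub>L\<^esub> x" y] e by (simp add: pair_uminus Q.l_minus)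
  qed
  note P = this
  fix v assume "v \<in> principal_frac_ideal A (pair e e)"
  then obtain a where a: "a \<in> carrier A" "v = emb a \<star> pair e e" by (auto simp: principal_frac_ideal_def)
  then show "v \<in> ?P" using P[OF Frag_simps(5)[OF a(1) c0(1)]] ev_act[OF a(1) c0(1)] c0 by simp
qed

lemma isomorphic_I_e: "A_lattice_isomorphic A L (ideal_lattice A bar I_e (pair e e))"
  unfolding A_lattice_isomorphic_def
proof (intro bexI ballI)
  show "(\<lambda>x. pair x e) \<in> module_isos A L (ideal_lattice A bar I_e (pair e e))"
    using e inj_pair_e
    by (auto simp: module_isos_def iso_def hom_def bij_betw_def I_e_def pair_add pair_smult)
  fix x y assume xy: "x \<in> carrier L" "y \<in> carrier L"
  have "pair x e \<star> cnjQ (pair y e) \<star> inv\<^bsub>AQ A\<^esub> pair e e = pair x y"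
    using xy e unit_e by (simp add: pair_pair Q.m_assoc)
  then show "ip (ideal_lattice A bar I_e (pair e e)) (pair x e) (pair y e) = ip L x y"
    using xy trace_pair by simp
qed

end

end

section \<open>The two directions of the equivalence\<close>

context A_lattice
begin

lemma ideal_of_invertible:
  assumes "invertible_A_lattice A bar L"
  shows "\<exists>I w. fractional_ideal A I \<and> w \<in> totally_positive A \<and>
    ideal_prod (AQ A) I (cnjQ ` I) = principal_frac_ideal A w \<and>
    A_lattice_isomorphic A L (ideal_lattice A bar I w)"
proof -
  from assms[unfolded invertible_iff] interpret integral_A_lattice A bar L by unfold_locales blast
  from assms[unfolded invertible_iff] obtain c0 where c0: "c0 \<in> Frag" "ev c0 = \<one>\<^bsub>AQ A\<^esub>" by blast
  have r1: "rank_one"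
    using rank_one_if_injective[OF c0] assms[unfolded invertible_iff] by blast
  obtain e where e: "e \<in> carrier L" "\<And>\<psi>. \<psi> \<in> Q.chars \<Longrightarrow> \<psi> (pair e e) \<noteq> 0"
    using exists_nonvanishing[OF r1 c0] by blast
  have tp: "pair e e \<in> totally_positive A" by (rule pair_self_totally_positive) (use e in blast)+
  show ?thesis
    using fractional_ideal_I_e[OF r1 e(1) tp] tp ideal_prod_I_e[OF r1 e(1) tp c0] isomorphic_I_e[OF r1 e(1) tp] by blast
qed

lemma invertible_of_ideal:
  assumes I: "fractional_ideal A I" and w: "w \<in> totally_positive A"
    and prod: "ideal_prod (AQ A) I (cnjQ ` I) = principal_frac_ideal A w"
    and iso: "A_lattice_isomorphic A L (ideal_lattice A bar I w)"
  shows "invertible_A_lattice A bar L"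
proof -
  obtain f where f: "f \<in> module_isos A L (ideal_lattice A bar I w)"
    and ipf: "\<And>x y. \<lbrakk>x \<in> carrier L; y \<in> carrier L\<rbrakk> \<Longrightarrow> AQ_trace A (f x \<star> cnjQ (f y) \<star> inv\<^bsub>AQ A\<^esub> w) = ip L x y"
    using iso by (auto simp: A_lattice_isomorphic_def)
  have fI: "f ` carrier L = I" and finj: "inj_on f (carrier L)"
    and fsm: "\<And>a x. \<lbrakk>a \<in> carrier A; x \<in> carrier L\<rbrakk> \<Longrightarrow> f (a \<odot>\<^bsub>L\<^esub> x) = emb a \<star> f x"
    using f by (auto simp: module_isos_def iso_def bij_betw_def)
  have "I \<subseteq> QQ" using I module.submoduleE(1)[OF module_AQ_sub] by (auto simp: fractional_ideal_def)
  then have fQ [simp]: "f x \<in> QQ" if "x \<in> carrier L" for x using fI that by blast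
  note u = totally_positive_unit[OF w]
  have wQ [simp]: "w \<in> QQ" "inv\<^bsub>AQ A\<^esub> w \<in> QQ" using u(1) by auto
  have cancel: "a \<star> w \<star> inv\<^bsub>AQ A\<^esub> w = a" if "a \<in> QQ" for a using that u(1) by (simp add: Q.m_assoc)
  \<comment> \<open>The inner product of the ideal lattice is a trace, so the characterization of
    the pairing by traces identifies it with the product in \<open>AQ A\<close> divided by
    w.\<close>
  have pair: "pair x y = f x \<star> cnjQ (f y) \<star> inv\<^bsub>AQ A\<^esub> w" if xy: "x \<in> carrier L" "y \<in> carrier L" for x y
    using xy ipf by (intro pairI) (simp_all add: Q.m_assoc[symmetric] fsm[symmetric])
  interpret integral_A_lattice A bar L
  proof unfold_locales
    fix x y assume xy: "x \<in> carrier L" "y \<in> carrier L"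
    then have "f x \<star> cnjQ (f y) \<in> principal_frac_ideal A w"
      unfolding prod[symmetric] fI[symmetric] by (intro ideal_prod.prod) auto
    then obtain a where "a \<in> carrier A" "f x \<star> cnjQ (f y) = emb a \<star> w" by (auto simp: principal_frac_ideal_def)
    then show "pair x y \<in> emb ` carrier A" using pair[OF xy] cancel[of "emb a"] by simp
  qed
  have r1: "rank_one"
    unfolding rank_one_def
  proof (intro ballI)
    fix x y z assume xyz: "x \<in> carrier L" "y \<in> carrier L" "z \<in> carrier L"
    show "s x y \<odot>\<^bsub>L\<^esub> z = s z y \<odot>\<^bsub>L\<^esub> x"
    proof (rule inj_onD[OF finj])
      \<comment> \<open>In \<open>AQ A\<close> the factors f x and f z may simply be exchanged;
        injectivity of f brings the identity back to \<open>L\<close>.\<close>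
      have "f (s x y \<odot>\<^bsub>L\<^esub> z) = f x \<star> cnjQ (f y) \<star> inv\<^bsub>AQ A\<^esub> w \<star> f z" using xyz by (simp add: fsm emb_s pair)
      also have "\<dots> = f z \<star> cnjQ (f y) \<star> inv\<^bsub>AQ A\<^esub> w \<star> f x" using xyz by (simp add: Q.m_ac)
      also have "\<dots> = f (s z y \<odot>\<^bsub>L\<^esub> x)" using xyz by (simp add: fsm emb_s pair)
      finally show "f (s x y \<odot>\<^bsub>L\<^esub> z) = f (s z y \<odot>\<^bsub>L\<^esub> x)" .
    qed (use xyz in auto)
  qed
  \<comment> \<open>Dividing by w turns sums of products from I and its conjugate into values of
    \<open>ev\<close>; applied to w itself this produces a preimage of 1. Membership in the carrier
    is kept for distributivity.\<close>
  have "\<exists>c\<in>Frag. ev c = v \<star> inv\<^bsub>AQ A\<^esub> w \<and> v \<in> QQ" if "v \<in> ideal_prod (AQ A) I (cnjQ ` I)" for v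
    using that
  proof (induction rule: ideal_prod.induct)
    case (prod i j)
    then obtain x y where xy: "x \<in> carrier L" "i = f x" "y \<in> carrier L" "j = cnjQ (f y)" unfolding fI[symmetric] by auto
    then show ?case by (intro bexI[of _ "frag_of (x, y)"]) (simp_all add: pair)
  next
    case (sum v v')
    then obtain c d where cd: "c \<in> Frag" "ev c = v \<star> inv\<^bsub>AQ A\<^esub> w" "v \<in> QQ" "d \<in> Frag" "ev d = v' \<star> inv\<^bsub>AQ A\<^esub> w" "v' \<in> QQ" by blast
    then show ?case by (intro bexI[of _ "c + d"]) (simp_all add: ev_add Q.l_distr)
  qed
  moreover have "w \<in> ideal_prod (AQ A) I (cnjQ ` I)"
    unfolding prod principal_frac_ideal_def by (rule image_eqI[of _ _ \<one>]) (simp_all add: AQ_of_one)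
  ultimately obtain c0 where c0: "c0 \<in> Frag" "ev c0 = \<one>\<^bsub>AQ A\<^esub>" using u(1) by fastforce
  then show ?thesis
    unfolding invertible_iff using pair_integral injective_if_rank_one[OF r1 c0] by blast
qed

end

theorem theorem10p3:
  fixes A :: "('a, 'c) ring_scheme" and bar :: "'a \<Rightarrow> 'a" and L :: "('a, 'b) form_module"
  assumes "cm_order A bar" and "A_lattice A bar L"
  shows "invertible_A_lattice A bar L \<longleftrightarrow>
    (\<exists>I w. fractional_ideal A I \<and> w \<in> totally_positive A \<and>
       ideal_prod (AQ A) I (AQ_bar A bar ` I) = principal_frac_ideal A w \<and>
       A_lattice_isomorphic A L (ideal_lattice A bar I w))"
proof -
  interpret A_lattice A bar L by (rule assms(2))
  show ?thesis using ideal_of_invertible invertible_of_ideal by blast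
qed

end
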